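(* Let $P,Q\in D_1$ be differential operators with $\operatorname{ord}(P)=\mathbf{ord}(P)=p=nd$, $\sigma(P)=\partial^{p}$, $\operatorname{ord}(Q)=\mathbf{ord}(Q)=q=md$, where $(m,n)=1$, and $[Q,P]=1$. Assume that there exists a head-chopping sequence $Q_i=F_i(P,Q)$, $i=0,\ldots,I$, with $\operatorname{ord}(Q_i)=\mathbf{ord}(Q_i)$ for all $i$, such that $SeqGCD_I(P,Q)=1$ and $SeqGCD_{I-1}(P,Q)>1$. Let $\tilde Q=S^{-1}QS$ be a normal form of $Q$ with respect to $P$, where $S$ is a monic Schur operator for $P$. Then the pair $(\partial^p,\tilde Q-\tilde Q_{-p})$ is a normal form of a commuting pair of formally elliptic differential operators $P',Q'\in D_1$, where $P'$ is monic and normalized, $\operatorname{ord}(P')=p$, $\operatorname{ord}(Q')=q$, and $\operatorname{rk}(K[P',Q'])=1$ (i.e. $\tilde Q-\tilde Q_{-p}$ is a normal form of $Q'$ with respect to $P'$). Moreover, with $\tilde Q'=\tilde Q-\tilde Q_{-p}$, the pair $(\partial^p,\tilde Q')$ has a head-chopping sequence $\tilde Q'_i=F_i(\partial^p,\tilde Q')$ with $\sigma(\tilde Q'_i)=\tilde c_i\partial^{\mathbf{ord}(\tilde Q'_i)}$, $\tilde c_i\in K^*$, which has the same sequence $(\mathbf{ord}(\tilde Q_i'),\tilde c_i)$ as $(P,Q)$, and the affine spectral curve of $K[P',Q']$ is given by a polynomial of Burchnall–Chaundy type of distance $\le p+q-1$.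
   Context: $K=\mathbb{C}$ (or any algebraically closed field of characteristic zero). $D_1=K[[x]][\partial]$; $\operatorname{ord}(P)$ is the degree of $P\in D_1$ in $\partial$. $\hat D_1^{sym}$ is the ring (multiplication extending that of $D_1$) of formal series $P=\sum_{k\ge0}a_k\partial^k$, $a_k\in K[[x]]$, with $\mathbf{ord}(P):=\sup_k\{k-v(a_k)\}<\infty$, $v$ the $x$-adic valuation. Writing $P=\sum\alpha_{k,i}x^i\partial^k$, its $m$-th homogeneous component is $P_m=\sum_{k-i=m}\alpha_{k,i}x^i\partial^k$, and $\sigma(P)=P_{\mathbf{ord}(P)}$. $S\in\hat D_1^{sym}$ of order $0$ is monic if $S_0=1$. $P\in D_1$ is monic if its highest coefficient is $1$, formally elliptic if its highest coefficient lies in $K^*$, normalized if $P=\partial^p+a_{p-2}\partial^{p-2}+\ldots+a_0$. Schur operator for $P\in D_1$ with $\operatorname{ord}(P)=\mathbf{ord}(P)=p$, $\sigma(P)=\partial^p$: an invertible $S\in\hat D_1^{sym}$, $\mathbf{ord}(S)=0$, with $S^{-1}PS=\partial^p$. The operator $S^{-1}QS$ is then called a normal form of $Q$ with respect to $P$. Convention: $(m,n)=1$ means $GCD(m,n)=1$ and $m,n>1$. Head-chopping sequence for $(P,Q)$ in $D_1$ or in $\hat D_1^{sym}$ with $[Q,P]\in\{0,1\}$: natural numbers $n_i,m_i$ and $\varepsilon_i\in K$, with $Q_0=Q$, $Q_{i+1}=Q_i^{n_i}-\varepsilon_i^{n_i}P^{m_i}$, $0\le i<I$, chosen so that the leading term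 cancels, $\mathbf{ord}(Q_{i+1})<\mathbf{ord}(Q_i^{n_i})$; one writes $Q_i=F_i(P,Q)$ with $F_0=Y$, $F_{i+1}=F_i^{n_i}-\varepsilon_i^{n_i}X^{m_i}$. If $\operatorname{ord}(Q_i)=\mathbf{ord}(Q_i)$ then $\sigma(Q_i)=c_i\partial^{\mathbf{ord}(Q_i)}$, $c_i\in K^*$, and the list of pairs $(\mathbf{ord}(Q_i),c_i)$, $i=0,\ldots,I$, is called the sequence of $(P,Q)$. $SeqGCD_i(P,Q):=GCD(\mathbf{ord}(P),\mathbf{ord}(Q_0),\ldots,\mathbf{ord}(Q_i))$. The rank of a commutative subring $B\subset D_1$ is $\operatorname{rk}B=GCD\{\operatorname{ord}(L):L\in B\}$. Its affine spectral curve is $\operatorname{Spec}B$; for $B=K[P',Q']$ it is the plane curve given by the irreducible algebraic relation $f(Q',P')=0$. An irreducible polynomial $f(X,Y)\in K[X,Y]$ is of Burchnall–Chaundy type if $f=(\alpha X^n+Y^m)^d+\ldots$ with $\alpha\in K^*$, $m,n$ coprime, $d\ge1$, where $\ldots$ are terms of lower weighted degree (weights $m$ for $X$, $n$ for $Y$), and the affine curve $f=0$ can be compactified by one regular $K$-point. Let $Y=z^{-nd}$, $X=c_{-md}z^{-md}+c_{n_1}z^{n_1}+c_{n_2}z^{n_2}+\ldots\in K((z))$ (non-zero coefficients, increasing exponents) be a Puiseux solution of $f(X,Y)=0$, and let $n_l$ be the first exponent with $GCD(d,n_1,\ldots,n_l)=1$. The distance of $f$ is $md+n_l$, i.e. the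 difference between the order $md$ of $X$ in $z^{-1}$ and the order $-n_l$ of that term. *)

theory Defs
  imports "HOL-Computational_Algebra.Computational_Algebra"
begin

section \<open>The ring of formal operators with bounded order\<close>

text \<open>
  An element is the sequence of coefficients \<open>(a\<^sub>k)\<close> of \<open>\<Sum>k. a\<^sub>k \<partial>\<^sup>k\<close>. With
  \<open>a\<^sub>k = \<Sum>i. \<alpha>\<^sub>k\<^sub>,\<^sub>i x\<^sup>i\<close>, finiteness of \<open>sup (k - v(a\<^sub>k))\<close> says that \<open>k - i\<close> is bounded above
  on the support of \<open>\<alpha>\<close>.
\<close>

typedef (overloaded) 'a dsym =
    "{a :: nat \<Rightarrow> 'a::zero fps. \<exists>r::nat. \<forall>k i. a k $ i \<noteq> 0 \<longrightarrow> k \<le> i + r}"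
  morphisms dcoeff Abs_dsym
  by (rule exI[of _ "\<lambda>_. 0"]) auto

setup_lifting type_definition_dsym

lemma dsym_eqI: "(\<And>k. dcoeff A k = dcoeff B k) \<Longrightarrow> A = B"
  by (metis dcoeff_inject ext)

lemma dcoeff_bounded:
  fixes A :: "'a::zero dsym"
  obtains r where "\<And>k i. i + r < k \<Longrightarrow> dcoeff A k $ i = 0"
proof -
  have "\<exists>r::nat. \<forall>k i. dcoeff A k $ i \<noteq> 0 \<longrightarrow> k \<le> i + r"
    using dcoeff[of A] by simp
  then show ?thesis using that by (metis not_le)
qed

instantiation dsym :: (field_char_0) "{zero, one, plus, minus, uminus}"
begin

lift_definition zero_dsym :: "'a dsym" is "\<lambda>_. 0" by simp

lift_definition one_dsym :: "'a dsym" is "\<lambda>k. if k = 0 then 1 else 0" by auto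

lift_definition plus_dsym :: "'a dsym \<Rightarrow> 'a dsym \<Rightarrow> 'a dsym" is "\<lambda>a b k. a k + b k"
proof -
  fix a b :: "nat \<Rightarrow> 'a fps"
  assume "\<exists>r::nat. \<forall>k i. a k $ i \<noteq> 0 \<longrightarrow> k \<le> i + r" "\<exists>r::nat. \<forall>k i. b k $ i \<noteq> 0 \<longrightarrow> k \<le> i + r"
  then obtain r s :: nat where "\<forall>k i. a k $ i \<noteq> 0 \<longrightarrow> k \<le> i + r" "\<forall>k i. b k $ i \<noteq> 0 \<longrightarrow> k \<le> i + s"
    by auto
  then have "\<forall>k i. (a k + b k) $ i \<noteq> 0 \<longrightarrow> k \<le> i + (r + s)"
    by (metis add_0 add.assoc fps_add_nth trans_le_add1 add.commute)
  then show "\<exists>r::nat. \<forall>k i. (a k + b k) $ i \<noteq> 0 \<longrightarrow> k \<le> i + r" by blast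
qed

lift_definition uminus_dsym :: "'a dsym \<Rightarrow> 'a dsym" is "\<lambda>a k. - a k" by simp

definition minus_dsym :: "'a dsym \<Rightarrow> 'a dsym \<Rightarrow> 'a dsym" where "minus_dsym A B = A + (- B)"

instance ..

end

lemma dcoeff_add [simp]: "dcoeff (A + B) k = dcoeff A k + dcoeff B k"
  by transfer simp
lemma dcoeff_uminus [simp]: "dcoeff (- A) k = - dcoeff A k"
  by transfer simp
lemma dcoeff_minus [simp]: "dcoeff (A - B) k = dcoeff A k - dcoeff B k"
  by (simp add: minus_dsym_def)
lemma dcoeff_0 [simp]: "dcoeff 0 k = 0"
  by transfer simp
lemma dcoeff_1: "dcoeff 1 k = (if k = 0 then 1 else 0)"
  by transfer simp

instance dsym :: (field_char_0) ab_group_add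
  by standard (auto intro!: dsym_eqI)

subsection \<open>Multiplication\<close>

text \<open>
  \<open>(a \<partial>\<^sup>k) (b \<partial>\<^sup>l) = \<Sum>j\<le>k. (k choose j) a b\<^sup>(\<^sup>j\<^sup>) \<partial>\<^sup>l\<^sup>+\<^sup>k\<^sup>-\<^sup>j\<close>; below \<open>dmul_term b k m\<close> collects the
  contributions of \<open>\<partial>\<^sup>k (\<Sum>l. b\<^sub>l \<partial>\<^sup>l)\<close> to the coefficient of \<open>\<partial>\<^sup>m\<close>. The sum over \<open>k\<close> is infinite
  and converges in the \<open>x\<close>-adic topology, the topology of the library on
  \<^typ>\<open>'a fps\<close>; see \<open>dmul_coeff_nth\<close>.
\<close>

definition dmul_term :: "(nat \<Rightarrow> 'a::field_char_0 fps) \<Rightarrow> nat \<Rightarrow> nat \<Rightarrow> 'a fps" where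
  "dmul_term b k m =
     (\<Sum>j | j \<le> k \<and> k - j \<le> m. of_nat (k choose j) * fps_nth_deriv j (b (m - (k - j))))"

definition dmul_coeff ::
  "(nat \<Rightarrow> 'a::field_char_0 fps) \<Rightarrow> (nat \<Rightarrow> 'a fps) \<Rightarrow> nat \<Rightarrow> 'a fps" where
  "dmul_coeff a b m = (\<Sum>k. a k * dmul_term b k m)"

lemma suminf_fps_nth:
  fixes F :: "nat \<Rightarrow> 'a::ring_1 fps"
  assumes ex: "\<And>i. \<exists>N. \<forall>k\<ge>N. F k $ i = 0" and N: "\<And>k. k \<ge> N \<Longrightarrow> F k $ i = 0"
  shows "suminf F $ i = (\<Sum>k<N. F k $ i)"
proof -
  obtain M where M: "\<And>i k. k \<ge> M i \<Longrightarrow> F k $ i = 0"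
    using ex by metis
  define G where "G = Abs_fps (\<lambda>i. \<Sum>k<M i. F k $ i)"
  have stab: "(\<Sum>k<n. F k $ j) = (\<Sum>k<n'. F k $ j)"
    if "n \<le> n'" "\<And>k. k \<ge> n \<Longrightarrow> F k $ j = 0" for n n' j
    using that by (intro sum.mono_neutral_left) auto
  have "(\<lambda>n. \<Sum>k<n. F k) \<longlonglongrightarrow> G"
  proof (rule tendsto_fpsI)
    fix j
    have "(\<Sum>k<n. F k) $ j = G $ j" if "n \<ge> M j" for n
      using stab[OF that M] by (simp add: G_def fps_sum_nth)
    then show "\<forall>\<^sub>F n in sequentially. (\<Sum>k<n. F k) $ j = G $ j"
      by (auto simp: eventually_sequentially)
  qed
  then have "suminf F = G" by (simp add: sums_def sums_unique[symmetric])
  moreover have "(\<Sum>k<M i. F k $ i) = (\<Sum>k<N. F k $ i)"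
    using stab[of "M i" "N + M i" i] stab[of N "N + M i" i] M N by auto
  ultimately show ?thesis by (simp add: G_def)
qed

lemma fps_nth_deriv_nth_eq_0:
  "(\<And>s. s \<le> i + j \<Longrightarrow> f $ s = 0) \<Longrightarrow> fps_nth_deriv j f $ i = 0"
proof (induction j arbitrary: f)
  case (Suc j)
  have "fps_deriv f $ s = 0" if "s \<le> i + j" for s
    using Suc.prems[of "Suc s"] that by (simp add: fps_deriv_def)
  then show ?case using Suc.IH by simp
qed simp

lemma dmul_term_nth_eq_0:
  assumes b: "\<And>k i. i + r < k \<Longrightarrow> b k $ i = 0" and "u + r + k < m"
  shows "dmul_term b k m $ u = 0"
proof -
  have "fps_nth_deriv j (b (m - (k - j))) $ u = 0" if "j \<le> k" "k - j \<le> m" for j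
    by (rule fps_nth_deriv_nth_eq_0, rule b) (use assms that in auto)
  then show ?thesis
    by (auto simp: dmul_term_def fps_sum_nth fps_of_nat[symmetric] intro!: sum.neutral)
qed

lemma dmul_term_nth_eq_0':
  assumes b: "\<And>k i. i + r < k \<Longrightarrow> b k $ i = 0" and "u + r + k < m"
  shows "v \<le> u \<Longrightarrow> dmul_term b k m $ v = 0"
  using dmul_term_nth_eq_0[of r b v k m] assms by auto

lemma dmul_summand_eq_0:
  assumes a: "\<And>k i. i + r < k \<Longrightarrow> a k $ i = 0" and "i + r < k"
  shows "(a k * g) $ i = (0::'a::field_char_0)"
  unfolding fps_mult_nth
proof (rule sum.neutral, safe)
  fix j assume "j \<in> {0..i}"
  then show "a k $ j * g $ (i - j) = 0" using a[of j k] assms(2) by simp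
qed

lemma dmul_coeff_nth:
  assumes a: "\<And>k i. i + r < k \<Longrightarrow> a k $ i = 0" and N: "i + r < N"
  shows "dmul_coeff a b m $ i = (\<Sum>k<N. (a k * dmul_term b k m) $ i)"
  unfolding dmul_coeff_def
proof (rule suminf_fps_nth)
  show "\<exists>N. \<forall>k\<ge>N. (a k * dmul_term b k m) $ i = 0" for i
    by (rule exI[of _ "i + r + 1"]) (auto intro!: dmul_summand_eq_0 a)
  show "(a k * dmul_term b k m) $ i = 0" if "k \<ge> N" for k
    using that N by (intro dmul_summand_eq_0 a) auto
qed

lemma dmul_coeff_bounded:
  assumes a: "\<And>k i. i + r < k \<Longrightarrow> a k $ i = 0" and b: "\<And>k i. i + s < k \<Longrightarrow> b k $ i = 0"
    and m: "i + (r + s) < m"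
  shows "dmul_coeff a b m $ i = 0"
proof -
  have "a k $ t * dmul_term b k m $ (i - t) = 0" if "t \<le> i" for k t
  proof (cases "t + r < k")
    case False
    then have "dmul_term b k m $ (i - t) = 0"
      using that m by (intro dmul_term_nth_eq_0[of s b]) (auto simp: b)
    then show ?thesis by simp
  qed (simp add: a)
  then have "(a k * dmul_term b k m) $ i = 0" for k
    by (auto simp: fps_mult_nth intro!: sum.neutral)
  then show ?thesis
    using dmul_coeff_nth[of r a i "i + r + 1" b m] a by simp
qed

instantiation dsym :: (field_char_0) times
begin

lift_definition times_dsym :: "'a dsym \<Rightarrow> 'a dsym \<Rightarrow> 'a dsym" is dmul_coeff
proof -
  fix a b :: "nat \<Rightarrow> 'a fps"
  assume "\<exists>r::nat. \<forall>k i. a k $ i \<noteq> 0 \<longrightarrow> k \<le> i + r" "\<exists>r::nat. \<forall>k i. b k $ i \<noteq> 0 \<longrightarrow> k \<le> i + r"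
  then obtain r s :: nat
    where "\<And>k i. i + r < k \<Longrightarrow> a k $ i = 0" "\<And>k i. i + s < k \<Longrightarrow> b k $ i = 0"
    by (metis not_le)
  then have "\<forall>k i. dmul_coeff a b k $ i \<noteq> 0 \<longrightarrow> k \<le> i + (r + s)"
    using dmul_coeff_bounded[of r a s b] by (meson not_le)
  then show "\<exists>r::nat. \<forall>k i. dmul_coeff a b k $ i \<noteq> 0 \<longrightarrow> k \<le> i + r" by blast
qed

instance ..

end

lemma dcoeff_mult: "dcoeff (A * B) m = (\<Sum>k. dcoeff A k * dmul_term (dcoeff B) k m)"
  by (simp add: times_dsym.rep_eq dmul_coeff_def)

subsection \<open>The faithful action on power series\<close>

definition dact :: "'a::field_char_0 dsym \<Rightarrow> 'a fps \<Rightarrow> 'a fps" where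
  "dact A f = (\<Sum>k. dcoeff A k * fps_nth_deriv k f)"

lemma dact_nth:
  assumes a: "\<And>k i. i + r < k \<Longrightarrow> dcoeff A k $ i = 0" and N: "i + r < N"
  shows "dact A f $ i = (\<Sum>k<N. (dcoeff A k * fps_nth_deriv k f) $ i)"
  unfolding dact_def
proof (rule suminf_fps_nth)
  show "\<exists>N. \<forall>k\<ge>N. (dcoeff A k * fps_nth_deriv k f) $ i = 0" for i
    by (rule exI[of _ "i + r + 1"]) (auto intro!: dmul_summand_eq_0 a)
  show "(dcoeff A k * fps_nth_deriv k f) $ i = 0" if "k \<ge> N" for k
    using that N by (intro dmul_summand_eq_0 a) auto
qed

lemma fps_nth_deriv_add_order: "fps_nth_deriv j (fps_nth_deriv k f) = fps_nth_deriv (j + k) f"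
  by (induction k arbitrary: f j) auto

lemma fps_nth_deriv_mult:
  fixes f g :: "'a::field_char_0 fps"
  shows "fps_nth_deriv k (f * g) =
    (\<Sum>j\<le>k. of_nat (k choose j) * fps_nth_deriv j f * fps_nth_deriv (k - j) g)"
proof (induction k)
  case (Suc k)
  let ?D = "fps_nth_deriv :: nat \<Rightarrow> 'a fps \<Rightarrow> 'a fps"
  have D: "fps_deriv (?D j h) = ?D (Suc j) h" for j h by (simp only: fps_nth_deriv_commute)
  have "?D (Suc k) (f * g) =
      fps_deriv (\<Sum>j\<le>k. of_nat (k choose j) * ?D j f * ?D (k - j) g)"
    by (simp only: fps_nth_deriv_commute Suc.IH)
  also have "\<dots> = (\<Sum>j\<le>k. of_nat (k choose j) * ?D j f * ?D (Suc k - j) g)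
      + (\<Sum>j\<le>k. of_nat (k choose j) * ?D (Suc j) f * ?D (k - j) g)"
    unfolding fps_deriv_sum sum.distrib[symmetric]
    by (intro sum.cong refl)
      (simp add: D Suc_diff_le algebra_simps fps_of_nat[symmetric] del: fps_nth_deriv.simps)
  also have "(\<Sum>j\<le>k. of_nat (k choose j) * ?D j f * ?D (Suc k - j) g)
      = f * ?D (Suc k) g + (\<Sum>j\<le>k. of_nat (k choose Suc j) * ?D (Suc j) f * ?D (k - j) g)"
  proof -
    have "(\<Sum>j\<le>k. of_nat (k choose j) * ?D j f * ?D (Suc k - j) g)
        = (\<Sum>j\<le>Suc k. of_nat (k choose j) * ?D j f * ?D (Suc k - j) g)"
      by (simp del: fps_nth_deriv.simps(2))
    also have "\<dots> = f * ?D (Suc k) g + (\<Sum>j\<le>k. of_nat (k choose Suc j) * ?D (Suc j) f * ?D (k - j) g)"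
      by (subst sum.atMost_Suc_shift) (simp del: fps_nth_deriv.simps(2))
    finally show ?thesis .
  qed
  also have "f * ?D (Suc k) g + (\<Sum>j\<le>k. of_nat (k choose Suc j) * ?D (Suc j) f * ?D (k - j) g)
      + (\<Sum>j\<le>k. of_nat (k choose j) * ?D (Suc j) f * ?D (k - j) g)
      = (\<Sum>j\<le>Suc k. of_nat (Suc k choose j) * ?D j f * ?D (Suc k - j) g)"
    by (subst sum.atMost_Suc_shift)
      (simp add: sum.distrib algebra_simps del: fps_nth_deriv.simps(2))
  finally show ?case .
qed simp

lemma dact_mult:
  fixes A B :: "'a::field_char_0 dsym"
  shows "dact (A * B) f = dact A (dact B f)"
proof (rule fps_ext)
  fix s
  let ?D = "fps_nth_deriv :: nat \<Rightarrow> 'a fps \<Rightarrow> 'a fps"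
  let ?a = "dcoeff A" and ?b = "dcoeff B"
  obtain r where a: "\<And>k i. i + r < k \<Longrightarrow> ?a k $ i = 0" using dcoeff_bounded[of A] by blast
  obtain r' where b: "\<And>k i. i + r' < k \<Longrightarrow> ?b k $ i = 0" using dcoeff_bounded[of B] by blast
  have ab: "dcoeff (A * B) k $ i = 0" if "i + (r + r') < k" for k i
    using dmul_coeff_bounded[of r ?a r' ?b i k] a b that by (simp add: times_dsym.rep_eq)
  define N where "N = s + r + 1"
  define L where "L = s + N + r' + 1"
  define M where "M = L + N + (s + (r + r') + 1)"
  have inner: "(\<Sum>m<M. dmul_term ?b k m * ?D m f) $ u = ?D k (dact B f) $ u"
    if u: "u \<le> s" and k: "k < N" for u k
  proof -
    let ?F = "\<lambda>j l. of_nat (k choose j) * ?D j (?b l) * ?D (k - j + l) f"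
    have F0: "?F j l $ u = 0" if "j \<le> k" "L \<le> l" for j l
    proof -
      have "?D j (?b l) $ t = 0" if "t \<le> u" for t
        by (rule fps_nth_deriv_nth_eq_0, rule b)
          (use that \<open>u \<le> s\<close> \<open>k < N\<close> \<open>j \<le> k\<close> \<open>L \<le> l\<close> in \<open>auto simp: L_def\<close>)
      then have "(?D j (?b l) * ?D (k - j + l) f) $ u = 0"
        by (auto simp: fps_mult_nth intro!: sum.neutral)
      then show ?thesis by (simp add: mult.assoc fps_of_nat[symmetric])
    qed
    have "(\<Sum>m<M. dmul_term ?b k m * ?D m f) =
        (\<Sum>m<M. \<Sum>j\<le>k. if k - j \<le> m then ?F j (m - (k - j)) else 0)"
    proof (rule sum.cong[OF refl])
      fix m
      have eq: "{j. j \<le> k \<and> k - j \<le> m} = {j \<in> {..k}. k - j \<le> m}" by auto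
      show "dmul_term ?b k m * ?D m f =
          (\<Sum>j\<le>k. if k - j \<le> m then ?F j (m - (k - j)) else 0)"
        unfolding dmul_term_def sum_distrib_right eq
        by (subst sum.inter_filter) (auto intro!: sum.cong)
    qed
    also have "\<dots> = (\<Sum>j\<le>k. \<Sum>m<M. if k - j \<le> m then ?F j (m - (k - j)) else 0)"
      by (rule sum.swap)
    also have "\<dots> = (\<Sum>j\<le>k. \<Sum>l<M - (k - j). ?F j l)"
    proof (rule sum.cong[OF refl])
      fix j
      have "(\<Sum>m<M. if k - j \<le> m then ?F j (m - (k - j)) else 0)
          = (\<Sum>m\<in>{m \<in> {..<M}. k - j \<le> m}. ?F j (m - (k - j)))"
        by (subst sum.inter_filter) auto
      also have "\<dots> = (\<Sum>l<M - (k - j). ?F j l)"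
        by (rule sum.reindex_bij_witness[of _ "\<lambda>l. l + (k - j)" "\<lambda>m. m - (k - j)"]) auto
      finally show "(\<Sum>m<M. if k - j \<le> m then ?F j (m - (k - j)) else 0)
          = (\<Sum>l<M - (k - j). ?F j l)" .
    qed
    finally have "(\<Sum>m<M. dmul_term ?b k m * ?D m f) $ u
        = (\<Sum>j\<le>k. \<Sum>l<M - (k - j). ?F j l $ u)"
      by (simp only: fps_sum_nth)
    also have "\<dots> = (\<Sum>j\<le>k. \<Sum>l<L. ?F j l $ u)"
    proof (rule sum.cong[OF refl])
      fix j assume "j \<in> {..k}"
      then show "(\<Sum>l<M - (k - j). ?F j l $ u) = (\<Sum>l<L. ?F j l $ u)"
        using k F0[of j] by (intro sum.mono_neutral_right) (auto simp: M_def)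
    qed
    also have "\<dots> = (\<Sum>l<L. \<Sum>j\<le>k. ?F j l $ u)" by (rule sum.swap)
    also have "\<dots> = ?D k (\<Sum>l<L. ?b l * ?D l f) $ u"
      by (simp add: fps_nth_deriv_sum fps_nth_deriv_mult fps_sum_nth fps_nth_deriv_add_order)
    also have "\<dots> = ?D k (dact B f) $ u"
    proof -
      have "?D k (dact B f - (\<Sum>l<L. ?b l * ?D l f)) $ u = 0"
      proof (rule fps_nth_deriv_nth_eq_0)
        fix t assume "t \<le> u + k"
        then have "dact B f $ t = (\<Sum>l<L. (?b l * ?D l f) $ t)"
          using u k by (intro dact_nth[of r'] b) (auto simp: L_def)
        then show "(dact B f - (\<Sum>l<L. ?b l * ?D l f)) $ t = 0" by (simp add: fps_sum_nth)
      qed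
      then show ?thesis by simp
    qed
    finally show ?thesis .
  qed
  have coeff: "dcoeff (A * B) m $ u = (\<Sum>k<N. (?a k * dmul_term ?b k m) $ u)" if "u \<le> s" for m u
    using that unfolding times_dsym.rep_eq by (intro dmul_coeff_nth[of r] a) (auto simp: N_def)
  have "dact (A * B) f $ s = (\<Sum>m<M. (dcoeff (A * B) m * ?D m f) $ s)"
    by (rule dact_nth[of "r + r'"]) (auto simp: ab M_def)
  also have "\<dots> = (\<Sum>m<M. ((\<Sum>k<N. ?a k * dmul_term ?b k m) * ?D m f) $ s)"
    by (intro sum.cong refl) (simp add: fps_mult_nth[of _ "?D _ f"] coeff fps_sum_nth)
  also have "\<dots> = (\<Sum>k<N. (?a k * (\<Sum>m<M. dmul_term ?b k m * ?D m f)) $ s)"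
    by (simp add: sum_distrib_right sum_distrib_left fps_sum_nth mult.assoc)
      (rule sum.swap)
  also have "\<dots> = (\<Sum>k<N. (?a k * ?D k (dact B f)) $ s)"
    by (intro sum.cong refl) (simp add: fps_mult_nth[of "?a _"] inner)
  also have "\<dots> = dact A (dact B f) $ s"
    by (rule dact_nth[of r, symmetric]) (auto simp: a N_def)
  finally show "dact (A * B) f $ s = dact A (dact B f) $ s" .
qed

lemma dact_add: "dact (A + B) f = dact A f + dact B f"
proof (rule fps_ext)
  fix s
  obtain r where a: "\<And>k i. i + r < k \<Longrightarrow> dcoeff A k $ i = 0" using dcoeff_bounded[of A] by blast
  obtain r' where b: "\<And>k i. i + r' < k \<Longrightarrow> dcoeff B k $ i = 0" using dcoeff_bounded[of B] by blast
  let ?N = "s + (r + r') + 1"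
  have "dact (A + B) f $ s = (\<Sum>k<?N. (dcoeff (A + B) k * fps_nth_deriv k f) $ s)"
    by (rule dact_nth[of "r + r'"]) (auto simp: a b)
  moreover have "dact A f $ s = (\<Sum>k<?N. (dcoeff A k * fps_nth_deriv k f) $ s)"
    by (rule dact_nth[of r]) (auto simp: a)
  moreover have "dact B f $ s = (\<Sum>k<?N. (dcoeff B k * fps_nth_deriv k f) $ s)"
    by (rule dact_nth[of r']) (auto simp: b)
  ultimately show "dact (A + B) f $ s = (dact A f + dact B f) $ s"
    by (simp add: distrib_right sum.distrib)
qed

lemma dact_fun_add: "dact A (f + g) = dact A f + dact A g"
proof (rule fps_ext)
  fix s
  obtain r where a: "\<And>k i. i + r < k \<Longrightarrow> dcoeff A k $ i = 0" using dcoeff_bounded[of A] by blast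
  have "dact A h $ s = (\<Sum>k<s + r + 1. (dcoeff A k * fps_nth_deriv k h) $ s)" for h
    by (rule dact_nth[of r]) (auto simp: a)
  then show "dact A (f + g) $ s = (dact A f + dact A g) $ s"
    by (simp add: distrib_left sum.distrib)
qed

lemma dact_1: "dact 1 f = f"
proof (rule fps_ext)
  fix s
  have "dact 1 f $ s = (\<Sum>k<s + 0 + 1. (dcoeff 1 k * fps_nth_deriv k f) $ s)"
    by (rule dact_nth[of 0]) (auto simp: dcoeff_1)
  also have "\<dots> = (\<Sum>k\<in>{0}. (dcoeff 1 k * fps_nth_deriv k f) $ s)"
    by (rule sum.mono_neutral_right) (auto simp: dcoeff_1)
  finally show "dact 1 f $ s = f $ s" by (simp add: dcoeff_1)
qed

lemma dact_uminus: "dact (- A) f = - dact A f"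
proof -
  have "dact 0 f = 0" using dact_add[of 0 0 f] by simp
  then show ?thesis using dact_add[of A "- A" f] by (simp add: eq_neg_iff_add_eq_0 add.commute)
qed

lemma fps_nth_deriv_X_power:
  "fps_nth_deriv k (fps_X ^ n :: 'a::field_char_0 fps) =
     (if k \<le> n then of_nat (fact n div fact (n - k)) * fps_X ^ (n - k) else 0)"
proof (induction k)
  case (Suc k)
  have *: "fact n div fact (n - k) * (n - k) = (fact n div fact (n - Suc k) :: nat)"
    if "Suc k \<le> n"
  proof -
    have "(fact (n - k) :: nat) = (n - k) * fact (n - Suc k)"
      using that by (metis Suc_diff_Suc Suc_le_eq fact_Suc of_nat_id)
    moreover have "(fact (n - k) :: nat) dvd fact n" by (simp add: fact_dvd)
    then obtain c :: nat where "fact n = fact (n - k) * c" by blast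
    ultimately show ?thesis using that by simp
  qed
  have "fps_nth_deriv (Suc k) (fps_X ^ n) = fps_deriv (fps_nth_deriv k (fps_X ^ n) :: 'a fps)"
    by (rule fps_nth_deriv_commute)
  also have "\<dots> = (if Suc k \<le> n
      then of_nat (fact n div fact (n - k) * (n - k)) * fps_X ^ (n - Suc k) else 0)"
  proof (cases "Suc k \<le> n")
    case True
    have "fps_deriv (of_nat c * fps_X ^ l :: 'a fps) = of_nat (c * l) * fps_X ^ (l - 1)" for c l
      by (simp add: fps_deriv_power' mult.assoc)
    note this[of "fact n div fact (n - k)" "n - k"]
    moreover have "n - k - 1 = n - Suc k" "k \<le> n" using True by simp_all
    ultimately show ?thesis using True by (simp only: Suc.IH if_True)
  next
    case False
    have "fps_deriv (fps_nth_deriv k (fps_X ^ n :: 'a fps)) = 0"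
    proof (cases "k \<le> n")
      case True
      with False have "n - k = 0" by simp
      then have "fps_nth_deriv k (fps_X ^ n :: 'a fps) = of_nat (fact n div fact (n - k))"
        using True by (simp only: Suc.IH if_True power_0 mult_1_right)
      then show ?thesis by (simp only: fps_deriv_of_nat)
    qed (simp only: Suc.IH if_False fps_deriv_0)
    with False show ?thesis by (simp only: if_False)
  qed
  also have "\<dots> = (if Suc k \<le> n
      then of_nat (fact n div fact (n - Suc k)) * fps_X ^ (n - Suc k) else 0)"
    using * by presburger
  finally show ?case .
qed simp

lemma dact_eq_0_imp:
  assumes "\<And>f. dact A f = 0"
  shows "A = 0"
proof (rule dsym_eqI)
  fix n show "dcoeff A n = dcoeff 0 n"
  proof (induction n rule: less_induct)
    case (less n)
    obtain r where a: "\<And>k i. i + r < k \<Longrightarrow> dcoeff A k $ i = 0" using dcoeff_bounded[of A] by blast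
    have "dcoeff A n $ s = 0" for s
    proof -
      have "0 = dact A (fps_X ^ n) $ s" using assms by simp
      also have "\<dots> = (\<Sum>k<s + r + n + 1. (dcoeff A k * fps_nth_deriv k (fps_X ^ n)) $ s)"
        by (rule dact_nth[of r]) (auto simp: a)
      also have "\<dots> = (\<Sum>k\<in>{n}. (dcoeff A k * fps_nth_deriv k (fps_X ^ n)) $ s)"
      proof (rule sum.mono_neutral_right)
        show "\<forall>k\<in>{..<s + r + n + 1} - {n}. (dcoeff A k * fps_nth_deriv k (fps_X ^ n)) $ s = 0"
        proof
          fix k assume "k \<in> {..<s + r + n + 1} - {n}"
          then consider "k < n" | "k > n" by fastforce
          then show "(dcoeff A k * fps_nth_deriv k (fps_X ^ n)) $ s = 0"
            by cases (simp_all add: less fps_nth_deriv_X_power)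
        qed
      qed auto
      also have "\<dots> = dcoeff A n $ s * of_nat (fact n)"
      proof -
        have "(g * of_nat c) $ s = g $ s * of_nat c" for g :: "'a fps" and c
          by (metis fps_mult_right_const_nth fps_of_nat)
        moreover have "fps_nth_deriv n (fps_X ^ n :: 'a fps) = of_nat (fact n)"
          unfolding fps_nth_deriv_X_power by simp
        ultimately show ?thesis by (simp del: of_nat_fact)
      qed
      finally have "dcoeff A n $ s * of_nat (fact n) = 0" by (rule sym)
      then show ?thesis by simp
    qed
    then show ?case by (intro fps_ext) simp
  qed
qed

lemma dact_inject:
  assumes "\<And>f. dact A f = dact B f"
  shows "A = B"
proof -
  have "dact (A + - B) f = 0" for f
    using assms by (simp only: dact_add dact_uminus right_minus)
  then have "A + - B = 0" by (rule dact_eq_0_imp)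
  then show ?thesis by (simp only: eq_neg_iff_add_eq_0[symmetric] minus_minus)
qed

instance dsym :: (field_char_0) ring_1
proof
  fix A B C :: "'a dsym"
  show "A * B * C = A * (B * C)" by (rule dact_inject) (simp add: dact_mult)
  show "(A + B) * C = A * C + B * C" by (rule dact_inject) (simp add: dact_mult dact_add)
  show "A * (B + C) = A * B + A * C"
    by (rule dact_inject) (simp add: dact_mult dact_add dact_fun_add)
  show "1 * A = A" "A * 1 = A" by (rule dact_inject, simp add: dact_mult dact_1)+
  have "dcoeff (0 :: 'a dsym) 0 \<noteq> dcoeff 1 0" by (simp add: dcoeff_1)
  then show "(0 :: 'a dsym) \<noteq> 1" by metis
qed

subsection \<open>Functions and the derivation\<close>

lift_definition dfun :: "'a::field_char_0 fps \<Rightarrow> 'a dsym" is "\<lambda>a k. if k = 0 then a else 0"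
  by (auto simp: le_Suc_eq)

lift_definition dD :: "'a::field_char_0 dsym" is "\<lambda>k. if k = 1 then 1 else 0"
  by (auto intro!: exI[of _ 1])

definition dconst :: "'a::field_char_0 \<Rightarrow> 'a dsym" where "dconst c = dfun (fps_const c)"

lemma dact_dfun: "dact (dfun a) f = a * f"
proof (rule fps_ext)
  fix s
  have "dact (dfun a) f $ s = (\<Sum>k<s + 0 + 1. (dcoeff (dfun a) k * fps_nth_deriv k f) $ s)"
    by (rule dact_nth[of 0]) (auto simp: dfun.rep_eq)
  also have "\<dots> = (\<Sum>k\<in>{0}. (dcoeff (dfun a) k * fps_nth_deriv k f) $ s)"
    by (rule sum.mono_neutral_right) (auto simp: dfun.rep_eq)
  finally show "dact (dfun a) f $ s = (a * f) $ s" by (simp add: dfun.rep_eq)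
qed

lemma dact_dD: "dact dD f = fps_deriv f"
proof (rule fps_ext)
  fix s
  have "dact dD f $ s = (\<Sum>k<s + 1 + 1. (dcoeff dD k * fps_nth_deriv k f) $ s)"
    by (rule dact_nth[of 1]) (auto simp: dD.rep_eq)
  also have "\<dots> = (\<Sum>k\<in>{1}. (dcoeff dD k * fps_nth_deriv k f) $ s)"
    by (rule sum.mono_neutral_right) (auto simp: dD.rep_eq)
  finally show "dact dD f $ s = fps_deriv f $ s" by (simp add: dD.rep_eq)
qed

lemma dD_dfun: "dD * dfun a = dfun a * dD + dfun (fps_deriv a)"
  by (rule dact_inject) (simp add: dact_mult dact_add dact_dfun dact_dD)

section \<open>Orders, homogeneous components, differential operators\<close>

text \<open>
  \<open>Ord\<close> is the bold order \<open>sup (k - v(a\<^sub>k))\<close>. Both \<open>Ord\<close> and \<open>dord\<close> (the degree in \<open>\<partial>\<close>) are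
  meaningful for nonzero operators only; the value \<open>-\<infinity>\<close> at \<open>0\<close> is treated explicitly where it
  matters. \<open>dord\<close> is moreover used for elements of \<open>D1\<close> only.
\<close>

definition Ord :: "'a::field_char_0 dsym \<Rightarrow> int" where
  "Ord A = Sup {int k - int (subdegree (dcoeff A k)) | k. dcoeff A k \<noteq> 0}"

lemma Ord_eqI:
  assumes "\<And>k i. dcoeff A k $ i \<noteq> 0 \<Longrightarrow> int k - int i \<le> r"
    and "dcoeff A k $ i \<noteq> 0" and "int k - int i = r"
  shows "Ord A = r"
  unfolding Ord_def
proof (rule cSup_eq_maximum)
  have "subdegree (dcoeff A k) \<le> i" using assms(2) by (rule subdegree_leI)
  moreover have "dcoeff A k $ subdegree (dcoeff A k) \<noteq> 0" using assms(2) by auto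
  ultimately have "int k - int (subdegree (dcoeff A k)) = r"
    using assms(1)[of k "subdegree (dcoeff A k)"] assms(3) by linarith
  then show "r \<in> {int k - int (subdegree (dcoeff A k)) | k. dcoeff A k \<noteq> 0}"
    using assms(2) by (intro CollectI exI[of _ k]) auto
next
  fix y assume "y \<in> {int k - int (subdegree (dcoeff A k)) | k. dcoeff A k \<noteq> 0}"
  then obtain l where "y = int l - int (subdegree (dcoeff A l))" "dcoeff A l \<noteq> 0" by blast
  then show "y \<le> r" using assms(1)[of l "subdegree (dcoeff A l)"] by simp
qed

lift_definition hcomp :: "'a::field_char_0 dsym \<Rightarrow> int \<Rightarrow> 'a dsym" is
  "\<lambda>a m k. Abs_fps (\<lambda>i. if int k - int i = m then a k $ i else 0)"
  by fastforce

definition symb :: "'a::field_char_0 dsym \<Rightarrow> 'a dsym" where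
  "symb A = hcomp A (Ord A)"

definition D1 :: "'a::field_char_0 dsym set" where
  "D1 = {A. finite {k. dcoeff A k \<noteq> 0}}"

definition dord :: "'a::field_char_0 dsym \<Rightarrow> nat" where
  "dord A = Max {k. dcoeff A k \<noteq> 0}"

definition orders_agree :: "'a::field_char_0 dsym \<Rightarrow> bool" where
  "orders_agree A \<longleftrightarrow> A \<in> D1 \<and> A \<noteq> 0 \<and> int (dord A) = Ord A"

definition monic_op :: "'a::field_char_0 dsym \<Rightarrow> bool" where
  "monic_op A \<longleftrightarrow> A \<in> D1 \<and> A \<noteq> 0 \<and> dcoeff A (dord A) = 1"

definition formally_elliptic :: "'a::field_char_0 dsym \<Rightarrow> bool" where
  "formally_elliptic A \<longleftrightarrow>
     A \<in> D1 \<and> A \<noteq> 0 \<and> (\<exists>c. c \<noteq> 0 \<and> dcoeff A (dord A) = fps_const c)"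

definition normalized_op :: "'a::field_char_0 dsym \<Rightarrow> bool" where
  "normalized_op A \<longleftrightarrow> monic_op A \<and> (\<forall>k. Suc k = dord A \<longrightarrow> dcoeff A k = 0)"

section \<open>Schur operators and normal forms\<close>

definition dinvertible :: "'a::field_char_0 dsym \<Rightarrow> bool" where
  "dinvertible S \<longleftrightarrow> (\<exists>T. S * T = 1 \<and> T * S = 1)"

definition dinv :: "'a::field_char_0 dsym \<Rightarrow> 'a dsym" where
  "dinv S = (THE T. S * T = 1 \<and> T * S = 1)"

lemma dinv:
  assumes "dinvertible S"
  shows "S * dinv S = 1 \<and> dinv S * S = 1"
proof -
  obtain T where T: "S * T = 1 \<and> T * S = 1" using assms unfolding dinvertible_def by blast
  moreover have "U = T" if "S * U = 1 \<and> U * S = 1" for U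
    using T that by (metis mult.assoc mult_1_left mult_1_right)
  ultimately show ?thesis unfolding dinv_def by (rule theI)
qed

definition schur_operator :: "'a::field_char_0 dsym \<Rightarrow> 'a dsym \<Rightarrow> bool" where
  "schur_operator P S \<longleftrightarrow>
     orders_agree P \<and> symb P = dD ^ dord P \<and>
     dinvertible S \<and> Ord S = 0 \<and> dinv S * P * S = dD ^ dord P"

definition monic_order_zero :: "'a::field_char_0 dsym \<Rightarrow> bool" where
  "monic_order_zero S \<longleftrightarrow> Ord S = 0 \<and> hcomp S 0 = 1"

text \<open>\<open>N\<close> is a normal form of \<open>Q\<close> with respect to \<open>P\<close>.\<close>

definition normal_form :: "'a::field_char_0 dsym \<Rightarrow> 'a dsym \<Rightarrow> 'a dsym \<Rightarrow> bool" where
  "normal_form P Q N \<longleftrightarrow> (\<exists>S. schur_operator P S \<and> N = dinv S * Q * S)"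

section \<open>Head-chopping sequences\<close>

text \<open>
  \<open>head_chop \<nu> \<mu> \<epsilon> P Q i\<close> is \<open>Q\<^sub>i = F\<^sub>i(P, Q)\<close>; the polynomials \<open>F\<^sub>i\<close> are given by the exponents
  \<open>\<nu>\<close>, \<open>\<mu>\<close> and the scalars \<open>\<epsilon>\<close>, and are evaluated at a pair by the same recursion, also when the
  pair does not commute.
\<close>

primrec head_chop ::
  "(nat \<Rightarrow> nat) \<Rightarrow> (nat \<Rightarrow> nat) \<Rightarrow> (nat \<Rightarrow> 'a::field_char_0) \<Rightarrow> 'a dsym \<Rightarrow> 'a dsym \<Rightarrow> nat \<Rightarrow> 'a dsym"
where
  "head_chop \<nu> \<mu> \<epsilon> P Q 0 = Q"
| "head_chop \<nu> \<mu> \<epsilon> P Q (Suc i) =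
     head_chop \<nu> \<mu> \<epsilon> P Q i ^ \<nu> i - dconst (\<epsilon> i ^ \<nu> i) * P ^ \<mu> i"

definition Ord_less :: "'a::field_char_0 dsym \<Rightarrow> 'a dsym \<Rightarrow> bool" where
  "Ord_less A B \<longleftrightarrow> B \<noteq> 0 \<and> (A = 0 \<or> Ord A < Ord B)"

definition head_chopping_sequence ::
  "(nat \<Rightarrow> nat) \<Rightarrow> (nat \<Rightarrow> nat) \<Rightarrow> (nat \<Rightarrow> 'a::field_char_0) \<Rightarrow> nat \<Rightarrow> 'a dsym \<Rightarrow> 'a dsym \<Rightarrow> bool"
where
  "head_chopping_sequence \<nu> \<mu> \<epsilon> I P Q \<longleftrightarrow>
     Q * P - P * Q \<in> {0, 1} \<and>
     (\<forall>i<I. Ord_less (head_chop \<nu> \<mu> \<epsilon> P Q (Suc i)) (head_chop \<nu> \<mu> \<epsilon> P Q i ^ \<nu> i))"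

text \<open>The pairs \<open>(Ord Q\<^sub>i, c\<^sub>i)\<close> with \<open>symb Q\<^sub>i = c\<^sub>i \<partial>\<close> to the power \<open>Ord Q\<^sub>i\<close>, for \<open>i = 0, \<dots>, I\<close>.\<close>

definition sequence_of ::
  "(nat \<Rightarrow> nat) \<Rightarrow> (nat \<Rightarrow> nat) \<Rightarrow> (nat \<Rightarrow> 'a::field_char_0) \<Rightarrow> nat \<Rightarrow> 'a dsym \<Rightarrow> 'a dsym \<Rightarrow>
     (nat \<times> 'a) list \<Rightarrow> bool"
where
  "sequence_of \<nu> \<mu> \<epsilon> I P Q s \<longleftrightarrow>
     length s = Suc I \<and>
     (\<forall>i\<le>I. let A = head_chop \<nu> \<mu> \<epsilon> P Q i; k = fst (s ! i); c = snd (s ! i) in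
        c \<noteq> 0 \<and> Ord A = int k \<and> symb A = dconst c * dD ^ k)"

text \<open>The index is an integer, so that index \<open>-1\<close> gives \<open>GCD(Ord P)\<close>.\<close>

definition SeqGCD ::
  "(nat \<Rightarrow> nat) \<Rightarrow> (nat \<Rightarrow> nat) \<Rightarrow> (nat \<Rightarrow> 'a::field_char_0) \<Rightarrow> 'a dsym \<Rightarrow> 'a dsym \<Rightarrow> int \<Rightarrow> int"
where
  "SeqGCD \<nu> \<mu> \<epsilon> P Q i =
     Gcd (insert (Ord P) {Ord (head_chop \<nu> \<mu> \<epsilon> P Q j) | j. int j \<le> i})"

section \<open>Generated algebras and rank\<close>

definition dsubalgebra :: "'a::field_char_0 dsym set \<Rightarrow> bool" where
  "dsubalgebra B \<longleftrightarrow>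
     range dconst \<subseteq> B \<and> (\<forall>L\<in>B. \<forall>M\<in>B. L + M \<in> B \<and> L * M \<in> B)"

definition generated_algebra :: "'a::field_char_0 dsym set \<Rightarrow> 'a dsym set" where
  "generated_algebra X = dsubalgebra hull X"

definition rk :: "'a::field_char_0 dsym set \<Rightarrow> nat" where
  "rk B = Gcd (dord ` (B - {0}))"

section \<open>Plane curves of Burchnall--Chaundy type\<close>

text \<open>
  Elements of \<open>K[X, Y]\<close> are polynomials in \<open>X\<close> with coefficients in \<open>K[Y]\<close>: the coefficient of
  \<open>X\<^sup>i Y\<^sup>j\<close> in \<open>f\<close> is \<open>coeff (coeff f i) j\<close>. In \<open>eval_XY\<close> the map \<open>\<iota>\<close> embeds the scalars, and
  the values of \<open>X\<close> and \<open>Y\<close> are meant to commute.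
\<close>

definition eval_XY :: "('a::comm_ring_1 \<Rightarrow> 'b::ring_1) \<Rightarrow> 'a poly poly \<Rightarrow> 'b \<Rightarrow> 'b \<Rightarrow> 'b" where
  "eval_XY \<iota> f x y =
     (\<Sum>i\<le>degree f. \<Sum>j\<le>degree (coeff f i). \<iota> (coeff (coeff f i) j) * x ^ i * y ^ j)"

text \<open>The affine spectral curve of \<open>K[P, Q]\<close> is the plane curve \<open>f = 0\<close>.\<close>

definition spectral_polynomial ::
  "'a::field_char_0 poly poly \<Rightarrow> 'a dsym \<Rightarrow> 'a dsym \<Rightarrow> bool" where
  "spectral_polynomial f P Q \<longleftrightarrow> irreducible f \<and> eval_XY dconst f Q P = 0"

text \<open>
  For irreducible \<open>f\<close>, the normalised discrete valuations over \<open>K\<close> of the function field of the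
  curve \<open>f = 0\<close> whose valuation ring does not contain the coordinate ring \<open>K[X, Y]/(f)\<close>. A
  valuation of the fraction field is determined by its restriction to \<open>K[X, Y]/(f)\<close>, here
  represented by a function on \<open>K[X, Y]\<close> whose values at the multiples of \<open>f\<close> (where the valuation
  is \<open>\<infinity>\<close>) are irrelevant.
\<close>

definition valuation_at_infinity ::
  "'a::field_char_0 poly poly \<Rightarrow> ('a poly poly \<Rightarrow> int) \<Rightarrow> bool" where
  "valuation_at_infinity f v \<longleftrightarrow>
     (\<forall>g h. \<not> f dvd g \<longrightarrow> f dvd (g - h) \<longrightarrow> v g = v h) \<and>
     (\<forall>g h. \<not> f dvd g \<longrightarrow> \<not> f dvd h \<longrightarrow> v (g * h) = v g + v h) \<and>
     (\<forall>g h. \<not> f dvd g \<longrightarrow> \<not> f dvd h \<longrightarrow> \<not> f dvd (g + h) \<longrightarrow> min (v g) (v h) \<le> v (g + h)) \<and>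
     (\<forall>c. c \<noteq> 0 \<longrightarrow> v [:[:c:]:] = 0) \<and>
     (\<exists>g h. \<not> f dvd g \<and> \<not> f dvd h \<and> v g = v h + 1) \<and>
     (\<exists>g. \<not> f dvd g \<and> v g < 0)"

text \<open>
  The affine curve \<open>f = 0\<close> is compactified by one regular \<open>K\<close>-point. The local ring of a regular
  point of a curve is a discrete valuation ring of the function field, the point is a \<open>K\<close>-point iff
  the residue field is \<open>K\<close>, and by the valuative criterion adding this single point gives a complete
  curve iff no other valuation ring over \<open>K\<close> fails to contain the affine coordinate ring.
\<close>

definition one_regular_point_at_infinity :: "'a::field_char_0 poly poly \<Rightarrow> bool" where
  "one_regular_point_at_infinity f \<longleftrightarrow>
     (\<exists>v. valuation_at_infinity f v \<and>
        (\<forall>g h. \<not> f dvd g \<longrightarrow> \<not> f dvd h \<longrightarrow> v g = v h \<longrightarrow>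
           (\<exists>c. f dvd (g - [:[:c:]:] * h) \<or> v h < v (g - [:[:c:]:] * h))) \<and>
        (\<forall>w. valuation_at_infinity f w \<longrightarrow> (\<forall>g. \<not> f dvd g \<longrightarrow> w g = v g)))"

definition BC_type :: "nat \<Rightarrow> nat \<Rightarrow> nat \<Rightarrow> 'a::field_char_0 poly poly \<Rightarrow> bool" where
  "BC_type n m d f \<longleftrightarrow>
     irreducible f \<and> coprime m n \<and> 1 \<le> d \<and>
     (\<exists>\<alpha>. \<alpha> \<noteq> 0 \<and>
        (\<forall>i j. coeff (coeff (f - (monom [:\<alpha>:] n + [:monom 1 m:]) ^ d) i) j \<noteq> 0 \<longrightarrow>
           m * i + n * j < m * n * d)) \<and>
     one_regular_point_at_infinity f"

text \<open>
  A Puiseux solution \<open>X(z)\<close> for \<open>Y = z\<close> to the power \<open>-nd\<close>, with leading exponent \<open>-md\<close>. The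
  distance is \<open>md + e\<close>, where \<open>e\<close> is the first exponent of \<open>X\<close> for which \<open>d\<close> and the exponents of
  \<open>X\<close> after the leading one and up to \<open>e\<close> have greatest common divisor \<open>1\<close>. For \<open>d = 1\<close> no further
  exponent is needed, so \<open>e\<close> is the leading exponent and the distance is \<open>0\<close>.
\<close>

definition puiseux_solution :: "nat \<Rightarrow> nat \<Rightarrow> nat \<Rightarrow> 'a::field_char_0 poly poly \<Rightarrow> 'a fls \<Rightarrow> bool" where
  "puiseux_solution n m d f X \<longleftrightarrow>
     X \<noteq> 0 \<and> fls_subdegree X = - int (m * d) \<and>
     eval_XY fls_const f X (fls_X_inv ^ (n * d)) = 0"

definition exponents_gcd :: "nat \<Rightarrow> nat \<Rightarrow> 'a::field_char_0 fls \<Rightarrow> int \<Rightarrow> int" where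
  "exponents_gcd m d X e =
     Gcd (insert (int d) {k. - int (m * d) < k \<and> k \<le> e \<and> fls_nth X k \<noteq> 0})"

definition has_distance :: "nat \<Rightarrow> nat \<Rightarrow> nat \<Rightarrow> 'a::field_char_0 poly poly \<Rightarrow> int \<Rightarrow> bool" where
  "has_distance n m d f \<delta> \<longleftrightarrow>
     (\<exists>X e. puiseux_solution n m d f X \<and>
        fls_nth X e \<noteq> 0 \<and> exponents_gcd m d X e = 1 \<and>
        (\<forall>e'<e. fls_nth X e' \<noteq> 0 \<longrightarrow> exponents_gcd m d X e' \<noteq> 1) \<and>
        \<delta> = int (m * d) + e)"

end

theory Submission
  imports Defs
begin

text \<open>
  After conjugation by the Schur operator, \<open>[Q, P] = 1\<close> says that all homogeneous components of the normal form
  of \<open>Q\<close> commute with \<open>\<partial>\<^sup>p\<close> except the one of order \<open>-p\<close>. Removing it does not change the leading terms of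
  the head-chopping sequence, because the orders of the commutators \<open>[Q\<^sub>i, P]\<close> of differential operators bound
  the orders of the perturbations. In the commutative algebra generated by \<open>\<partial>\<^sup>p\<close> and the remaining operator
  \<open>Q'\<close>, acting on \<open>K[\<partial>] = D/xD\<close>, the orders have greatest common divisor \<open>1\<close>. A common eigenvector
  over \<open>K((z))\<close> therefore embeds \<open>K[\<partial>]\<close> as a subspace \<open>W\<close> such that \<open>\<partial>\<^sup>p\<close> and \<open>Q'\<close> act as multiplication by
  \<open>z\<^sup>-\<^sup>p\<close> and a series \<open>b\<close>, and the Baker--Akhiezer function of \<open>W\<close> turns both into differential operators, as in
  the theory of Sato. The spectral curve is read off from \<open>(b, z\<^sup>-\<^sup>p)\<close>, whose conjugates under \<open>z \<mapsto> \<zeta> z\<close> are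
  distinct; the perturbation argument once more shows that the terms of \<open>b\<close> up to \<open>z\<^sup>p\<^sup>-\<^sup>1\<close> already have
  exponents of greatest common divisor \<open>1\<close>, which bounds the distance.
\<close>

text \<open>Nothing forces conjugation by \<open>S\<close> to carry \<open>Qt'\<close> back into
  \<open>D1\<close>, so a second Schur operator \<open>T\<close> is built: the matrix that expresses
  the Baker--Akhiezer basis of W through the eigenvector. It is unitriangular because W is
  complementary to zK[[z]]. Greatest common divisor 1 of the orders is used in one form throughout:
  the residues modulo p of a semigroup of orders containing p form a group, so the residue 1 occurs.
  An operator of such an order makes the difference equations for the eigenvector first-order, hence
  solvable, and its solution unique up to a scalar; this forces all commuting operators to share the
  eigenvector. On the curve the same fact gives an element whose leading coefficient separates the p
  substitutions, and elements whose orders differ by 1, which normalises the valuation. No function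
  field is formed: divisibility by the equation of the curve is vanishing in K((z)), the place at
  infinity is the order of a Laurent series, and that there is no second place follows from
  finiteness over K[y].\<close>

unbundle fps_syntax

section \<open>Operators as matrices\<close>

text \<open>\<open>D/xD\<close> has the basis \<open>1, \<partial>, \<partial>\<^sup>2, \<dots>\<close>, and \<open>rep A k l\<close> is the coefficient of \<open>\<partial>\<^sup>l\<close> in \<open>\<partial>\<^sup>k A\<close> modulo \<open>xD\<close>, so
  \<open>rep\<close> identifies the operators with the matrices with \<open>l \<le> k + r\<close> on the support.\<close>

definition rep :: "'a::field_char_0 dsym \<Rightarrow> nat \<Rightarrow> nat \<Rightarrow> 'a" where
  "rep A k l =
     (\<Sum>j\<le>k. if k - j \<le> l then of_nat (k choose j) * fact j * dcoeff A (l - (k - j)) $ j else 0)"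

lemma rep_0 [simp]: "rep 0 k l = 0"
  unfolding rep_def by (rule sum.neutral) simp

lemma rep_add [simp]: "rep (A + B) k l = rep A k l + rep B k l"
  unfolding rep_def sum.distrib[symmetric] by (intro sum.cong refl) (simp add: algebra_simps)

lemma rep_uminus [simp]: "rep (- A) k l = - rep A k l"
  unfolding rep_def sum_negf[symmetric] by (intro sum.cong refl) simp

lemma rep_minus [simp]: "rep (A - B) k l = rep A k l - rep B k l"
  by (simp only: minus_dsym_def rep_add rep_uminus) simp

lemma rep_eq_0:
  assumes "\<And>i j. j \<le> k \<Longrightarrow> N < i \<Longrightarrow> dcoeff A i $ j = 0" and "N + k < l"
  shows "rep A k l = 0"
  unfolding rep_def by (rule sum.neutral) (use assms in auto)

lemma rep_dD: "rep dD k l = (if l = k + 1 then 1 else 0)"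
proof -
  have "rep dD k l = (\<Sum>j\<in>{0}. if k - j \<le> l then of_nat (k choose j) * fact j *
      dcoeff dD (l - (k - j)) $ j else (0::'a))"
    unfolding rep_def
    by (rule sum.mono_neutral_right) (auto simp: dD.rep_eq)
  then show ?thesis by (auto simp: dD.rep_eq)
qed

lemma rep_dconst: "rep (dconst c) k l = (if l = k then c else 0)"
proof -
  have "rep (dconst c) k l = (\<Sum>j\<in>{0}. if k - j \<le> l then of_nat (k choose j) * fact j *
      dcoeff (dconst c) (l - (k - j)) $ j else (0::'a))"
    unfolding rep_def
    by (rule sum.mono_neutral_right) (auto simp: dconst_def dfun.rep_eq)
  then show ?thesis by (auto simp: dconst_def dfun.rep_eq)
qed

lemma dconst_1: "dconst 1 = 1"
  by (rule dsym_eqI) (simp add: dconst_def dfun.rep_eq dcoeff_1)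

lemma rep_1: "rep 1 k l = (if l = k then 1 else 0)"
  by (simp add: rep_dconst flip: dconst_1)

text \<open>The substitution l = i + (k - j) turns a row of the matrix back into coefficients of the
  operator. The additive map \<open>h\<close> is the identity for the action on power series and
  \<open>fls_const\<close> for Laurent series.\<close>

lemma rep_sum:
  fixes h :: "'a::field_char_0 \<Rightarrow> 'b::semiring_0"
  assumes h0: "h 0 = 0" and hadd: "\<And>x y. h (x + y) = h x + h y"
    and N: "\<And>i j. j \<le> k \<Longrightarrow> N < i \<Longrightarrow> dcoeff A i $ j = 0" and M: "N + k \<le> M"
  shows "(\<Sum>l\<le>M. h (rep A k l) * g l) =
    (\<Sum>j\<le>k. \<Sum>i\<le>N. h (of_nat (k choose j) * fact j * dcoeff A i $ j) * g (i + (k - j)))"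
proof -
  have hsum: "h (sum f B) = (\<Sum>b\<in>B. h (f b))" if "finite B" for f and B :: "nat set"
    using that by (induction B) (auto simp: h0 hadd)
  let ?c = "\<lambda>j i. h (of_nat (k choose j) * fact j * dcoeff A i $ j)"
  have "(\<Sum>l\<le>M. h (rep A k l) * g l) =
      (\<Sum>l\<le>M. \<Sum>j\<le>k. if k - j \<le> l then ?c j (l - (k - j)) * g l else 0)"
    unfolding rep_def by (intro sum.cong refl)
      (auto simp: hsum sum_distrib_right h0 intro!: sum.cong)
  also have "\<dots> = (\<Sum>j\<le>k. \<Sum>l\<le>M. if k - j \<le> l then ?c j (l - (k - j)) * g l else 0)"
    by (rule sum.swap)
  also have "\<dots> = (\<Sum>j\<le>k. \<Sum>i\<le>N. ?c j i * g (i + (k - j)))"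
  proof (rule sum.cong[OF refl])
    fix j assume j: "j \<in> {..k}"
    have "(\<Sum>l\<le>M. if k - j \<le> l then ?c j (l - (k - j)) * g l else 0) =
        (\<Sum>l\<in>{l \<in> {..M}. k - j \<le> l}. ?c j (l - (k - j)) * g l)"
      by (subst sum.inter_filter) auto
    also have "\<dots> = (\<Sum>i\<le>M - (k - j). ?c j i * g (i + (k - j)))"
      using M by (intro sum.reindex_bij_witness[of _ "\<lambda>i. i + (k - j)" "\<lambda>l. l - (k - j)"]) auto
    also have "\<dots> = (\<Sum>i\<le>N. ?c j i * g (i + (k - j)))"
      using M N j by (intro sum.mono_neutral_right) (auto simp: h0)
    finally show "(\<Sum>l\<le>M. if k - j \<le> l then ?c j (l - (k - j)) * g l else 0) =
        (\<Sum>i\<le>N. ?c j i * g (i + (k - j)))" .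
  qed
  finally show ?thesis .
qed

lemma fps_nth_deriv_nth:
  "fact m * fps_nth_deriv i f $ m = fact (m + i) * (f :: 'a::field_char_0 fps) $ (m + i)"
proof (induction i arbitrary: m)
  case (Suc i)
  have "fps_nth_deriv (Suc i) f = fps_deriv (fps_nth_deriv i f)"
    by (rule fps_nth_deriv_commute)
  then have "fact m * fps_nth_deriv (Suc i) f $ m = fact (Suc m) * fps_nth_deriv i f $ (Suc m)"
    by (simp only: fps_deriv_nth fact_Suc Suc_eq_plus1[symmetric] mult.assoc mult.left_commute)
  then show ?case using Suc.IH[of "Suc m"] by (simp only: add_Suc add_Suc_right)
qed simp

text \<open>k! times the k-th Taylor coefficient is \<partial>^k followed by evaluation at 0, that
  is, the class of \<partial>^k in D/xD; hence row k governs it.\<close>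

lemma dact_rep:
  assumes M: "\<And>l. M < l \<Longrightarrow> rep A k l = 0"
  shows "fact k * dact A f $ k = (\<Sum>l\<le>M. rep A k l * (fact l * f $ l))"
proof -
  obtain r where r: "\<And>k i. i + r < k \<Longrightarrow> dcoeff A k $ i = 0" using dcoeff_bounded[of A] by blast
  define N where "N = k + r"
  have N: "\<And>i j. j \<le> k \<Longrightarrow> N < i \<Longrightarrow> dcoeff A i $ j = 0" using r by (simp add: N_def)
  have "fact k * dact A f $ k = (\<Sum>i\<le>N. fact k * (dcoeff A i * fps_nth_deriv i f) $ k)"
    by (subst dact_nth[of r _ _ "Suc N"]) (auto simp: r N_def lessThan_Suc_atMost sum_distrib_left)
  also have "\<dots> = (\<Sum>i\<le>N. \<Sum>j\<le>k. of_nat (k choose j) * fact j * dcoeff A i $ j *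
      (fact (i + (k - j)) * f $ (i + (k - j))))"
    unfolding fps_mult_nth sum_distrib_left atLeast0AtMost
  proof (intro sum.cong refl)
    fix i j assume "j \<in> {..k}"
    then have b: "(fact k :: 'a) = of_nat (k choose j) * fact j * fact (k - j)"
      by (simp add: binomial_fact)
    show "fact k * (dcoeff A i $ j * fps_nth_deriv i f $ (k - j)) =
        of_nat (k choose j) * fact j * dcoeff A i $ j * (fact (i + (k - j)) * f $ (i + (k - j)))"
      using fps_nth_deriv_nth[of "k - j" i f] unfolding b by (simp add: ac_simps)
  qed
  also have "\<dots> = (\<Sum>l\<le>N + k + M. rep A k l * (fact l * f $ l))"
    by (subst sum.swap, subst rep_sum[where h = "\<lambda>x. x" and N = N])
      (use N in auto)
  also have "\<dots> = (\<Sum>l\<le>M. rep A k l * (fact l * f $ l))"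
    by (rule sum.mono_neutral_right) (auto simp: M)
  finally show ?thesis .
qed

lemma rep_bounded:
  obtains r where "\<And>k l. k + r < l \<Longrightarrow> rep A k l = 0"
proof -
  obtain r where r: "\<And>k i. i + r < k \<Longrightarrow> dcoeff A k $ i = 0" using dcoeff_bounded[of A] by blast
  have "rep A k l = 0" if "k + r < l" for k l
    unfolding rep_def by (rule sum.neutral) (use r that in auto)
  then show ?thesis using that by blast
qed

lemma rep_row_bounded:
  obtains M where "\<And>l. M < l \<Longrightarrow> rep A k l = 0"
  using rep_bounded[of A] by metis

lemma rep_mult:
  assumes M: "\<And>m. M < m \<Longrightarrow> rep A k m = 0"
  shows "rep (A * B) k l = (\<Sum>m\<le>M. rep A k m * rep B m l)"
proof -
  \<comment> \<open>Monomials isolate single columns, so composition of the actions becomes the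
    matrix product.\<close>
  have X: "fact k * dact C (fps_X ^ l) $ k = rep C k l * fact l" for C :: "'a dsym" and k l
  proof -
    obtain r where r: "\<And>k l. k + r < l \<Longrightarrow> rep C k l = 0" using rep_bounded by blast
    have "fact k * dact C (fps_X ^ l) $ k =
        (\<Sum>m\<le>k + r + l. rep C k m * (fact m * (fps_X ^ l :: 'a fps) $ m))"
      by (rule dact_rep) (auto simp: r)
    also have "\<dots> = (\<Sum>m\<in>{l}. rep C k m * (fact m * (fps_X ^ l :: 'a fps) $ m))"
      by (rule sum.mono_neutral_right) auto
    finally show ?thesis by simp
  qed
  have "rep (A * B) k l * fact l = (\<Sum>m\<le>M. rep A k m * rep B m l) * fact l"
    using dact_rep[OF M, where f = "dact B (fps_X ^ l)"]
    by (simp only: X dact_mult X[symmetric, of "A * B"]) (simp add: sum_distrib_right mult.assoc)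
  then show ?thesis by simp
qed

lemma rep_inject:
  assumes "\<And>k l. rep A k l = rep B k l"
  shows "A = B"
proof (rule dact_inject, rule fps_ext)
  fix f k
  obtain M where M: "\<And>l. M < l \<Longrightarrow> rep A k l = 0" using rep_row_bounded by blast
  have "fact k * dact A f $ k = fact k * dact B f $ k"
    using M assms by (simp add: dact_rep[of M])
  then show "dact A f $ k = dact B f $ k" by simp
qed

lemma ex_course_of_values: "\<exists>f :: nat \<Rightarrow> 'b. \<forall>n. f n = F n (\<lambda>j. if j < n then f j else z)"
proof -
  have "\<exists>f. \<forall>n. f n = F n (\<lambda>j. if (j, n) \<in> less_than then f j else z)"
    by (rule dependent_wf_choice[OF wf_less_than]) (simp_all cong: if_cong)
  then show ?thesis by simp
qed

text \<open>On the diagonal l - k = m the unknowns are the coefficients \<open>c m j\<close> of x^j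
  \<partial>^(m+j), and entry k is k! \<open>c m k\<close> plus a combination of those with j < k.
  The system is triangular with invertible diagonal, and the diagonals beyond r receive only
  zeros.\<close>

lemma rep_surj:
  fixes M :: "nat \<Rightarrow> nat \<Rightarrow> 'a::field_char_0"
  assumes r: "\<And>k l. k + r < l \<Longrightarrow> M k l = 0"
  obtains A where "\<And>k l. rep A k l = M k l"
proof -
  \<comment> \<open>For k + m < 0 the truncation by \<open>nat\<close> gives a meaningless value. It
    is never read: \<open>a\<close> uses \<open>c m j\<close> only where m + j is a natural
    number.\<close>
  have "\<exists>c. \<forall>k. c k = (M k (nat (int k + m)) -
      (\<Sum>j<k. if 0 \<le> m + int j then of_nat (k choose j) * fact j * c j else 0)) / fact k" for m
  proof -
    define F where "F = (\<lambda>k g. (M k (nat (int k + m)) -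
        (\<Sum>j<k. if 0 \<le> m + int j then of_nat (k choose j) * fact j * g j else 0)) / fact k)"
    have "\<exists>c. \<forall>k. c k = F k (\<lambda>j. if j < k then c j else 0)"
      by (rule ex_course_of_values)
    then obtain c where c: "\<And>k. c k = F k (\<lambda>j. if j < k then c j else 0)" by blast
    have "c k = F k c" for k
      by (subst c) (auto simp: F_def intro!: arg_cong2[where f = "(/)"] arg_cong2[where f = "(-)"] sum.cong)
    then have "\<forall>k. c k = (M k (nat (int k + m)) -
      (\<Sum>j<k. if 0 \<le> m + int j then of_nat (k choose j) * fact j * c j else 0)) / fact k"
      unfolding F_def by blast
    then show ?thesis by blast
  qed
  then obtain c where c: "\<And>m k. c m k = (M k (nat (int k + m)) -
      (\<Sum>j<k. if 0 \<le> m + int j then of_nat (k choose j) * fact j * c m j else 0)) / fact k"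
    by metis
  have z: "c m k = 0" if "int r < m" for m k
  proof (induction k rule: less_induct)
    case (less k)
    have "(\<Sum>j<k. if 0 \<le> m + int j then of_nat (k choose j) * fact j * c m j else 0) = 0"
      by (rule sum.neutral) (simp add: less)
    moreover have "M k (nat (int k + m)) = 0" using that by (intro r) linarith
    ultimately show ?case by (subst c) simp
  qed
  define a where "a = (\<lambda>i. Abs_fps (\<lambda>j. c (int i - int j) j))"
  have "\<forall>k i. a k $ i \<noteq> 0 \<longrightarrow> k \<le> i + r"
  proof (intro allI impI)
    fix k i assume "a k $ i \<noteq> 0"
    then have "\<not> int r < int k - int i" using z[of "int k - int i" i] by (auto simp: a_def)
    then show "k \<le> i + r" by linarith
  qed
  then have a: "dcoeff (Abs_dsym a) = a" by (intro Abs_dsym_inverse) blast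
  have "rep (Abs_dsym a) k l = M k l" for k l
  proof -
    let ?m = "int l - int k"
    let ?t = "\<lambda>j. if 0 \<le> ?m + int j then of_nat (k choose j) * fact j * c ?m j else 0"
    have "rep (Abs_dsym a) k l = (\<Sum>j\<le>k. ?t j)"
      unfolding rep_def a
    proof (intro sum.cong refl)
      fix j assume "j \<in> {..k}"
      then have "int (l - (k - j)) - int j = ?m" if "k - j \<le> l" using that by auto
      moreover have "k - j \<le> l \<longleftrightarrow> 0 \<le> ?m + int j" using \<open>j \<in> {..k}\<close> by auto
      ultimately show "(if k - j \<le> l then of_nat (k choose j) * fact j * a (l - (k - j)) $ j else 0) = ?t j"
        unfolding a_def fps_nth_Abs_fps by metis
    qed
    also have "\<dots> = ?t k + (\<Sum>j<k. ?t j)"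
      by (simp add: lessThan_Suc_atMost[symmetric] add.commute)
    also have "?t k = M k l - (\<Sum>j<k. ?t j)"
      by (subst c) simp
    finally show ?thesis by simp
  qed
  then show ?thesis using that by blast
qed

lemma dcoeff_hcomp: "dcoeff (hcomp A m) k $ i = (if int k - int i = m then dcoeff A k $ i else 0)"
  by (simp add: hcomp.rep_eq)

lemma rep_hcomp: "rep (hcomp A m) k l = (if int l - int k = m then rep A k l else 0)"
proof -
  have "rep (hcomp A m) k l = (\<Sum>j\<le>k. if int l - int k = m then (if k - j \<le> l
      then of_nat (k choose j) * fact j * dcoeff A (l - (k - j)) $ j else 0) else 0)"
    unfolding rep_def by (intro sum.cong refl) (auto simp: dcoeff_hcomp of_nat_diff)
  then show ?thesis by (auto simp: rep_def)
qed

lemma rep_mult_single_row: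
  assumes "\<And>m. m \<noteq> a \<Longrightarrow> rep A k m = 0"
  shows "rep (A * B) k l = rep A k a * rep B a l"
proof -
  have "rep (A * B) k l = (\<Sum>m\<le>a. rep A k m * rep B m l)" by (rule rep_mult) (simp add: assms)
  also have "\<dots> = (\<Sum>m\<in>{a}. rep A k m * rep B m l)"
    by (rule sum.mono_neutral_right) (auto simp: assms)
  finally show ?thesis by simp
qed

lemma rep_mult_single_column:
  assumes "\<And>m. m \<noteq> a \<Longrightarrow> rep B m l = 0"
  shows "rep (A * B) k l = rep A k a * rep B a l"
proof -
  obtain M where M: "\<And>l. M < l \<Longrightarrow> rep A k l = 0" using rep_row_bounded by blast
  have "rep (A * B) k l = (\<Sum>m\<le>M + a. rep A k m * rep B m l)" by (rule rep_mult) (simp add: M)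
  also have "\<dots> = (\<Sum>m\<in>{a}. rep A k m * rep B m l)"
    by (rule sum.mono_neutral_right) (auto simp: assms)
  finally show ?thesis by simp
qed

lemma rep_dD_power: "rep (dD ^ n) k l = (if l = k + n then 1 else 0 :: 'a::field_char_0)"
proof (induction n arbitrary: k l)
  case (Suc n)
  show ?case unfolding power_Suc
    by (subst rep_mult_single_row[of "k + 1"]) (auto simp: rep_dD Suc.IH)
qed (simp add: rep_1)

lemma rep_dD_power_mult: "rep (dD ^ n * A) k l = rep A (k + n) l"
  by (subst rep_mult_single_row[of "k + n"]) (auto simp: rep_dD_power)

lemma rep_mult_dD_power: "rep (A * dD ^ n) k l = (if n \<le> l then rep A k (l - n) else 0)"
  by (subst rep_mult_single_column[of "l - n"]) (auto simp: rep_dD_power)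

lemma rep_dconst_mult: "rep (dconst c * A) k l = c * rep A k l"
  by (subst rep_mult_single_row[of k]) (auto simp: rep_dconst)

lemma rep_mult_dconst: "rep (A * dconst c) k l = c * rep A k l"
  by (subst rep_mult_single_column[of l]) (auto simp: rep_dconst)

lemma dconst_commute: "dconst c * A = A * dconst c"
  by (rule rep_inject) (simp add: rep_dconst_mult rep_mult_dconst)

lemma dconst_0: "dconst 0 = 0"
  by (rule rep_inject) (simp add: rep_dconst)

text \<open>Replaces \<open>Ord\<close> in estimates: it is meaningful at 0 and passes to sums
  without a maximum.\<close>

definition ordle :: "'a::field_char_0 dsym \<Rightarrow> int \<Rightarrow> bool" where
  "ordle A r \<longleftrightarrow> (\<forall>k l. r < int l - int k \<longrightarrow> rep A k l = 0)"

lemma ordleD: "ordle A r \<Longrightarrow> r < int l - int k \<Longrightarrow> rep A k l = 0"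
  by (simp add: ordle_def)

lemma ordle_mono: "ordle A r \<Longrightarrow> r \<le> s \<Longrightarrow> ordle A s"
  by (simp add: ordle_def)

lemma ordle_add: "ordle A r \<Longrightarrow> ordle B r \<Longrightarrow> ordle (A + B) r"
  by (simp add: ordle_def)

lemma ordle_mult:
  assumes A: "ordle A r" and B: "ordle B s"
  shows "ordle (A * B) (r + s)"
  unfolding ordle_def
proof (intro allI impI)
  fix k l :: nat assume kl: "r + s < int l - int k"
  obtain M where M: "\<And>l. M < l \<Longrightarrow> rep A k l = 0" using rep_row_bounded by blast
  have "rep A k m * rep B m l = 0" for m
    using ordleD[OF A, of m k] ordleD[OF B, of l m] kl by (cases "r < int m - int k") auto
  then show "rep (A * B) k l = 0" by (subst rep_mult[OF M]) (simp_all only: sum.neutral_const)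
qed

lemma hcomp_eq_0_iff: "hcomp A m = 0 \<longleftrightarrow> (\<forall>k l. int l - int k = m \<longrightarrow> rep A k l = 0)"
  by (metis rep_0 rep_hcomp rep_inject)

lemma ordle_iff: "ordle A r \<longleftrightarrow> (\<forall>k i. r < int k - int i \<longrightarrow> dcoeff A k $ i = 0)"
proof
  assume "ordle A r"
  then have "hcomp A m = 0" if "r < m" for m using that by (auto simp: hcomp_eq_0_iff ordle_def)
  then show "\<forall>k i. r < int k - int i \<longrightarrow> dcoeff A k $ i = 0"
    by (metis dcoeff_0 dcoeff_hcomp fps_zero_nth)
next
  assume "\<forall>k i. r < int k - int i \<longrightarrow> dcoeff A k $ i = 0"
  then have "hcomp A m = 0" if "r < m" for m
    using that by (intro dsym_eqI fps_ext) (auto simp: dcoeff_hcomp)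
  then show "ordle A r" unfolding ordle_def hcomp_eq_0_iff by blast
qed

lemma Ord_eqI':
  assumes "ordle A r" "rep A k l \<noteq> 0" "int l - int k = r"
  shows "Ord A = r"
proof -
  have "hcomp A r \<noteq> 0" using assms by (auto simp: hcomp_eq_0_iff)
  then obtain k i where ki: "dcoeff (hcomp A r) k $ i \<noteq> 0"
    by (metis dcoeff_0 dsym_eqI fps_ext fps_zero_nth)
  show ?thesis
    by (rule Ord_eqI[of A r k i]) (use ki assms(1) in \<open>auto simp: dcoeff_hcomp ordle_iff not_less[symmetric] split: if_splits\<close>)
qed

lemma Ord_attained:
  assumes "A \<noteq> 0"
  shows "ordle A (Ord A)" and "\<exists>k l. rep A k l \<noteq> 0 \<and> int l - int k = Ord A"
proof -
  obtain r where r: "\<And>k l. k + r < l \<Longrightarrow> rep A k l = 0" using rep_bounded by blast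
  obtain k0 l0 where kl: "rep A k0 l0 \<noteq> 0" using assms by (metis rep_0 rep_inject)
  let ?P = "\<lambda>y. \<exists>k l. rep A k l \<noteq> 0 \<and> y = nat (int r - (int l - int k))"
  obtain y where "?P y" and y: "\<And>z. ?P z \<Longrightarrow> y \<le> z"
    using exists_least_iff[of ?P] kl by (metis not_less)
  then obtain k l where k: "rep A k l \<noteq> 0" "y = nat (int r - (int l - int k))" by blast
  have "ordle A (int l - int k)"
    unfolding ordle_def
  proof (intro allI impI)
    fix k' l' assume a: "int l - int k < int l' - int k'"
    show "rep A k' l' = 0"
    proof (rule ccontr)
      assume "rep A k' l' \<noteq> 0"
      then have "y \<le> nat (int r - (int l' - int k'))" "l' \<le> k' + r"
        using y r by (blast, meson not_less)
      then show False using a k(2) by linarith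
    qed
  qed
  then have "Ord A = int l - int k" using k by (intro Ord_eqI') auto
  then show "ordle A (Ord A)" "\<exists>k l. rep A k l \<noteq> 0 \<and> int l - int k = Ord A"
    using \<open>ordle A (int l - int k)\<close> k by auto
qed

section \<open>Leading terms\<close>

text \<open>The component of degree w is c \<partial>^w and nothing lies above it. The scalar c may
  be 0, so that sums need no case distinction.\<close>

definition leads :: "'a::field_char_0 dsym \<Rightarrow> nat \<Rightarrow> 'a \<Rightarrow> bool" where
  "leads A w c \<longleftrightarrow> ordle A (int w) \<and> (\<forall>k. rep A k (k + w) = c)"

lemma leadsD: "leads A w c \<Longrightarrow> rep A k (k + w) = c"
  and leads_ordle: "leads A w c \<Longrightarrow> ordle A (int w)"
  by (auto simp: leads_def)

lemma leads_eq_0: "leads A w c \<Longrightarrow> k + w < l \<Longrightarrow> rep A k l = 0"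
  by (auto simp: leads_def ordle_def)

lemma leads_mult:
  assumes "leads A w c" "leads B w' c'"
  shows "leads (A * B) (w + w') (c * c')"
  unfolding leads_def
proof (intro conjI allI)
  show "ordle (A * B) (int (w + w'))"
    using ordle_mult[of A "int w" B "int w'"] assms by (simp add: leads_def)
  fix k
  have "rep (A * B) k (k + (w + w')) = (\<Sum>m\<le>k + w. rep A k m * rep B m (k + (w + w')))"
    by (rule rep_mult) (rule leads_eq_0[OF assms(1)])
  also have "\<dots> = (\<Sum>m\<in>{k + w}. rep A k m * rep B m (k + (w + w')))"
    by (rule sum.mono_neutral_right) (auto simp: leads_eq_0[OF assms(2)])
  finally show "rep (A * B) k (k + (w + w')) = c * c'"
    using leadsD[OF assms(1), of k] leadsD[OF assms(2), of "k + w"] by (simp add: add.assoc)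
qed

lemma leads_1: "leads 1 0 1"
  by (simp add: leads_def ordle_def rep_1)

lemma leads_dconst: "leads (dconst c) 0 c"
  by (simp add: leads_def ordle_def rep_dconst)

lemma leads_dD_power: "leads (dD ^ n) n 1"
  by (simp add: leads_def ordle_def rep_dD_power)

lemma leads_power: "leads A w c \<Longrightarrow> leads (A ^ n) (n * w) (c ^ n)"
  by (induction n) (auto simp: leads_1 intro: leads_mult)

lemma leads_add: "leads A w c \<Longrightarrow> leads B w c' \<Longrightarrow> leads (A + B) w (c + c')"
  by (auto simp: leads_def intro: ordle_add)

lemma leads_add_lower: "leads A w c \<Longrightarrow> ordle B r \<Longrightarrow> r < int w \<Longrightarrow> leads (A + B) w c"
  using ordle_mono[of B r "int w"] by (auto simp: leads_def ordleD intro: ordle_add)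

lemma leads_nonzero: "leads A w c \<Longrightarrow> c \<noteq> 0 \<Longrightarrow> A \<noteq> 0"
  by (auto simp: leads_def)

lemma leads_Ord: "leads A w c \<Longrightarrow> c \<noteq> 0 \<Longrightarrow> Ord A = int w"
  by (rule Ord_eqI'[of _ _ 0 w]) (use leadsD[of A w c 0] in \<open>auto simp: leads_ordle\<close>)

lemma leads_symb:
  assumes "leads A w c" "c \<noteq> 0"
  shows "symb A = dconst c * dD ^ w"
proof (rule rep_inject)
  show "rep (symb A) k l = rep (dconst c * dD ^ w) k l" for k l
  proof -
    have "int l - int k = int w \<longleftrightarrow> l = k + w" by auto
    then show ?thesis using leads_Ord[OF assms] leadsD[OF assms(1), of k]
      by (auto simp: symb_def rep_hcomp rep_dconst_mult rep_dD_power)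
  qed
qed

lemma leads_symbI:
  assumes "A \<noteq> 0" "symb A = dconst c * dD ^ w" "Ord A = int w"
  shows "leads A w c"
  unfolding leads_def
proof (intro conjI allI)
  show "ordle A (int w)" using Ord_attained(1)[OF assms(1)] assms(3) by simp
  fix k
  have "rep A k (k + w) = rep (symb A) k (k + w)" by (simp add: symb_def rep_hcomp assms(3))
  then show "rep A k (k + w) = c" by (simp add: assms(2) rep_dconst_mult rep_dD_power)
qed

lemma dord_max:
  assumes "A \<in> D1" "dord A < k"
  shows "dcoeff A k = 0"
proof (rule ccontr)
  assume "dcoeff A k \<noteq> 0"
  then have "k \<le> dord A" unfolding dord_def using assms by (intro Max_ge) (auto simp: D1_def)
  with assms show False by simp
qed

lemma dordI:
  assumes "\<And>k. w < k \<Longrightarrow> dcoeff A k = 0" "dcoeff A w \<noteq> 0"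
  shows "A \<in> D1" "dord A = w" "A \<noteq> 0"
proof -
  have sub: "{k. dcoeff A k \<noteq> 0} \<subseteq> {..w}" using assms(1) by (auto simp: not_less[symmetric])
  then show "A \<in> D1" by (auto simp: D1_def intro: finite_subset)
  show "dord A = w" unfolding dord_def
    using sub assms by (intro Max_eqI) (auto intro: finite_subset)
  show "A \<noteq> 0" using assms(2) by auto
qed

text \<open>A term x^i \<partial>^k of order k - i = \<open>dord A\<close> has k \<le>
  \<open>dord A\<close>, hence i = 0: only the constant term of the top coefficient enters the
  symbol.\<close>

lemma orders_agree_leads:
  assumes "orders_agree A"
  obtains c where "c \<noteq> 0" "leads A (dord A) c"
proof -
  have A: "A \<in> D1" "A \<noteq> 0" "Ord A = int (dord A)" using assms by (auto simp: orders_agree_def)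
  let ?c = "dcoeff A (dord A) $ 0"
  have "rep A k (k + dord A) = ?c" for k
  proof -
    have "rep A k (k + dord A) = (\<Sum>j\<in>{0}. if k - j \<le> k + dord A then
        of_nat (k choose j) * fact j * dcoeff A (k + dord A - (k - j)) $ j else 0)"
      unfolding rep_def by (rule sum.mono_neutral_right) (auto simp: dord_max[OF A(1)])
    then show ?thesis by simp
  qed
  then have l: "leads A (dord A) ?c"
    using Ord_attained(1)[OF A(2)] by (simp add: leads_def A(3))
  obtain k l where "rep A k l \<noteq> 0" "int l - int k = Ord A" using Ord_attained(2)[OF A(2)] by blast
  then have "rep A k (k + dord A) \<noteq> 0" using A(3) by (metis add.commute diff_add_cancel nat_int of_nat_add)
  then have "?c \<noteq> 0" using leadsD[OF l] by simp
  with l that show ?thesis by blast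
qed

text \<open>Leibniz rule for the commutator with P. The symbols are scalars times powers of
  \<partial> and commute, so the n + 1 summands have equal leading terms and add up.\<close>

lemma leads_commutator_power:
  assumes "leads A w c" "leads (A * P - P * A) E e"
  shows "leads (A ^ Suc n * P - P * A ^ Suc n) (E + n * w) (of_nat (Suc n) * c ^ n * e)"
proof (induction n)
  case (Suc n)
  let ?B = "A ^ Suc n"
  have "leads (A * (?B * P - P * ?B) + (A * P - P * A) * ?B) (E + Suc n * w)
      (c * (of_nat (Suc n) * c ^ n * e) + e * c ^ Suc n)"
    using leads_mult[OF assms(1) Suc.IH] leads_mult[OF assms(2) leads_power[OF assms(1), of "Suc n"]]
    by (intro leads_add) (simp_all add: algebra_simps)
  then show ?case by (simp add: algebra_simps)
qed (use assms in simp)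

lemma dcoeff_mult_top:
  assumes a: "\<And>k. a < k \<Longrightarrow> dcoeff A k = 0" and b: "\<And>k. b < k \<Longrightarrow> dcoeff B k = 0"
    and m: "a + b \<le> m"
  shows "dcoeff (A * B) m = (if m = a + b then dcoeff A a * dcoeff B b else 0)"
proof -
  have t: "dmul_term (dcoeff B) k m = (if k = a \<and> m = a + b then dcoeff B b else 0)" if "k \<le> a" for k
  proof -
    let ?f = "\<lambda>j. of_nat (k choose j) * fps_nth_deriv j (dcoeff B (m - (k - j)))"
    have "dmul_term (dcoeff B) k m = (\<Sum>j\<in>(if k = a \<and> m = a + b then {0} else {}). ?f j)"
      unfolding dmul_term_def
    proof (rule sum.mono_neutral_right)
      show "\<forall>j\<in>{j. j \<le> k \<and> k - j \<le> m} - (if k = a \<and> m = a + b then {0} else {}). ?f j = 0"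
      proof
        fix j assume "j \<in> {j. j \<le> k \<and> k - j \<le> m} - (if k = a \<and> m = a + b then {0} else {})"
        then have "b < m - (k - j)" using m that by (auto split: if_splits)
        then show "?f j = 0" by (simp add: b)
      qed
    qed auto
    then show ?thesis by auto
  qed
  have "dcoeff (A * B) m = (\<Sum>k\<le>a. dcoeff A k * dmul_term (dcoeff B) k m)"
    unfolding dcoeff_mult by (rule suminf_finite) (auto simp: a)
  also have "\<dots> = (\<Sum>k\<in>{a}. dcoeff A k * dmul_term (dcoeff B) k m)"
    by (rule sum.mono_neutral_right) (auto simp: t)
  finally show ?thesis by (simp add: t)
qed

text \<open>Top coefficients of differential operators are commuting power series, so the commutator
  has degree below \<open>dord A + dord P\<close> in \<partial>. Row 0 of the matrix lists the
  values of the coefficients at x = 0, so a nonzero leading term shows a power of \<partial> that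
  really occurs.\<close>

lemma leads_commutator_le:
  assumes A: "A \<in> D1" and P: "P \<in> D1" and c: "leads (A * P - P * A) E e" "e \<noteq> 0"
  shows "E < dord A + dord P"
proof (rule ccontr)
  assume E: "\<not> E < dord A + dord P"
  have z: "dcoeff (A * P - P * A) m = 0" if "dord A + dord P \<le> m" for m
    using dcoeff_mult_top[of "dord A" A "dord P" P m] dcoeff_mult_top[of "dord P" P "dord A" A m]
      dord_max[OF A] dord_max[OF P] that by (simp add: add.commute mult.commute)
  have "rep (A * P - P * A) 0 E = 0"
    using E by (simp add: rep_def z del: dcoeff_minus rep_minus)
  then show False using leadsD[OF c(1), of 0] c(2) by simp
qed

section \<open>Inversion of unitriangular matrices by forward substitution\<close>

lemma left_inverse_rows:
  fixes M :: "nat \<Rightarrow> nat \<Rightarrow> 'a::comm_ring_1"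
  assumes M0: "\<And>k l. k < l \<Longrightarrow> M k l = 0" and M1: "\<And>k. M k k = 1"
  shows "\<exists>c. (\<forall>m>k. c m = 0) \<and> c k = 1 \<and> (\<forall>l. (\<Sum>m\<le>k. c m * M m l) = (if l = k then 1 else 0))"
proof (induction k rule: less_induct)
  case (less k)
  then obtain e where e: "\<And>i m. i < k \<Longrightarrow> i < m \<Longrightarrow> e i m = 0"
    "\<And>i l. i < k \<Longrightarrow> (\<Sum>m\<le>i. e i m * M m l) = (if l = i then 1 else 0)"
    by metis
  have e': "(\<Sum>m\<le>k. e i m * M m l) = (if l = i then 1 else 0)" if "i < k" for i l
    unfolding e(2)[OF that, symmetric]
    by (rule sum.mono_neutral_right) (use e(1) that in auto)
  define c where "c = (\<lambda>m. (if m = k then 1 else 0) - (\<Sum>i<k. M k i * e i m))"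
  have "(\<Sum>m\<le>k. c m * M m l) = (if l = k then 1 else 0)" for l
  proof -
    have "(\<Sum>m\<le>k. c m * M m l) =
        (\<Sum>m\<le>k. (if m = k then M m l else 0)) - (\<Sum>m\<le>k. \<Sum>i<k. M k i * (e i m * M m l))"
      unfolding sum_subtractf[symmetric] c_def
      by (intro sum.cong refl) (auto simp: left_diff_distrib sum_distrib_right mult.assoc)
    also have "(\<Sum>m\<le>k. (if m = k then M m l else 0)) = M k l" by (simp add: sum.delta)
    also have "(\<Sum>m\<le>k. \<Sum>i<k. M k i * (e i m * M m l)) = (\<Sum>i<k. M k i * (if l = i then 1 else 0))"
      by (subst sum.swap) (simp add: sum_distrib_left[symmetric] e' cong: if_cong)
    also have "\<dots> = (if l < k then M k l else 0)" by (auto simp: if_distrib sum.delta cong: if_cong)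
    finally show ?thesis using M0[of k l] M1[of k] by auto
  qed
  moreover have "c m = 0" if "k < m" for m
    using that e(1) by (auto simp: c_def intro!: sum.neutral)
  moreover have "c k = 1" using e(1) by (auto simp: c_def intro!: sum.neutral)
  ultimately show ?case by blast
qed

lemma leads_left_inverse:
  assumes "leads T 0 1"
  obtains U where "leads U 0 1" "U * T = 1"
proof -
  have "\<forall>k. \<exists>c. (\<forall>m>k. c m = 0) \<and> c k = 1 \<and>
      (\<forall>l. (\<Sum>m\<le>k. c m * rep T m l) = (if l = k then 1 else 0))"
    using assms by (intro allI left_inverse_rows) (auto simp: leads_def ordle_def)
  then obtain c where c: "\<And>k m. k < m \<Longrightarrow> c k m = 0" "\<And>k. c k k = 1"
    "\<And>k l. (\<Sum>m\<le>k. c k m * rep T m l) = (if l = k then 1 else 0)" by metis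
  obtain U where U: "\<And>k l. rep U k l = c k l"
    using rep_surj[of 0 c] c(1) by auto
  have "leads U 0 1" by (auto simp: leads_def ordle_def U c)
  moreover have "U * T = 1"
    by (rule rep_inject, subst rep_mult) (use c in \<open>auto simp: U rep_1\<close>)
  ultimately show ?thesis using that by blast
qed

lemma leads_inverse:
  assumes "leads T 0 1"
  obtains U where "leads U 0 1" "U * T = 1" "T * U = 1"
proof -
  obtain U where U: "leads U 0 1" "U * T = 1" using leads_left_inverse[OF assms] .
  obtain V where V: "V * U = 1" using leads_left_inverse[OF U(1)] by metis
  have "V = T" using U(2) V by (metis mult.assoc mult_1_left mult_1_right)
  then show ?thesis using that U V by blast
qed

lemma dinv_unique: "T * U = 1 \<Longrightarrow> U * T = 1 \<Longrightarrow> dinv T = U"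
proof -
  assume a: "T * U = 1" "U * T = 1"
  then have "dinvertible T" unfolding dinvertible_def by blast
  then have "dinv T * T = 1" using dinv by blast
  then show ?thesis using a by (metis mult.assoc mult_1_left mult_1_right)
qed

lemma leads_monic_order_zero:
  assumes "dinvertible S" "monic_order_zero S"
  shows "leads S 0 1" "leads (dinv S) 0 1"
proof -
  have "S \<noteq> 0" using assms(1) by (auto simp: dinvertible_def)
  then show S: "leads S 0 1"
    using assms(2) by (intro leads_symbI) (auto simp: monic_order_zero_def symb_def dconst_1)
  obtain U where "leads U 0 1" "U * S = 1" "S * U = 1" using leads_inverse[OF S] .
  then show "leads (dinv S) 0 1" using dinv_unique[of S U] by simp
qed

section \<open>Perturbation of power recursions in filtered rings\<close>

locale ring_filtration =
  fixes le :: "'r::ring_1 \<Rightarrow> int \<Rightarrow> bool"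
  assumes le_add: "le x r \<Longrightarrow> le y r \<Longrightarrow> le (x + y) r"
    and le_mult: "le x r \<Longrightarrow> le y s \<Longrightarrow> le (x * y) (r + s)"
    and le_mono: "le x r \<Longrightarrow> r \<le> s \<Longrightarrow> le x s"
    and le_1: "le 1 0"
begin

lemma le_power: "le x r \<Longrightarrow> le (x ^ n) (int n * r)"
proof (induction n)
  case (Suc n)
  then show ?case using le_mult[of x r "x ^ n" "int n * r"] by (simp add: distrib_right)
qed (simp add: le_1)

text \<open>x^(n+1) - y^(n+1) = x (x^n - y^n) + (x - y) y^n holds without commutation.\<close>

lemma le_power_diff:
  assumes "le x w" "le y w" "le (x - y) s"
  shows "le (x ^ Suc n - y ^ Suc n) (s + int n * w)"
proof (induction n)
  case (Suc n)
  have "le (x * (x ^ Suc n - y ^ Suc n) + (x - y) * y ^ Suc n) (s + int (Suc n) * w)"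
    using le_mult[OF assms(1) Suc.IH] le_mult[OF assms(3) le_power[OF assms(2), of "Suc n"]]
    by (intro le_add) (simp_all add: algebra_simps)
  then show ?case by (simp add: algebra_simps)
qed (use assms in simp)

text \<open>\<open>F\<close> and \<open>G\<close> are head-chopping sequences with the same
  exponents and scalars, whose subtracted powers cancel in the difference. By \<open>E\<close> the
  error never exceeds order \<open>w i\<close>, so \<open>F i\<close> obeys the bound of
  \<open>G i\<close> and the next powers can be compared. The argument serves both for operators and
  for Laurent series.\<close>

lemma power_recursion_perturbation:
  assumes rec: "\<And>i. i < I \<Longrightarrow> F (Suc i) - G (Suc i) = F i ^ \<nu> i - G i ^ \<nu> i"
    and \<nu>: "\<And>i. i < I \<Longrightarrow> 1 \<le> \<nu> i"
    and 0: "le (F 0 - G 0) r" and G: "\<And>i. i \<le> I \<Longrightarrow> le (G i) (int (w i))"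
    and E: "\<And>i. i \<le> I \<Longrightarrow> int (\<Sum>j<i. (\<nu> j - 1) * w j) + r \<le> int (w i)"
    and "i \<le> I"
  shows "le (F i - G i) (int (\<Sum>j<i. (\<nu> j - 1) * w j) + r)"
  using \<open>i \<le> I\<close>
proof (induction i)
  case (Suc i)
  then have IH: "le (F i - G i) (int (\<Sum>j<i. (\<nu> j - 1) * w j) + r)" by simp
  have "le ((F i - G i) + G i) (int (w i))"
    using IH Suc.prems by (intro le_add G le_mono[OF IH E]) auto
  then have "le (F i) (int (w i))" by simp
  moreover obtain n where n: "\<nu> i = Suc n" using \<nu>[of i] Suc.prems by (cases "\<nu> i") auto
  ultimately have "le (F i ^ \<nu> i - G i ^ \<nu> i) (int (\<Sum>j<i. (\<nu> j - 1) * w j) + r + int n * int (w i))"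
    unfolding n using Suc.prems IH by (intro le_power_diff G) auto
  moreover have "F (Suc i) - G (Suc i) = F i ^ \<nu> i - G i ^ \<nu> i" using Suc.prems by (intro rec) simp
  ultimately show ?case by (simp add: n add_ac)
qed (use 0 in simp)

end

interpretation dsym: ring_filtration "ordle :: 'a::field_char_0 dsym \<Rightarrow> int \<Rightarrow> bool"
  by standard (auto intro: ordle_add ordle_mult ordle_mono leads_ordle[OF leads_1, simplified])

text \<open>Modulo p the semigroup becomes a group, since p - 1 copies of an element represent its
  negative. The least positive integer with an attained residue therefore divides every
  element.\<close>

lemma semigroup_residue_1:
  fixes G :: "nat set"
  assumes add: "\<And>x y. x \<in> G \<Longrightarrow> y \<in> G \<Longrightarrow> x + y \<in> G" and "0 \<in> G" and p: "p \<in> G" "0 < p"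
    and gcd: "\<And>g. (\<And>x. x \<in> G \<Longrightarrow> g dvd x) \<Longrightarrow> g = 1"
  shows "\<exists>w\<in>G. w mod p = 1 mod p"
proof -
  let ?P = "\<lambda>x. 0 < x \<and> (\<exists>w\<in>G. w mod p = x mod p)"
  define x where "x = Least ?P"
  have "?P p" using p by (intro conjI bexI[of _ p]) auto
  then have x: "?P x" and le: "\<And>y. ?P y \<Longrightarrow> x \<le> y" using LeastI[of ?P p] Least_le[of ?P] unfolding x_def by blast+
  then obtain w where w: "w \<in> G" "w mod p = x mod p" by blast
  have mult: "n * y \<in> G" if "y \<in> G" for n y
    using that by (induction n) (auto intro: add \<open>0 \<in> G\<close>)
  have "x dvd u" if u: "u \<in> G" for u
  proof (rule ccontr)
    assume "\<not> x dvd u"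
    then have r: "0 < u mod x" by (simp add: dvd_eq_mod_eq_0)
    \<comment> \<open>Modulo p this subtracts (u div x) x from u and leaves the remainder
      \<open>u mod x\<close>.\<close>
    let ?v = "u + ((p - 1) * (u div x)) * w"
    have "?v mod p = (u + ((p - 1) * (u div x)) * x) mod p"
      using w(2) by (metis mod_add_right_eq mod_mult_right_eq)
    also have "u + ((p - 1) * (u div x)) * x = u mod x + p * ((u div x) * x)"
      using p(2) div_mult_mod_eq[of u x] by (cases p) (simp_all add: algebra_simps)
    finally have "?v mod p = (u mod x) mod p" by simp
    moreover have "?v \<in> G" using u w mult add by blast
    ultimately have "x \<le> u mod x" using r by (intro le) blast
    then show False using x by (simp add: not_less[symmetric])
  qed
  then have "x = 1" by (rule gcd)
  then show ?thesis using w by blast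
qed

section \<open>Head-chopping sequences\<close>

lemma conj_power:
  fixes S U :: "'r::monoid_mult"
  assumes "S * U = 1" "U * S = 1"
  shows "U * A ^ n * S = (U * A * S) ^ n"
proof (induction n)
  case (Suc n)
  have "U * A ^ Suc n * S = U * A * (S * U) * A ^ n * S" by (simp add: assms mult.assoc)
  also have "\<dots> = (U * A * S) * (U * A ^ n * S)" by (simp add: mult.assoc)
  finally show ?case by (simp add: Suc.IH)
qed (simp add: assms)

lemma head_chop_conj:
  assumes "S * U = 1" "U * S = 1"
  shows "U * head_chop \<nu> \<mu> \<epsilon> P Q i * S = head_chop \<nu> \<mu> \<epsilon> (U * P * S) (U * Q * S) i"
proof (induction i)
  case (Suc i)
  have "U * (dconst k * A) * S = dconst k * (U * A * S)" for k A
    by (metis dconst_commute mult.assoc)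
  then show ?case
    by (simp add: conj_power[OF assms, symmetric] Suc.IH[symmetric] left_diff_distrib right_diff_distrib)
qed simp

text \<open>Powers of P drop out of the commutator, so a step only takes the power
  \<open>\<nu> i\<close>, which adds (\<nu> i - 1) w i to the order. The start is [Q, P] = 1, of
  order 0.\<close>

lemma leads_head_chop_commutator:
  assumes PQ: "Q * P - P * Q = 1"
    and \<nu>: "\<And>i. i < I \<Longrightarrow> 1 \<le> \<nu> i"
    and hc: "\<And>i. i \<le> I \<Longrightarrow> leads (head_chop \<nu> \<mu> \<epsilon> P Q i) (w i) (c i)" "\<And>i. i \<le> I \<Longrightarrow> c i \<noteq> 0"
    and "i \<le> I"
  shows "\<exists>e. e \<noteq> 0 \<and> leads (head_chop \<nu> \<mu> \<epsilon> P Q i * P - P * head_chop \<nu> \<mu> \<epsilon> P Q i)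
    (\<Sum>j<i. (\<nu> j - 1) * w j) e"
  using \<open>i \<le> I\<close>
proof (induction i)
  case 0
  show ?case using PQ leads_1 by (intro exI[of _ 1]) simp
next
  case (Suc i)
  let ?A = "head_chop \<nu> \<mu> \<epsilon> P Q i"
  obtain e where e: "e \<noteq> 0" "leads (?A * P - P * ?A) (\<Sum>j<i. (\<nu> j - 1) * w j) e"
    using Suc by auto
  obtain n where n: "\<nu> i = Suc n" using \<nu>[of i] Suc.prems by (cases "\<nu> i") auto
  have c: "dconst k * P ^ r * P = P * (dconst k * P ^ r)" for k r
    by (metis dconst_commute mult.assoc power_commutes)
  have "head_chop \<nu> \<mu> \<epsilon> P Q (Suc i) * P - P * head_chop \<nu> \<mu> \<epsilon> P Q (Suc i) =
      ?A ^ Suc n * P - P * ?A ^ Suc n"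
    by (simp only: head_chop.simps n left_diff_distrib right_diff_distrib c) simp
  moreover have "leads (?A ^ Suc n * P - P * ?A ^ Suc n) ((\<Sum>j<i. (\<nu> j - 1) * w j) + n * w i)
      (of_nat (Suc n) * c i ^ n * e)"
    using Suc.prems by (intro leads_commutator_power hc e) auto
  moreover have "of_nat (Suc n) * c i ^ n * e \<noteq> 0"
    using hc(2)[of i] Suc.prems e by (simp del: of_nat_Suc)
  ultimately show ?case by (intro exI[of _ "of_nat (Suc n) * c i ^ n * e"]) (simp add: n)
qed

text \<open>Commutation with \<open>dD ^ p\<close> raises degrees by p, and 1 is homogeneous of
  degree 0. Only the component of degree -p contributes to it; all others commute.\<close>

lemma commutes_without_component:
  assumes "Q * dD ^ p - dD ^ p * Q = 1"
  shows "(Q - hcomp Q (- int p)) * dD ^ p = dD ^ p * (Q - hcomp Q (- int p))"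
proof (rule rep_inject)
  fix k l
  have "rep (Q * dD ^ p - dD ^ p * Q) k l = (if l = k then 1 else 0)"
    by (simp add: assms rep_1)
  then have "(if p \<le> l then rep Q k (l - p) else 0) - rep Q (k + p) l = (if l = k then 1 else 0)"
    by (simp add: rep_mult_dD_power rep_dD_power_mult)
  then show "rep ((Q - hcomp Q (- int p)) * dD ^ p) k l = rep (dD ^ p * (Q - hcomp Q (- int p))) k l"
    by (auto simp: rep_mult_dD_power rep_dD_power_mult rep_hcomp split: if_splits)
qed

text \<open>Orders and leading constants are explicit data, which \<open>(dD ^ p, Qt')\<close> can
  inherit unchanged from \<open>(P, Q)\<close>.\<close>

locale chopped_pair =
  fixes P Q :: "'a::field_char_0 dsym" and \<nu> \<mu> :: "nat \<Rightarrow> nat" and \<epsilon> :: "nat \<Rightarrow> 'a"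
    and I :: nat and w :: "nat \<Rightarrow> nat" and c :: "nat \<Rightarrow> 'a"
  assumes chop_exponent: "\<And>i. i < I \<Longrightarrow> 1 \<le> \<nu> i"
    and chop_leads: "\<And>i. i \<le> I \<Longrightarrow> leads (head_chop \<nu> \<mu> \<epsilon> P Q i) (w i) (c i)"
    and chop_nonzero: "\<And>i. i \<le> I \<Longrightarrow> c i \<noteq> 0"
    and chop_lower: "\<And>i. i < I \<Longrightarrow> w (Suc i) < \<nu> i * w i"
begin

abbreviation H :: "nat \<Rightarrow> 'a dsym" where "H \<equiv> head_chop \<nu> \<mu> \<epsilon> P Q"

lemma head_chopping:
  assumes "Q * P - P * Q \<in> {0, 1}"
  shows "head_chopping_sequence \<nu> \<mu> \<epsilon> I P Q"
  unfolding head_chopping_sequence_def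
proof (intro conjI allI impI)
  fix i assume i: "i < I"
  have 1: "leads (H i ^ \<nu> i) (\<nu> i * w i) (c i ^ \<nu> i)"
    using i by (intro leads_power chop_leads) auto
  have 2: "leads (H (Suc i)) (w (Suc i)) (c (Suc i))"
    using i by (intro chop_leads) auto
  have lt: "int (w (Suc i)) < int (\<nu> i * w i)" using chop_lower[OF i] by (simp only: of_nat_less_iff)
  have nz: "c i ^ \<nu> i \<noteq> 0" "c (Suc i) \<noteq> 0" using chop_nonzero[of i] chop_nonzero[of "Suc i"] i by auto
  show "Ord_less (H (Suc i)) (H i ^ \<nu> i)"
    unfolding Ord_less_def using leads_Ord[OF 1] leads_Ord[OF 2] leads_nonzero[OF 1] nz lt
    by (simp del: head_chop.simps of_nat_mult)
qed (rule assms)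

lemma sequence:
  "sequence_of \<nu> \<mu> \<epsilon> I P Q (map (\<lambda>i. (w i, c i)) [0..<Suc I])"
  unfolding sequence_of_def Let_def
proof (intro conjI allI impI)
  fix i assume "i \<le> I"
  then have "map (\<lambda>i. (w i, c i)) [0..<Suc I] ! i = (w i, c i)"
    by (simp add: less_Suc_eq_le nth_append del: upt_Suc)
  moreover note leads_Ord[OF chop_leads chop_nonzero, of i] leads_symb[OF chop_leads chop_nonzero, of i]
    chop_nonzero[of i] \<open>i \<le> I\<close>
  ultimately show "snd (map (\<lambda>i. (w i, c i)) [0..<Suc I] ! i) \<noteq> 0"
    "Ord (H i) = int (fst (map (\<lambda>i. (w i, c i)) [0..<Suc I] ! i))"
    "symb (H i) = dconst (snd (map (\<lambda>i. (w i, c i)) [0..<Suc I] ! i)) *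
      dD ^ fst (map (\<lambda>i. (w i, c i)) [0..<Suc I] ! i)"
    by simp_all
qed simp

end

lemma chopped_pairI:
  assumes "head_chopping_sequence \<nu> \<mu> \<epsilon> I P Q"
    and hc: "\<forall>i\<le>I. orders_agree (head_chop \<nu> \<mu> \<epsilon> P Q i)"
  obtains c where "chopped_pair P Q \<nu> \<mu> \<epsilon> I (\<lambda>i. dord (head_chop \<nu> \<mu> \<epsilon> P Q i)) c"
proof -
  let ?H = "head_chop \<nu> \<mu> \<epsilon> P Q"
  have "\<exists>c. c \<noteq> 0 \<and> leads (?H i) (dord (?H i)) c" if "i \<le> I" for i
    using orders_agree_leads[of "?H i"] hc that by metis
  then obtain c where c: "\<And>i. i \<le> I \<Longrightarrow> c i \<noteq> 0" "\<And>i. i \<le> I \<Longrightarrow> leads (?H i) (dord (?H i)) (c i)"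
    by metis
  have less: "int (dord (?H (Suc i))) < Ord (?H i ^ \<nu> i)" if "i < I" for i
  proof -
    have "?H (Suc i) \<noteq> 0" "Ord (?H (Suc i)) = int (dord (?H (Suc i)))"
      using hc that by (auto simp: orders_agree_def simp del: head_chop.simps)
    moreover have "Ord_less (?H (Suc i)) (?H i ^ \<nu> i)"
      using assms(1) that by (simp add: head_chopping_sequence_def del: head_chop.simps)
    ultimately show ?thesis by (simp add: Ord_less_def del: head_chop.simps)
  qed
  have "chopped_pair P Q \<nu> \<mu> \<epsilon> I (\<lambda>i. dord (?H i)) c"
  proof
    fix i assume i: "i < I"
    \<comment> \<open>\<open>\<nu> i = 0\<close> is impossible: the power would be 1, of order 0,
      and the next order, a natural number, cannot be smaller.\<close>
    have "Ord (1 :: 'a dsym) = 0" using leads_Ord[OF leads_1] by simp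
    then show "1 \<le> \<nu> i"
      using less[OF i] by (cases "\<nu> i") (auto simp del: head_chop.simps(2))
    have "leads (?H i ^ \<nu> i) (\<nu> i * dord (?H i)) (c i ^ \<nu> i)"
      using i by (intro leads_power c) auto
    then have "Ord (?H i ^ \<nu> i) = int (\<nu> i * dord (?H i))"
      by (rule leads_Ord) (use c(1)[of i] i in auto)
    then show "dord (?H (Suc i)) < \<nu> i * dord (?H i)" using less[OF i] by linarith
  qed (use c in auto)
  then show ?thesis using that by blast
qed

lemma SeqGCD_eq_1D:
  assumes "SeqGCD \<nu> \<mu> \<epsilon> P Q (int I) = 1" and "Ord P = int p"
    and "\<And>i. i \<le> I \<Longrightarrow> Ord (head_chop \<nu> \<mu> \<epsilon> P Q i) = int (w i)"
    and "g dvd p" "\<And>i. i \<le> I \<Longrightarrow> g dvd w i"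
  shows "g = 1"
proof -
  have "int g dvd SeqGCD \<nu> \<mu> \<epsilon> P Q (int I)"
    unfolding SeqGCD_def by (rule Gcd_greatest) (use assms in auto)
  then show ?thesis using assms(1) by simp
qed

text \<open>The commutators \<open>[Q\<^sub>i, P]\<close> have order \<open>\<Sum>j<i. (\<nu> j - 1) w j\<close>. As \<open>Q\<^sub>i\<close> and \<open>P\<close> are differential
  operators, this is less than \<open>w i + p\<close>, so a change of \<open>Q\<close> by terms of order \<open>-p\<close> does not affect the
  leading terms of the \<open>Q\<^sub>i\<close>.\<close>

lemma chopped_pair_normal_form:
  assumes P: "orders_agree P" "dord P = p" and PQ: "Q * P - P * Q = 1"
    and hc: "\<forall>i\<le>I. orders_agree (head_chop \<nu> \<mu> \<epsilon> P Q i)"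
    and cp: "chopped_pair P Q \<nu> \<mu> \<epsilon> I (\<lambda>i. dord (head_chop \<nu> \<mu> \<epsilon> P Q i)) c"
    and S: "schur_operator P S" "monic_order_zero S" "Qt = dinv S * Q * S"
    and Qt': "Qt' = Qt - hcomp Qt (- int p)"
  shows "\<And>i. i \<le> I \<Longrightarrow> (\<Sum>j<i. (\<nu> j - 1) * dord (head_chop \<nu> \<mu> \<epsilon> P Q j)) < dord (head_chop \<nu> \<mu> \<epsilon> P Q i) + p"
    and "chopped_pair (dD ^ p) Qt' \<nu> \<mu> \<epsilon> I (\<lambda>i. dord (head_chop \<nu> \<mu> \<epsilon> P Q i)) c"
    and "Qt' * dD ^ p = dD ^ p * Qt'"
proof -
  let ?H = "head_chop \<nu> \<mu> \<epsilon> P Q" and ?N = "head_chop \<nu> \<mu> \<epsilon> (dD ^ p) Qt" and ?N' = "head_chop \<nu> \<mu> \<epsilon> (dD ^ p) Qt'"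
  let ?w = "\<lambda>i. dord (?H i)"
  let ?E = "\<lambda>i. \<Sum>j<i. (\<nu> j - 1) * ?w j"
  interpret cp: chopped_pair P Q \<nu> \<mu> \<epsilon> I ?w c by (rule cp)
  show E: "(?E i) < ?w i + p" if i: "i \<le> I" for i
  proof -
    obtain e where "e \<noteq> 0" "leads (?H i * P - P * ?H i)
        (?E i) e"
      using leads_head_chop_commutator[OF PQ cp.chop_exponent cp.chop_leads cp.chop_nonzero i] by blast
    then show ?thesis
      using leads_commutator_le[of "?H i" P] hc P i by (auto simp: orders_agree_def)
  qed
  have S': "dinvertible S" "dinv S * P * S = dD ^ p" using S P by (auto simp: schur_operator_def)
  note inv = dinv[OF S'(1)]
  note lS = leads_monic_order_zero[OF S'(1) S(2)]
  have chop: "dinv S * ?H i * S = ?N i" for i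
    using head_chop_conj[of S "dinv S" \<nu> \<mu> \<epsilon> P Q i] inv by (simp add: S'(2) S(3))
  have lead: "leads (?N i) (?w i) (c i)" if "i \<le> I" for i
    using leads_mult[OF leads_mult[OF lS(2) cp.chop_leads[OF that]] lS(1)] by (simp add: chop)
  have comm: "Qt * dD ^ p - dD ^ p * Qt = 1"
  proof -
    have "dinv S * (Q * P - P * Q) * S = (dinv S * Q * S) * (dinv S * P * S) - (dinv S * P * S) * (dinv S * Q * S)"
    proof -
      have "dinv S * A * S * (dinv S * B * S) = dinv S * (A * B) * S" for A B
      proof -
        have "dinv S * A * S * (dinv S * B * S) = dinv S * A * (S * dinv S) * B * S"
          by (simp only: mult.assoc)
        then show ?thesis using inv by (simp add: mult.assoc)
      qed
      then show ?thesis by (simp only: left_diff_distrib right_diff_distrib)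
    qed
    then show ?thesis using inv by (simp add: PQ S'(2) S(3))
  qed
  show "Qt' * dD ^ p = dD ^ p * Qt'" unfolding Qt' by (rule commutes_without_component[OF comm])
  have "ordle (hcomp Qt (- int p)) (- int p)" by (auto simp: ordle_def rep_hcomp)
  \<comment> \<open>The two sequences share \<open>dD ^ p\<close>, so they differ only through this
    error of order at most -p.\<close>
  then have d: "ordle (Qt' - Qt) (- int p)" by (simp add: Qt' ordle_def)
  have diff: "ordle (?N' i - ?N i)
      (int (?E i) + (- int p))" if "i \<le> I" for i
  proof (rule dsym.power_recursion_perturbation[where I = I])
    show "int (?E i) + - int p \<le> int (?w i)" if "i \<le> I" for i
      using E[OF that] by linarith
  qed (use d that lead cp.chop_exponent in \<open>auto intro: leads_ordle\<close>)
  have lead': "leads (?N' i) (?w i) (c i)" if "i \<le> I" for i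
    using leads_add_lower[OF lead[OF that] diff[OF that]] E[OF that] by (simp del: of_nat_sum)
  show "chopped_pair (dD ^ p) Qt' \<nu> \<mu> \<epsilon> I ?w c"
    by standard (use lead' cp.chop_exponent cp.chop_nonzero cp.chop_lower in auto)
qed

section \<open>Eigenvectors over Laurent series\<close>

definition degle :: "'a::field_char_0 fls \<Rightarrow> int \<Rightarrow> bool" where
  "degle a r \<longleftrightarrow> (\<forall>i. i < - r \<longrightarrow> a $$ i = 0)"

lemma degle_subdegree: "degle a r \<longleftrightarrow> a = 0 \<or> - r \<le> fls_subdegree a"
  by (auto simp: degle_def intro: fls_subdegree_geI fls_eq0_below_subdegree)

lemma degle_add: "degle a r \<Longrightarrow> degle b r \<Longrightarrow> degle (a + b) r"
  and degle_minus: "degle a r \<Longrightarrow> degle b r \<Longrightarrow> degle (a - b) r"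
  and degle_uminus: "degle a r \<Longrightarrow> degle (- a) r"
  and degle_mono: "degle a r \<Longrightarrow> r \<le> s \<Longrightarrow> degle a s"
  and degle_0: "degle 0 r"
  by (auto simp: degle_def)

lemma degle_const: "degle (fls_const c) 0"
  by (simp add: degle_def)

lemma degle_X_inv_power: "degle (fls_X_inv ^ n) (int n)"
  by (simp add: degle_def)

lemma degle_mult: "degle a r \<Longrightarrow> degle b s \<Longrightarrow> degle (a * b) (r + s)"
  unfolding degle_subdegree by (cases "a = 0 \<or> b = 0") auto

lemma degle_sum: "(\<And>x. x \<in> X \<Longrightarrow> degle (f x) r) \<Longrightarrow> degle (sum f X) r"
  by (induction X rule: infinite_finite_induct) (auto intro: degle_add degle_0)

lemma fls_mult_nth_lowest:
  assumes "degle a r" "degle b s"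
  shows "(a * b) $$ (- r - s) = a $$ (- r) * b $$ (- s)"
proof (cases "a = 0 \<or> b = 0")
  case False
  then have ab: "- r \<le> fls_subdegree a" "- s \<le> fls_subdegree b"
    using assms by (auto simp: degle_subdegree)
  show ?thesis
  proof (cases "- r = fls_subdegree a \<and> - s = fls_subdegree b")
    case True
    then have "- r - s = fls_subdegree a + fls_subdegree b" by linarith
    then show ?thesis using True fls_times_base[of a b] by metis
  next
    case False
    then have "- r < fls_subdegree a \<or> - s < fls_subdegree b" using ab by auto
    moreover have "(a * b) $$ (- r - s) = 0" using False ab by (intro fls_times_nth_eq0) auto
    ultimately show ?thesis by (auto simp: fls_eq0_below_subdegree)
  qed
qed auto

interpretation fls: ring_filtration "degle :: 'a::field_char_0 fls \<Rightarrow> int \<Rightarrow> bool"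
  by standard (auto intro: degle_add degle_mult degle_mono degle_const[of 1, simplified])

text \<open>The K-linear map from D/xD to K((z)) with \<partial>^l \<mapsto>
  \<open>\<phi> l\<close>, applied to a row vector. Rows of operators are finite; for infinite
  support the sum defaults to 0.\<close>

definition lcomb :: "(nat \<Rightarrow> 'a::field_char_0 fls) \<Rightarrow> (nat \<Rightarrow> 'a) \<Rightarrow> 'a fls" where
  "lcomb \<phi> c = (\<Sum>l | c l \<noteq> 0. fls_const (c l) * \<phi> l)"

lemma lcomb_eq:
  assumes "\<And>l. N < l \<Longrightarrow> c l = 0"
  shows "lcomb \<phi> c = (\<Sum>l\<le>N. fls_const (c l) * \<phi> l)"
  unfolding lcomb_def by (rule sum.mono_neutral_left) (use assms in \<open>auto simp: not_less[symmetric]\<close>)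

lemma lcomb_single:
  assumes "\<And>m. m \<noteq> a \<Longrightarrow> c m = 0"
  shows "lcomb \<phi> c = fls_const (c a) * \<phi> a"
proof -
  have "lcomb \<phi> c = (\<Sum>l\<le>a. fls_const (c l) * \<phi> l)" by (rule lcomb_eq) (simp add: assms)
  also have "\<dots> = (\<Sum>l\<in>{a}. fls_const (c l) * \<phi> l)"
    by (rule sum.mono_neutral_right) (auto simp: assms)
  finally show ?thesis by simp
qed

lemma lcomb_add:
  assumes "\<And>l. N < l \<Longrightarrow> c l = 0" "\<And>l. N' < l \<Longrightarrow> c' l = 0"
  shows "lcomb \<phi> (\<lambda>l. c l + c' l) = lcomb \<phi> c + lcomb \<phi> c'"
  using assms by (simp add: lcomb_eq[of "N + N'"] sum.distrib distrib_right flip: fls_plus_const)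

lemma lcomb_scale: "lcomb \<phi> (\<lambda>l. a * c l) = fls_const a * lcomb \<phi> c"
  by (cases "a = 0") (simp_all add: lcomb_def sum_distrib_left mult.assoc flip: fls_const_mult_const)

text \<open>The linear map defined by \<phi> is then injective, and its image W is complementary to
  zK[[z]]: a point of the big cell of Sato's Grassmannian.\<close>

definition graded :: "(nat \<Rightarrow> 'a::field_char_0 fls) \<Rightarrow> bool" where
  "graded \<phi> \<longleftrightarrow> (\<forall>k. degle (\<phi> k) (int k) \<and> \<phi> k $$ (- int k) = 1)"

lemma graded_nonzero: "graded \<phi> \<Longrightarrow> \<phi> k \<noteq> 0"
  by (auto simp: graded_def dest!: spec[of _ k])

lemma graded_subdegree: "graded \<phi> \<Longrightarrow> fls_subdegree (\<phi> k) = - int k"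
  by (auto simp: graded_def degle_def intro!: fls_subdegree_eqI dest!: spec[of _ k])

lemma lcomb_leading:
  assumes "graded \<phi>" "\<And>l. N < l \<Longrightarrow> c l = 0"
  shows "degle (lcomb \<phi> c) (int N)" "lcomb \<phi> c $$ (- int N) = c N"
proof -
  have d: "degle (fls_const (c l) * \<phi> l) (int l)" for l
    using degle_mult[OF degle_const, of "\<phi> l" "int l" "c l"] assms(1) by (simp add: graded_def)
  have eq: "lcomb \<phi> c = (\<Sum>l\<le>N. fls_const (c l) * \<phi> l)" by (rule lcomb_eq[OF assms(2)])
  show "degle (lcomb \<phi> c) (int N)"
    unfolding eq by (rule degle_sum, rule degle_mono[OF d]) auto
  have "(\<Sum>l\<le>N. (fls_const (c l) * \<phi> l) $$ (- int N)) = (\<Sum>l\<in>{N}. (fls_const (c l) * \<phi> l) $$ (- int N))"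
    by (rule sum.mono_neutral_right) (use d in \<open>auto simp: degle_def\<close>)
  then show "lcomb \<phi> c $$ (- int N) = c N"
    using assms(1) by (simp add: eq fls_nth_sum graded_def)
qed

text \<open>The pole orders of the \<open>\<phi> l\<close> are distinct, so the term of largest
  index cannot cancel. Thus W meets zK[[z]] only in 0.\<close>

lemma lcomb_subdegree_le_0:
  assumes "graded \<phi>" "\<And>l. N < l \<Longrightarrow> c l = 0" "c l0 \<noteq> 0"
  shows "lcomb \<phi> c \<noteq> 0" "fls_subdegree (lcomb \<phi> c) \<le> 0"
proof -
  define M where "M = Max {l. c l \<noteq> 0}"
  have fin: "finite {l. c l \<noteq> 0}"
    by (rule finite_subset[of _ "{..N}"]) (use assms(2) in \<open>auto simp: not_less[symmetric]\<close>)
  have "c M \<noteq> 0" unfolding M_def using Max_in[OF fin] assms(3) by auto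
  moreover have "c l = 0" if "M < l" for l
    using Max_ge[OF fin, of l] that by (force simp: M_def)
  ultimately have "lcomb \<phi> c $$ (- int M) \<noteq> 0" using lcomb_leading[OF assms(1), of M c] by simp
  then show "lcomb \<phi> c \<noteq> 0" "fls_subdegree (lcomb \<phi> c) \<le> 0"
    using fls_subdegree_leI[of "lcomb \<phi> c" "- int M"] by auto
qed

lemma lcomb_eq_0:
  assumes "graded \<phi>" "\<And>l. N < l \<Longrightarrow> c l = 0" "lcomb \<phi> c = 0"
  shows "c l = 0"
  using lcomb_subdegree_le_0(1)[of \<phi> N c l] assms by blast

text \<open>Right multiplication by A on D/xD becomes multiplication by a on W.\<close>

definition eigen :: "(nat \<Rightarrow> 'a::field_char_0 fls) \<Rightarrow> 'a dsym \<Rightarrow> 'a fls \<Rightarrow> bool" where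
  "eigen \<phi> A a \<longleftrightarrow> (\<forall>k. lcomb \<phi> (rep A k) = a * \<phi> k)"

lemma lcomb_rep_mult: "lcomb \<phi> (rep (A * B) k) = lcomb (\<lambda>m. lcomb \<phi> (rep B m)) (rep A k)"
proof -
  obtain M where M: "\<And>m. M < m \<Longrightarrow> rep A k m = 0" using rep_row_bounded by blast
  obtain r where r: "\<And>k l. k + r < l \<Longrightarrow> rep B k l = 0" using rep_bounded by blast
  have B: "lcomb \<phi> (rep B m) = (\<Sum>l\<le>M + r. fls_const (rep B m l) * \<phi> l)" if "m \<le> M" for m
    by (rule lcomb_eq) (use r that in auto)
  have AB: "rep (A * B) k l = (\<Sum>m\<le>M. rep A k m * rep B m l)" for l by (rule rep_mult[OF M])
  have "rep (A * B) k l = 0" if "M + r < l" for l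
    unfolding AB by (rule sum.neutral) (use r that in auto)
  then have "lcomb \<phi> (rep (A * B) k) = (\<Sum>l\<le>M + r. fls_const (rep (A * B) k l) * \<phi> l)"
    by (rule lcomb_eq)
  also have "\<dots> = (\<Sum>l\<le>M + r. \<Sum>m\<le>M. fls_const (rep A k m) * (fls_const (rep B m l) * \<phi> l))"
  proof (intro sum.cong refl)
    fix l
    have c: "fls_const (sum f X) = (\<Sum>x\<in>X. fls_const (f x))" for f :: "nat \<Rightarrow> 'a" and X
      by (induction X rule: infinite_finite_induct) (auto simp flip: fls_plus_const)
    show "fls_const (rep (A * B) k l) * \<phi> l = (\<Sum>m\<le>M. fls_const (rep A k m) * (fls_const (rep B m l) * \<phi> l))"
      unfolding AB by (simp add: c sum_distrib_right mult.assoc flip: fls_const_mult_const)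
  qed
  also have "\<dots> = (\<Sum>m\<le>M. fls_const (rep A k m) * lcomb \<phi> (rep B m))"
    by (subst sum.swap) (simp add: B sum_distrib_left)
  also have "\<dots> = lcomb (\<lambda>m. lcomb \<phi> (rep B m)) (rep A k)" by (rule lcomb_eq[OF M, symmetric])
  finally show ?thesis .
qed

lemma lcomb_mult_left: "lcomb (\<lambda>m. a * \<phi> m) c = a * lcomb \<phi> c"
  by (simp add: lcomb_def sum_distrib_left mult.left_commute)

lemma eigen_mult: "eigen \<phi> A a \<Longrightarrow> eigen \<phi> B b \<Longrightarrow> eigen \<phi> (A * B) (a * b)"
  by (simp add: eigen_def lcomb_rep_mult lcomb_mult_left mult_ac)

lemma lcomb_rep_add: "lcomb \<phi> (rep (A + B) k) = lcomb \<phi> (rep A k) + lcomb \<phi> (rep B k)"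
proof -
  obtain M where M: "\<And>m. M < m \<Longrightarrow> rep A k m = 0" using rep_row_bounded by blast
  obtain N where N: "\<And>m. N < m \<Longrightarrow> rep B k m = 0" using rep_row_bounded by blast
  have "rep (A + B) k = (\<lambda>l. rep A k l + rep B k l)" by auto
  then show ?thesis using lcomb_add[of M "rep A k" N "rep B k"] M N by simp
qed

lemma lcomb_rep_minus: "lcomb \<phi> (rep (A - B) k) = lcomb \<phi> (rep A k) - lcomb \<phi> (rep B k)"
  using lcomb_rep_add[of \<phi> "A - B" B k] by simp

lemma eigen_add: "eigen \<phi> A a \<Longrightarrow> eigen \<phi> B b \<Longrightarrow> eigen \<phi> (A + B) (a + b)"
  by (simp add: eigen_def lcomb_rep_add distrib_right)

lemma eigen_minus: "eigen \<phi> A a \<Longrightarrow> eigen \<phi> B b \<Longrightarrow> eigen \<phi> (A - B) (a - b)"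
  by (simp add: eigen_def lcomb_rep_minus left_diff_distrib)

lemma eigen_dconst: "eigen \<phi> (dconst c) (fls_const c)"
  unfolding eigen_def
proof
  show "lcomb \<phi> (rep (dconst c) k) = fls_const c * \<phi> k" for k
    by (subst lcomb_single[of k]) (auto simp: rep_dconst)
qed

lemma eigen_1: "eigen \<phi> 1 1"
  using eigen_dconst[of \<phi> 1] by (simp add: dconst_1)

lemma eigen_0: "eigen \<phi> 0 0"
  using eigen_dconst[of \<phi> 0] by (simp add: dconst_0)

lemma eigen_power: "eigen \<phi> A a \<Longrightarrow> eigen \<phi> (A ^ n) (a ^ n)"
  by (induction n) (auto intro: eigen_mult eigen_1)

lemma eigen_sum: "(\<And>x. x \<in> X \<Longrightarrow> eigen \<phi> (A x) (a x)) \<Longrightarrow> eigen \<phi> (sum A X) (sum a X)"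
  by (induction X rule: infinite_finite_induct) (auto intro: eigen_add eigen_0)

lemma lcomb_rep_dD_power: "lcomb \<phi> (rep (dD ^ p) k) = \<phi> (k + p)"
  by (subst lcomb_single[of "k + p"]) (auto simp: rep_dD_power)

lemma eigen_unique_operator:
  assumes "graded \<phi>" "eigen \<phi> A a" "eigen \<phi> B a"
  shows "A = B"
proof (rule rep_inject)
  fix k l
  obtain M where M: "\<And>m. M < m \<Longrightarrow> rep (A - B) k m = 0" using rep_row_bounded by blast
  have "lcomb \<phi> (rep (A - B) k) = 0" using assms(2,3) by (simp add: eigen_def lcomb_rep_minus)
  then have "rep (A - B) k l = 0" using lcomb_eq_0[of \<phi> M "rep (A - B) k" l] assms(1) M by blast
  then show "rep A k l = rep B k l" by simp
qed

text \<open>Row 0 is the image of the class of 1, and \<open>\<phi> 0\<close> is 1 + O(z), so the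
  symbol of A appears as the lowest term of \<open>a * \<phi> 0\<close>.\<close>

lemma eigen_leads:
  assumes \<phi>: "graded \<phi>" and e: "eigen \<phi> A a" and l: "leads A w c"
  shows "degle a (int w)" "a $$ (- int w) = c"
proof -
  have r: "rep A 0 l = 0" if "w < l" for l using leads_eq_0[OF l, of 0 l] that by simp
  have L: "degle (a * \<phi> 0) (int w)" "(a * \<phi> 0) $$ (- int w) = c"
    using lcomb_leading[of \<phi> w "rep A 0"] \<phi> r e leadsD[OF l, of 0] by (auto simp: eigen_def)
  show a: "degle a (int w)"
    using L(1) graded_nonzero[OF \<phi>, of 0] graded_subdegree[OF \<phi>, of 0]
    by (cases "a = 0") (auto simp: degle_subdegree)
  show "a $$ (- int w) = c"
    using fls_mult_nth_lowest[OF a, of "\<phi> 0" 0] \<phi> L(2) by (auto simp: graded_def dest: spec[of _ 0])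
qed

text \<open>\<open>a * \<phi> 0\<close> lies in W, which contains no nonzero element of zK[[z]].
  This later excludes positive orders in the coordinate ring of the curve.\<close>

lemma eigen_subdegree_le_0:
  assumes "graded \<phi>" "eigen \<phi> A a" "a \<noteq> 0"
  shows "fls_subdegree a \<le> 0"
proof -
  obtain M where M: "\<And>m. M < m \<Longrightarrow> rep A 0 m = 0" using rep_row_bounded by blast
  have e: "lcomb \<phi> (rep A 0) = a * \<phi> 0" using assms(2) by (simp add: eigen_def)
  moreover have nz: "a * \<phi> 0 \<noteq> 0" using assms(3) graded_nonzero[OF assms(1)] by simp
  ultimately obtain l where "rep A 0 l \<noteq> 0"
    unfolding lcomb_def by (metis (mono_tags, lifting) empty_Collect_eq sum.empty)
  with lcomb_subdegree_le_0(2)[of \<phi> M "rep A 0" l] assms(1) M have "fls_subdegree (a * \<phi> 0) \<le> 0"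
    unfolding e by blast
  then show ?thesis using assms(3) graded_nonzero[OF assms(1), of 0] graded_subdegree[OF assms(1), of 0]
    by simp
qed

primrec chop_fls ::
  "(nat \<Rightarrow> nat) \<Rightarrow> (nat \<Rightarrow> nat) \<Rightarrow> (nat \<Rightarrow> 'a::field_char_0) \<Rightarrow> 'a fls \<Rightarrow> 'a fls \<Rightarrow> nat \<Rightarrow> 'a fls"
where
  "chop_fls \<nu> \<mu> \<epsilon> y b 0 = b"
| "chop_fls \<nu> \<mu> \<epsilon> y b (Suc i) =
     chop_fls \<nu> \<mu> \<epsilon> y b i ^ \<nu> i - fls_const (\<epsilon> i ^ \<nu> i) * y ^ \<mu> i"

lemma eigen_head_chop:
  "eigen \<phi> P y \<Longrightarrow> eigen \<phi> Q b \<Longrightarrow> eigen \<phi> (head_chop \<nu> \<mu> \<epsilon> P Q i) (chop_fls \<nu> \<mu> \<epsilon> y b i)"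
  by (induction i) (auto intro!: eigen_minus eigen_mult eigen_power eigen_dconst)

section \<open>Periodic difference equations\<close>

lemma periodic_mod:
  fixes x :: "nat \<Rightarrow> 'b"
  assumes "\<And>k. x (k + p) = x k" "a mod p = b mod p"
  shows "x a = x b"
proof -
  have "x (k + j * p) = x k" for k j
    by (induction j) (auto simp: assms(1) add.assoc[symmetric] add.commute[of p])
  then have "x k = x (k mod p)" for k by (metis mod_mult_div_eq mult.commute)
  then show ?thesis using assms(2) by metis
qed

text \<open>The increments must sum to 0 over one period, which determines \<rho> as minus the mean
  of C.\<close>

lemma periodic_difference_equation:
  fixes C :: "nat \<Rightarrow> 'a::field_char_0"
  assumes "0 < p" and C: "\<And>k. C (k + p) = C k"
  shows "\<exists>\<rho> x. (\<forall>k. x (k + p) = x k) \<and> (\<forall>k. x (Suc k) = x k + \<rho> + C k)"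
proof -
  define \<rho> where "\<rho> = - (\<Sum>k<p. C k) / of_nat p"
  define x where "x = (\<lambda>k. \<Sum>i<k. \<rho> + C i)"
  have step: "x (Suc k) = x k + \<rho> + C k" for k by (simp add: x_def)
  have xp: "x (k + p) = x k" for k
  proof (induction k)
    case 0
    show ?case using \<open>0 < p\<close> by (simp add: x_def sum_subtractf \<rho>_def)
  next
    case (Suc k)
    then show ?case using step[of k] step[of "k + p"] C[of k] by simp
  qed
  show ?thesis
    by (rule exI[of _ \<rho>], rule exI[of _ x]) (use step xp in blast)
qed

definition subdiag :: "'a::field_char_0 dsym \<Rightarrow> nat \<Rightarrow> nat \<Rightarrow> nat \<Rightarrow> 'a" where
  "subdiag A w j k = (if j \<le> k + w then rep A k (k + w - j) else 0)"

lemma subdiag_periodic: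
  assumes "A * dD ^ p = dD ^ p * A"
  shows "subdiag A w j (k + p) = subdiag A w j k"
proof -
  have "rep A (k + p) l = (if p \<le> l then rep A k (l - p) else 0)" for k l
    using assms by (metis rep_dD_power_mult rep_mult_dD_power)
  then show ?thesis by (auto simp: subdiag_def)
qed

text \<open>Comparison of coefficients in the ansatz that \<open>\<phi> k\<close> is z^(-k) times
  the series of the \<open>x s k\<close> z^s, and the eigenvalue z^(-w) times the series of the
  \<open>\<rho> j\<close> z^j. As \<open>x s\<close> has period p and w is congruent to 1, stage s
  reads x(k + 1) = x(k) + \<rho> + known terms.\<close>

lemma eigen_coefficients_exist:
  fixes R :: "'a::field_char_0 dsym"
  assumes p: "0 < p" and w: "w mod p = 1 mod p" and comm: "R * dD ^ p = dD ^ p * R"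
    and lead: "leads R w 1"
  obtains \<rho> x where "\<And>k. x 0 k = (1::'a)" "\<And>s k. x s (k + p) = x s k"
    "\<And>s k. (\<Sum>j\<le>s. subdiag R w j k * x (s - j) (k + w - j)) = (\<Sum>j\<le>s. \<rho> j * x (s - j) k)"
proof -
  let ?r = "subdiag R w"
  \<comment> \<open>Stage s determines the pair (\<open>\<rho> s\<close>, \<open>x s\<close>). The
    terms containing it are isolated, using that R, \<rho> and x all start with 1; the remaining
    sums involve earlier stages only.\<close>
  define Pr where "Pr = (\<lambda>(f :: nat \<Rightarrow> 'a \<times> (nat \<Rightarrow> 'a)) s (y :: 'a \<times> (nat \<Rightarrow> 'a)).
    if s = 0 then y = (1, \<lambda>_. 1)
    else (\<forall>k. snd y (k + p) = snd y k) \<and>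
      (\<forall>k. snd y (k + w) + (\<Sum>j\<in>{1..s}. ?r j k * snd (f (s - j)) (k + w - j)) =
        snd y k + fst y + (\<Sum>j\<in>{1..<s}. fst (f j) * snd (f (s - j)) k)))"
  have per: "snd y (k + p) = snd y k" if "Pr f s y" for f s y k
    using that by (auto simp: Pr_def split: if_splits)
  have "\<exists>f. \<forall>s. Pr f s (f s)"
  proof (rule dependent_wf_choice[OF wf_less_than])
    fix f g :: "nat \<Rightarrow> 'a \<times> (nat \<Rightarrow> 'a)" and s y
    assume fg: "\<And>z. (z, s) \<in> less_than \<Longrightarrow> f z = g z"
    have "(\<Sum>j\<in>{1..s}. ?r j k * snd (f (s - j)) (k + w - j)) = (\<Sum>j\<in>{1..s}. ?r j k * snd (g (s - j)) (k + w - j))"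
      "(\<Sum>j\<in>{1..<s}. fst (f j) * snd (f (s - j)) k) = (\<Sum>j\<in>{1..<s}. fst (g j) * snd (g (s - j)) k)" for k
      by (rule sum.cong; use fg in auto)+
    then show "Pr f s y = Pr g s y" by (simp add: Pr_def)
  next
    fix s and f :: "nat \<Rightarrow> 'a \<times> (nat \<Rightarrow> 'a)"
    assume IH: "\<And>y. (y, s) \<in> less_than \<Longrightarrow> Pr f y (f y)"
    show "\<exists>r. Pr f s r"
    proof (cases "s = 0")
      case False
      define C where "C = (\<lambda>k. (\<Sum>j\<in>{1..<s}. fst (f j) * snd (f (s - j)) k) -
        (\<Sum>j\<in>{1..s}. ?r j k * snd (f (s - j)) (k + w - j)))"
      have fp: "snd (f (s - j)) (k + p) = snd (f (s - j)) k" if "1 \<le> j" for j k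
        using per[OF IH[of "s - j"]] that False by simp
      have 1: "?r j (k + p) * snd (f (s - j)) (k + p + w - j) = ?r j k * snd (f (s - j)) (k + w - j)"
        if "1 \<le> j" for j k
      proof (cases "j \<le> k + w")
        case True
        then have "k + p + w - j = k + w - j + p" by simp
        then show ?thesis by (simp only: subdiag_periodic[OF comm] fp[OF that])
      qed (unfold subdiag_periodic[OF comm], simp add: subdiag_def)
      have "C (k + p) = C k" for k
        unfolding C_def by (intro arg_cong2[where f = "(-)"] sum.cong refl) (simp_all only: 1 fp atLeastLessThan_iff atLeastAtMost_iff)
      then obtain \<rho> x where x: "\<And>k. x (k + p) = x k" "\<And>k. x (Suc k) = x k + \<rho> + C k"
        using periodic_difference_equation[OF p, of C] by metis
      have "x (k + w) = x (Suc k)" for k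
        by (rule periodic_mod[where p = p and x = x, OF x(1)])
          (metis w mod_add_right_eq add.commute plus_1_eq_Suc)
      then have "Pr f s (\<rho>, x)" using False x by (simp add: Pr_def C_def algebra_simps)
      then show ?thesis by blast
    qed (simp add: Pr_def)
  qed
  then obtain f where f: "\<And>s. Pr f s (f s)" by blast
  define \<rho> where "\<rho> = (\<lambda>s. fst (f s))"
  define x where "x = (\<lambda>s. snd (f s))"
  have 0: "f 0 = (1, \<lambda>_. 1)" using f[of 0] by (simp add: Pr_def)
  have r0: "?r 0 k = 1" for k using leadsD[OF lead] by (simp add: subdiag_def)
  have "(\<Sum>j\<le>s. ?r j k * x (s - j) (k + w - j)) = (\<Sum>j\<le>s. \<rho> j * x (s - j) k)" for s k
  proof (cases "s = 0")
    case False
    have "(\<Sum>j\<le>s. ?r j k * x (s - j) (k + w - j)) =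
        x s (k + w) + (\<Sum>j\<in>{1..s}. ?r j k * x (s - j) (k + w - j))"
      by (simp add: atMost_atLeast0 sum.atLeast_Suc_atMost r0)
    also have "\<dots> = x s k + \<rho> s + (\<Sum>j\<in>{1..<s}. \<rho> j * x (s - j) k)"
      using f[of s] False by (simp add: Pr_def \<rho>_def x_def)
    also have "\<dots> = (\<Sum>j\<in>insert 0 (insert s {1..<s}). \<rho> j * x (s - j) k)"
      using False by (simp add: \<rho>_def x_def 0)
    also have "insert 0 (insert s {1..<s}) = {..s}" by auto
    finally show ?thesis .
  qed (simp add: r0 x_def \<rho>_def 0)
  moreover have "x s (k + p) = x s k" for s k using per[OF f] by (simp add: x_def)
  moreover have "x 0 k = 1" for k by (simp add: x_def 0)
  ultimately show ?thesis using that[of x \<rho>] by blast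
qed

text \<open>An operator \<open>R\<close> of order \<open>1\<close> modulo \<open>p\<close> has an eigenvector over \<open>K((z))\<close> because its coefficients are found
  recursively from difference equations of period \<open>p\<close>; the free constants \<open>\<rho> j\<close> make them solvable.\<close>

lemma eigenvector_exists:
  fixes R :: "'a::field_char_0 dsym"
  assumes p: "0 < p" and w: "w mod p = 1 mod p" and comm: "R * dD ^ p = dD ^ p * R"
    and lead: "leads R w 1"
  obtains \<phi> \<rho> where "graded \<phi>" "\<And>k. \<phi> (k + p) = fls_X_inv ^ p * \<phi> k" "eigen \<phi> R \<rho>"
    "degle \<rho> (int w)" "\<rho> $$ (- int w) = 1"
proof -
  obtain \<rho> x where x0: "\<And>k. x 0 k = (1::'a)" and xp: "\<And>s k. x s (k + p) = x s k"
    and eq: "\<And>s k. (\<Sum>j\<le>s. subdiag R w j k * x (s - j) (k + w - j)) = (\<Sum>j\<le>s. \<rho> j * x (s - j) k)"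
    by (rule eigen_coefficients_exist[OF assms]) blast
  define F where "F = (\<lambda>k. Abs_fps (\<lambda>s. x s k))"
  define \<phi> where "\<phi> = (\<lambda>k. fls_X_inv ^ k * fps_to_fls (F k))"
  define \<rho>' where "\<rho>' = fls_X_inv ^ w * fps_to_fls (Abs_fps \<rho>)"
  have g: "graded \<phi>"
    by (simp add: graded_def \<phi>_def degle_def fls_X_inv_power_times_conv_shift F_def x0)
  moreover have "\<phi> (k + p) = fls_X_inv ^ p * \<phi> k" for k
    by (simp add: \<phi>_def F_def xp power_add mult_ac)
  moreover have "eigen \<phi> R \<rho>'"
    unfolding eigen_def
  proof
    fix k
    \<comment> \<open>Multiplication by z^(k+w) clears the poles, so the eigenvalue equation becomes
      an identity of power series.\<close>
    have fps: "(\<Sum>j\<le>k + w. fps_const (subdiag R w j k) * fps_X ^ j * F (k + w - j)) = Abs_fps \<rho> * F k"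
    proof (rule fps_ext)
      fix s
      have "(\<Sum>j\<le>k + w. fps_const (subdiag R w j k) * fps_X ^ j * F (k + w - j)) $ s =
          (\<Sum>j\<le>k + w. if j \<le> s then subdiag R w j k * x (s - j) (k + w - j) else 0)"
        by (auto simp: fps_sum_nth mult.assoc fps_X_power_mult_nth F_def intro!: sum.cong)
      also have "\<dots> = (\<Sum>j\<in>{j \<in> {..k + w}. j \<le> s}. subdiag R w j k * x (s - j) (k + w - j))"
        by (rule sum.inter_filter[symmetric]) simp
      also have "\<dots> = (\<Sum>j\<le>s. subdiag R w j k * x (s - j) (k + w - j))"
        by (rule sum.mono_neutral_left) (auto simp: subdiag_def)
      also have "\<dots> = (Abs_fps \<rho> * F k) $ s"
        unfolding eq by (simp add: fps_mult_nth F_def atMost_atLeast0)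
      finally show "(\<Sum>j\<le>k + w. fps_const (subdiag R w j k) * fps_X ^ j * F (k + w - j)) $ s =
          (Abs_fps \<rho> * F k) $ s" .
    qed
    have fsum: "fps_to_fls (sum h X) = (\<Sum>j\<in>X. fps_to_fls (h j))" for h :: "nat \<Rightarrow> 'a fps" and X
      by (induction X rule: infinite_finite_induct) auto
    have X: "fls_X_inv ^ (a - j) = fls_X_inv ^ a * (fls_X ^ j :: 'a fls)" if "j \<le> a" for a j
    proof -
      have "(fls_X_inv :: 'a fls) ^ a * fls_X ^ j = fls_X_inv ^ (a - j) * (fls_X_inv ^ j * fls_X ^ j)"
        using that by (simp flip: power_add mult.assoc)
      also have "(fls_X_inv :: 'a fls) ^ j * fls_X ^ j = 1"
        by (simp add: fls_X_inv_power_conv_shift_1 fls_X_power_conv_shift_1 fls_shifted_times_simps)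
      finally show ?thesis by simp
    qed
    have "lcomb \<phi> (rep R k) = (\<Sum>l\<le>k + w. fls_const (rep R k l) * \<phi> l)"
      by (rule lcomb_eq) (rule leads_eq_0[OF lead])
    also have "\<dots> = (\<Sum>j\<le>k + w. fls_const (rep R k (k + w - j)) * \<phi> (k + w - j))"
      by (rule sum.reindex_bij_witness[of _ "\<lambda>j. k + w - j" "\<lambda>j. k + w - j"]) auto
    also have "\<dots> = fls_X_inv ^ (k + w) *
        fps_to_fls (\<Sum>j\<le>k + w. fps_const (subdiag R w j k) * fps_X ^ j * F (k + w - j))"
      unfolding fsum sum_distrib_left
      by (intro sum.cong refl)
        (simp add: \<phi>_def X subdiag_def fls_times_fps_to_fls fps_to_fls_power mult_ac)
    also have "\<dots> = \<rho>' * \<phi> k"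
      unfolding fps by (simp add: \<rho>'_def \<phi>_def fls_times_fps_to_fls power_add mult_ac)
    finally show "lcomb \<phi> (rep R k) = \<rho>' * \<phi> k" .
  qed
  ultimately show ?thesis using that eigen_leads[OF g _ lead] by blast
qed

text \<open>Order plus index is p-periodic and has a minimum s. The coefficients h on this minimal
  line satisfy h(i + w) = h(i) = h(i + p), because R and \<rho> both lead with 1. So h is constant,
  and 0 because \<open>\<chi> 0 = 0\<close>, against the choice of s.\<close>

lemma eigenvector_unique:
  assumes p: "0 < p" and w: "w mod p = 1 mod p" and lead: "leads R w 1"
    and \<rho>: "degle \<rho> (int w)" "\<rho> $$ (- int w) = 1"
    and \<chi>: "\<And>k. lcomb \<chi> (rep R k) = \<rho> * \<chi> k" "\<And>k. \<chi> (k + p) = fls_X_inv ^ p * \<chi> k"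
    and 0: "\<chi> 0 = 0"
  shows "\<chi> k = 0"
proof (rule ccontr)
  assume nz: "\<chi> k \<noteq> 0"
  have per: "\<chi> (k mod p) = 0 \<longleftrightarrow> \<chi> k = 0" "fls_subdegree (\<chi> k) + int k = fls_subdegree (\<chi> (k mod p)) + int (k mod p)"
    if "\<chi> k \<noteq> 0" for k
  proof -
    have "\<chi> (i + j * p) = fls_X_inv ^ (j * p) * \<chi> i" for i j
    proof (induction j)
      case (Suc j)
      have "\<chi> (i + Suc j * p) = \<chi> (i + j * p + p)" by (simp add: add_ac)
      then show ?case by (simp only: \<chi>(2) Suc.IH) (simp add: power_add mult_ac)
    qed simp
    from this[of "k mod p" "k div p"] have e: "\<chi> k = fls_X_inv ^ (k div p * p) * \<chi> (k mod p)" by simp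
    then show "\<chi> (k mod p) = 0 \<longleftrightarrow> \<chi> k = 0" by simp
    have "int k = int (k div p * p) + int (k mod p)" by (metis div_mult_mod_eq of_nat_add)
    then show "fls_subdegree (\<chi> k) + int k = fls_subdegree (\<chi> (k mod p)) + int (k mod p)"
      using e that by auto
  qed
  define X where "X = (\<lambda>i. fls_subdegree (\<chi> i) + int i) ` {i. i < p \<and> \<chi> i \<noteq> 0}"
  define s where "s = Min X"
  have X: "finite X" "X \<noteq> {}" using per[OF nz] nz p by (auto simp: X_def intro!: exI[of _ "k mod p"])
  have ge: "\<chi> i $$ n = 0" if "n < s - int i" for i n
  proof (cases "\<chi> i = 0")
    case False
    then have "fls_subdegree (\<chi> i) + int i \<in> X"
      using per[OF False] p by (auto simp: X_def intro!: image_eqI[of _ _ "i mod p"])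
    then have "s \<le> fls_subdegree (\<chi> i) + int i" unfolding s_def using X by simp
    then show ?thesis using that by (intro fls_eq0_below_subdegree) simp
  qed simp
  have deg: "degle (\<chi> i) (int i - s)" for i using ge by (auto simp: degle_def)
  define h where "h = (\<lambda>i. \<chi> i $$ (s - int i))"
  have hp: "h (i + p) = h i" for i
    unfolding h_def \<chi>(2) by (simp add: fls_X_inv_power_times_conv_shift algebra_simps)
  have hw: "h (i + w) = h i" for i
  proof -
    have "lcomb \<chi> (rep R i) = (\<Sum>l\<le>i + w. fls_const (rep R i l) * \<chi> l)"
      by (rule lcomb_eq) (rule leads_eq_0[OF lead])
    then have "lcomb \<chi> (rep R i) $$ (s - int i - int w) =
        (\<Sum>l\<le>i + w. rep R i l * \<chi> l $$ (s - int i - int w))"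
      by (simp add: fls_nth_sum)
    also have "\<dots> = (\<Sum>l\<in>{i + w}. rep R i l * \<chi> l $$ (s - int i - int w))"
      by (rule sum.mono_neutral_right) (auto simp: ge)
    also have "\<dots> = h (i + w)" using leadsD[OF lead, of i] by (simp add: h_def algebra_simps)
    finally have 1: "lcomb \<chi> (rep R i) $$ (s - int i - int w) = h (i + w)" .
    have "(\<rho> * \<chi> i) $$ (- int w - (int i - s)) = h i"
      using fls_mult_nth_lowest[OF \<rho>(1) deg[of i]] by (simp add: \<rho>(2) h_def)
    then show ?thesis using 1 \<chi>(1)[of i] by (simp add: algebra_simps)
  qed
  have "h (Suc i) = h i" for i
    unfolding hw[of i, symmetric]
    by (rule periodic_mod[where p = p and x = h, OF hp])
      (metis w mod_add_right_eq add.commute plus_1_eq_Suc)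
  then have "h i = h 0" for i by (induction i) auto
  then have h0: "h i = 0" for i by (simp add: h_def 0)
  obtain i where i: "\<chi> i \<noteq> 0" "s = fls_subdegree (\<chi> i) + int i"
    using Min_in[OF X] unfolding s_def[symmetric] by (auto simp: X_def)
  then have "h i \<noteq> 0" by (simp add: h_def)
  then show False using h0 by simp
qed

text \<open>Commutation makes A\<phi> a second solution with the same eigenvalue and the same period
  relation. Subtracting the multiple of \<phi> that cancels its entry at 0 leaves a solution that
  vanishes by uniqueness.\<close>

lemma eigen_commuting:
  assumes p: "0 < p" and w: "w mod p = 1 mod p" and lead: "leads R w 1"
    and \<phi>: "graded \<phi>" "\<And>k. \<phi> (k + p) = fls_X_inv ^ p * \<phi> k" "eigen \<phi> R \<rho>"
    and \<rho>: "degle \<rho> (int w)" "\<rho> $$ (- int w) = 1"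
    and A: "A * dD ^ p = dD ^ p * A" "A * R = R * A"
  obtains a where "eigen \<phi> A a"
proof -
  define \<psi> where "\<psi> = (\<lambda>k. lcomb \<phi> (rep A k))"
  define a where "a = \<psi> 0 / \<phi> 0"
  define \<chi> where "\<chi> = (\<lambda>k. \<psi> k - a * \<phi> k)"
  have 1: "\<psi> (k + p) = fls_X_inv ^ p * \<psi> k" for k
  proof -
    have "\<psi> (k + p) = lcomb \<phi> (rep (dD ^ p * A) k)"
      by (simp only: lcomb_rep_mult lcomb_rep_dD_power \<psi>_def)
    also have "\<dots> = lcomb (\<lambda>m. fls_X_inv ^ p * \<phi> m) (rep A k)"
      by (simp only: A(1)[symmetric] lcomb_rep_mult lcomb_rep_dD_power \<phi>(2))
    finally show ?thesis by (simp only: lcomb_mult_left \<psi>_def)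
  qed
  have 2: "lcomb \<psi> (rep R k) = \<rho> * \<psi> k" for k
  proof -
    have "lcomb \<psi> (rep R k) = lcomb \<phi> (rep (R * A) k)" by (simp only: lcomb_rep_mult \<psi>_def)
    also have "\<dots> = lcomb (\<lambda>m. \<rho> * \<phi> m) (rep A k)"
      using \<phi>(3) by (simp only: A(2)[symmetric] lcomb_rep_mult eigen_def)
    finally show ?thesis by (simp only: lcomb_mult_left \<psi>_def)
  qed
  have "\<chi> k = 0" for k
  proof (rule eigenvector_unique[OF p w lead \<rho>])
    show "lcomb \<chi> (rep R k) = \<rho> * \<chi> k" for k
    proof -
      have "lcomb \<chi> (rep R k) = lcomb \<psi> (rep R k) - lcomb (\<lambda>m. a * \<phi> m) (rep R k)"
        by (simp add: lcomb_def \<chi>_def right_diff_distrib sum_subtractf)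
      then show ?thesis using \<phi>(3) unfolding 2 lcomb_mult_left
        by (simp add: eigen_def \<chi>_def algebra_simps)
    qed
    show "\<chi> (k + p) = fls_X_inv ^ p * \<chi> k" for k
      by (simp add: \<chi>_def 1 \<phi>(2) algebra_simps)
    show "\<chi> 0 = 0" using graded_nonzero[OF \<phi>(1)] by (simp add: \<chi>_def a_def)
  qed
  then have "eigen \<phi> A a" by (simp add: eigen_def \<chi>_def \<psi>_def)
  then show ?thesis using that by blast
qed

section \<open>Baker--Akhiezer functions\<close>

text \<open>K((z)) is the sum of W and zK[[z]]: poles are removed from the highest order downwards.
  The top coefficient is recorded because it becomes a diagonal entry of the Schur operator.\<close>

lemma lcomb_complement:
  assumes "graded \<phi>" "degle g (int N)"
  shows "\<exists>c. (\<forall>m>N. c m = 0) \<and> c N = g $$ (- int N) \<and> degle (g - lcomb \<phi> c) (- 1)"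
  using assms(2)
proof (induction N arbitrary: g)
  case 0
  let ?c = "\<lambda>m. if m = 0 then g $$ 0 else 0"
  have "lcomb \<phi> ?c = fls_const (g $$ 0) * \<phi> 0" by (subst lcomb_eq[of 0]) auto
  moreover have "degle (g - fls_const (g $$ 0) * \<phi> 0) (- 1)"
    unfolding degle_def
  proof (intro allI impI)
    fix i :: int assume "i < - (- 1)"
    then have "i = 0 \<or> i < 0" by linarith
    then show "(g - fls_const (g $$ 0) * \<phi> 0) $$ i = 0"
      using assms(1) 0 by (auto simp: graded_def degle_def dest!: spec[of _ "0 :: nat"])
  qed
  ultimately show ?case by (intro exI[of _ ?c]) auto
next
  case (Suc N)
  let ?a = "g $$ (- int (Suc N))"
  have "degle (g - fls_const ?a * \<phi> (Suc N)) (int N)"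
    unfolding degle_def
  proof (intro allI impI)
    fix i assume "i < - int N"
    then consider "i = - int (Suc N)" | "i < - int (Suc N)" by linarith
    moreover have "\<phi> (Suc N) $$ (- int (Suc N)) = 1" "i < - int (Suc N) \<Longrightarrow> \<phi> (Suc N) $$ i = 0"
      using assms(1) by (simp_all only: graded_def degle_def)
    ultimately show "(g - fls_const ?a * \<phi> (Suc N)) $$ i = 0"
      using Suc.prems by cases (simp_all add: degle_def del: of_nat_Suc)
  qed
  from Suc.IH[OF this] obtain c where c: "\<And>m. N < m \<Longrightarrow> c m = 0"
    "degle (g - fls_const ?a * \<phi> (Suc N) - lcomb \<phi> c) (- 1)" by blast
  let ?c = "c(Suc N := ?a)"
  have "lcomb \<phi> ?c = (\<Sum>l\<le>Suc N. fls_const (?c l) * \<phi> l)"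
    by (rule lcomb_eq) (use c in auto)
  also have "\<dots> = fls_const ?a * \<phi> (Suc N) + (\<Sum>l\<le>N. fls_const (c l) * \<phi> l)"
    by (simp add: add.commute)
  also have "(\<Sum>l\<le>N. fls_const (c l) * \<phi> l) = lcomb \<phi> c" by (rule lcomb_eq[symmetric]) (rule c)
  finally have L: "lcomb \<phi> ?c = fls_const ?a * \<phi> (Suc N) + lcomb \<phi> c" .
  have "degle (g - lcomb \<phi> ?c) (- 1)" using c(2) unfolding L by (simp only: diff_diff_eq)
  then show ?case using c(1) by (intro exI[of _ ?c] conjI) (assumption | simp)+
qed

text \<open>With \<open>t = z\<^sup>-\<^sup>1\<close>, \<open>\<psi> = \<Sum>k. v k x\<^sup>k / k!\<close> is a Baker--Akhiezer function: the sums below are the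
  coefficients of \<open>exp (- x t) \<psi>\<close> up to factorials.\<close>

definition baker_akhiezer :: "(nat \<Rightarrow> 'a::field_char_0 fls) \<Rightarrow> bool" where
  "baker_akhiezer v \<longleftrightarrow> graded v \<and>
     (\<forall>k\<ge>1. degle (\<Sum>j\<le>k. of_nat (k choose j) * (- fls_X_inv) ^ (k - j) * v j) (- 1))"

lemma minus_X_inv_power:
  "(- fls_X_inv) ^ n = fls_const ((- 1) ^ n) * (fls_X_inv ^ n :: 'a::field_char_0 fls)"
  using power_minus[of "fls_X_inv :: 'a fls" n] by (simp add: fls_const_power)

lemma degle_binomial_term:
  assumes "degle v (int j)" "v $$ (- int j) = 1" "j \<le> k"
  shows "degle (of_nat (k choose j) * (- fls_X_inv) ^ (k - j) * v) (int k)"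
    and "(of_nat (k choose j) * (- fls_X_inv) ^ (k - j) * v) $$ (- int k) = of_nat (k choose j) * (- 1) ^ (k - j)"
proof -
  have eq: "(of_nat (k choose j) * (- fls_X_inv) ^ (k - j) * v) $$ i =
      of_nat (k choose j) * ((- 1) ^ (k - j) * v $$ (i + int (k - j)))" for i
  proof -
    have "of_nat (k choose j) * (- fls_X_inv) ^ (k - j) * v =
      of_nat (k choose j) * (fls_const ((- 1) ^ (k - j)) * (fls_X_inv ^ (k - j) * v))"
      by (simp only: minus_X_inv_power mult.assoc)
    then show ?thesis
      by (simp only:) (simp add: fls_X_inv_power_times_conv_shift)
  qed
  show "degle (of_nat (k choose j) * (- fls_X_inv) ^ (k - j) * v) (int k)"
    unfolding degle_def eq using assms by (auto simp: degle_def)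
  show "(of_nat (k choose j) * (- fls_X_inv) ^ (k - j) * v) $$ (- int k) = of_nat (k choose j) * (- 1) ^ (k - j)"
    unfolding eq using assms by (simp add: of_nat_diff)
qed

text \<open>Row k of T gives the W-component, along zK[[z]], of the negated part j < k of the
  binomial sum.\<close>

lemma baker_akhiezer_exists:
  fixes \<phi> :: "nat \<Rightarrow> 'a::field_char_0 fls"
  assumes "graded \<phi>"
  obtains T where "leads T 0 1" "baker_akhiezer (\<lambda>k. lcomb \<phi> (rep T k))"
proof -
  define S where "S = (\<lambda>f k. \<Sum>j<k. of_nat (k choose j) * (- fls_X_inv) ^ (k - j) * lcomb \<phi> (f j))"
  define Pr where "Pr = (\<lambda>f k c. (\<forall>m>k. c m = 0) \<and> c k = (1::'a) \<and>
    (1 \<le> k \<longrightarrow> degle (S f k + lcomb \<phi> c) (- 1)))"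
  have "\<exists>f. \<forall>k. Pr f k (f k)"
  proof (rule dependent_wf_choice[OF wf_less_than])
    fix f g :: "nat \<Rightarrow> nat \<Rightarrow> 'a" and k c assume "\<And>z. (z, k) \<in> less_than \<Longrightarrow> f z = g z"
    then have "S f k = S g k" by (auto simp: S_def intro!: sum.cong)
    then show "Pr f k c = Pr g k c" by (simp add: Pr_def)
  next
    fix k and f :: "nat \<Rightarrow> nat \<Rightarrow> 'a" assume IH: "\<And>y. (y, k) \<in> less_than \<Longrightarrow> Pr f y (f y)"
    show "\<exists>c. Pr f k c"
    proof (cases "k = 0")
      case True
      then show ?thesis by (intro exI[of _ "\<lambda>m. if m = 0 then 1 else 0"]) (auto simp: Pr_def)
    next
      case False
      have L: "degle (lcomb \<phi> (f j)) (int j)" "lcomb \<phi> (f j) $$ (- int j) = 1" if "j < k" for j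
        using lcomb_leading[OF assms, of j "f j"] IH[of j] that by (auto simp: Pr_def)
      have d: "degle (S f k) (int k)"
        unfolding S_def by (rule degle_sum, rule degle_binomial_term) (use L in auto)
      \<comment> \<open>The full alternating binomial sum is 0 for k > 0, so its part j < k is -1;
        this yields the diagonal entry 1.\<close>
      have "S f k $$ (- int k) = (\<Sum>j<k. of_nat (k choose j) * (- 1) ^ (k - j))"
        unfolding S_def fls_nth_sum by (intro sum.cong refl, rule degle_binomial_term) (use L in auto)
      also have "\<dots> = (\<Sum>j\<le>k. of_nat (k choose j) * 1 ^ j * (- 1) ^ (k - j)) - (1 :: 'a)"
        by (simp flip: lessThan_Suc_atMost)
      also have "\<dots> = - 1" using False binomial_ring[of "1 :: 'a" "- 1" k] by (simp add: zero_power)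
      finally have top: "(- S f k) $$ (- int k) = 1" by simp
      obtain c where "\<forall>m>k. c m = 0" "c k = 1" "degle (- S f k - lcomb \<phi> c) (- 1)"
        using lcomb_complement[OF assms degle_uminus[OF d]] top by metis
      moreover from this(3) have "degle (S f k + lcomb \<phi> c) (- 1)"
        using degle_uminus[of "- S f k - lcomb \<phi> c" "- 1"] by (simp add: add.commute)
      ultimately show ?thesis by (auto simp: Pr_def)
    qed
  qed
  then obtain \<tau> where \<tau>: "\<And>k. Pr \<tau> k (\<tau> k)" by blast
  obtain T where T: "\<And>k l. rep T k l = \<tau> k l"
    using rep_surj[of 0 \<tau>] \<tau> by (auto simp: Pr_def)
  have T': "rep T k = \<tau> k" for k by (rule ext) (rule T)
  have l: "leads T 0 1" using \<tau> by (auto simp: leads_def ordle_def T Pr_def)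
  have g: "graded (\<lambda>k. lcomb \<phi> (rep T k))"
    unfolding graded_def T' using lcomb_leading[OF assms] \<tau> by (simp add: Pr_def)
  have "degle (\<Sum>j\<le>k. of_nat (k choose j) * (- fls_X_inv) ^ (k - j) * lcomb \<phi> (rep T j)) (- 1)" if "1 \<le> k" for k
    using \<tau>[of k] that by (simp add: Pr_def S_def T' flip: lessThan_Suc_atMost)
  then show ?thesis using that[of T] l g by (simp add: baker_akhiezer_def)
qed

section \<open>Division by the Baker--Akhiezer function\<close>

definition cdegle :: "'a::field_char_0 fls fps \<Rightarrow> int \<Rightarrow> bool" where
  "cdegle H r \<longleftrightarrow> (\<forall>k. degle (H $ k) r)"

definition lift_coeff :: "'a::field_char_0 fps \<Rightarrow> 'a fls fps" where
  "lift_coeff a = Abs_fps (\<lambda>i. fls_const (a $ i))"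

lemma cdegle_add: "cdegle H r \<Longrightarrow> cdegle G r \<Longrightarrow> cdegle (H + G) r"
  and cdegle_minus: "cdegle H r \<Longrightarrow> cdegle G r \<Longrightarrow> cdegle (H - G) r"
  and cdegle_mono: "cdegle H r \<Longrightarrow> r \<le> s \<Longrightarrow> cdegle H s"
  by (auto simp: cdegle_def intro: degle_add degle_minus degle_mono)

lemma cdegle_mult: "cdegle H r \<Longrightarrow> cdegle G s \<Longrightarrow> cdegle (H * G) (r + s)"
  by (auto simp: cdegle_def fps_mult_nth intro!: degle_sum degle_mult)

lemma cdegle_lift_coeff: "cdegle (lift_coeff a) 0"
  by (simp add: cdegle_def lift_coeff_def degle_const)

lemma cdegle_const: "degle b r \<Longrightarrow> cdegle (fps_const b) r"
  by (simp add: cdegle_def degle_0)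

lemma cdegle_deriv:
  assumes "cdegle H r"
  shows "cdegle (fps_deriv H) r"
proof -
  have "degle (of_nat m * b) r" if "degle b r" for m and b :: "'a fls"
    using that by (auto simp: degle_def)
  then show ?thesis using assms by (auto simp: cdegle_def simp del: of_nat_Suc of_nat_add)
qed

text \<open>exp(-xt) \<partial> exp(xt) = \<partial> + t with t = z^(-1).\<close>

definition twisted_deriv :: "'a::field_char_0 fls fps \<Rightarrow> 'a fls fps" where
  "twisted_deriv H = fps_deriv H + fps_const fls_X_inv * H"

lemma exp_mult_nth_deriv:
  "fps_exp (- fls_X_inv) * fps_nth_deriv l \<psi> = (twisted_deriv ^^ l) (fps_exp (- fls_X_inv) * \<psi>)"
proof (induction l)
  case (Suc l)
  let ?E = "fps_exp (- fls_X_inv) :: 'a fls fps" and ?G = "fps_nth_deriv l \<psi>"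
  have "fps_deriv (?E * ?G) = ?E * fps_deriv ?G - fps_const fls_X_inv * (?E * ?G)"
    by (simp add: algebra_simps flip: fps_const_neg)
  then have "?E * fps_deriv ?G = twisted_deriv (?E * ?G)" by (simp add: twisted_deriv_def)
  moreover have "fps_nth_deriv (Suc l) \<psi> = fps_deriv ?G" by (rule fps_nth_deriv_commute)
  ultimately show ?case by (simp only: Suc.IH funpow.simps o_apply)
qed simp

text \<open>The terms beyond t^l \<chi> contain derivatives of \<chi>, which are O(z) because the
  constant 1 disappears. That order l - 1 is missing is the reason why \<open>P'\<close> is
  normalized.\<close>

lemma twisted_deriv_power:
  assumes "cdegle (\<chi> - 1) (- 1)"
  shows "cdegle ((twisted_deriv ^^ l) \<chi> - fps_const (fls_X_inv ^ l) * \<chi>) (int l - 2)"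
proof (induction l)
  case 0
  then show ?case by (simp add: cdegle_def degle_0)
next
  case (Suc l)
  let ?t = "fls_X_inv :: 'a fls"
  define H where "H = (twisted_deriv ^^ l) \<chi> - fps_const (?t ^ l) * \<chi>"
  have "(twisted_deriv ^^ Suc l) \<chi> = twisted_deriv (fps_const (?t ^ l) * \<chi> + H)"
    by (simp add: H_def)
  also have "\<dots> = fps_const (?t ^ Suc l) * \<chi> + fps_const (?t ^ l) * fps_deriv \<chi> +
      (fps_deriv H + fps_const ?t * H)"
    by (simp add: twisted_deriv_def algebra_simps flip: fps_const_mult)
  finally have eq: "(twisted_deriv ^^ Suc l) \<chi> - fps_const (?t ^ Suc l) * \<chi> =
      fps_const (?t ^ l) * fps_deriv \<chi> + (fps_deriv H + fps_const ?t * H)" by simp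
  have "cdegle (fps_deriv \<chi>) (- 1)" using cdegle_deriv[OF assms] by simp
  then have 1: "cdegle (fps_const (?t ^ l) * fps_deriv \<chi>) (int l + - 1)"
    by (intro cdegle_mult cdegle_const degle_X_inv_power)
  have H: "cdegle H (int l - 2)" using Suc.IH by (simp add: H_def)
  have t: "degle ?t 1" using degle_X_inv_power[of 1] by simp
  have 2: "cdegle (fps_const ?t * H) (1 + (int l - 2))" by (intro cdegle_mult cdegle_const t H)
  show ?case
    unfolding eq
    by (intro cdegle_add cdegle_mono[OF 1] cdegle_mono[OF 2] cdegle_mono[OF cdegle_deriv[OF H]]) auto
qed

lemma fact_fls_const: "(fact k :: 'a::field_char_0 fls) = fls_const (fact k)"
  by (metis fls_of_nat of_nat_fact)

lemma fls_const_inverse_fact: "fls_const (1 / fact k) * fact k = (1 :: 'a::field_char_0 fls)"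
  by (simp add: fact_fls_const)

locale baker_akhiezer_family =
  fixes v :: "nat \<Rightarrow> 'a::field_char_0 fls"
  assumes v: "baker_akhiezer v"
begin

lemma graded_v: "graded v"
  using v by (simp add: baker_akhiezer_def)

definition \<psi> :: "'a fls fps" where "\<psi> = Abs_fps (\<lambda>k. v k / fact k)"

definition E :: "'a fls fps" where "E = fps_exp (- fls_X_inv)"

lemma E_\<psi>: "cdegle (E * \<psi> - 1) (- 1)"
  unfolding cdegle_def
proof
  fix k
  show "degle ((E * \<psi> - 1) $ k) (- 1)"
  proof (cases "k = 0")
    case True
    have "(E * \<psi> - 1) $ k = v 0 - 1" by (simp add: True E_def \<psi>_def)
    then show ?thesis using graded_v
      by (auto simp: graded_def degle_def dest!: spec[of _ 0])
  next
    case False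
    have "(\<psi> * E) $ k = (\<Sum>j\<le>k. of_nat (k choose j) * (- fls_X_inv) ^ (k - j) * v j) / fact k"
      unfolding fps_mult_nth sum_divide_distrib atLeast0AtMost
      by (intro sum.cong refl) (simp add: E_def \<psi>_def binomial_fact field_simps)
    moreover have "degle (g / fact k) (- 1)" if "degle g (- 1)" for g :: "'a fls"
    proof -
      have "g / fact k = fls_const (1 / fact k) * g"
        by (simp add: fact_fls_const field_simps)
      then show ?thesis using that degle_mult[OF degle_const, of g "- 1"] by simp
    qed
    ultimately show ?thesis using v False
      by (simp add: baker_akhiezer_def mult.commute)
  qed
qed

text \<open>Division with remainder: after the twist, \<partial>^n \<psi> is t^n plus lower orders,
  so a multiple of it by a function of x removes the top order of \<eta>. The first quotient
  coefficient is kept for the leading coefficient of the resulting operator.\<close>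

lemma reduction:
  assumes "cdegle (E * \<eta>) (int n - 1)"
  shows "\<exists>a. (\<forall>l\<ge>n. a l = 0) \<and> (\<forall>m. n = Suc m \<longrightarrow> a m = Abs_fps (\<lambda>k. (E * \<eta>) $ k $$ (- int m))) \<and>
    cdegle (E * (\<eta> - (\<Sum>l<n. lift_coeff (a l) * fps_nth_deriv l \<psi>))) (- 1)"
  using assms
proof (induction n arbitrary: \<eta>)
  case 0
  then show ?case by (intro exI[of _ "\<lambda>_. 0"]) simp
next
  case (Suc n)
  define \<alpha> where "\<alpha> = Abs_fps (\<lambda>k. (E * \<eta>) $ k $$ (- int n))"
  define H where "H = E * fps_nth_deriv n \<psi> - fps_const (fls_X_inv ^ n)"
  have "cdegle H (int n - 1)"
  proof -
    have "H = ((twisted_deriv ^^ n) (E * \<psi>) - fps_const (fls_X_inv ^ n) * (E * \<psi>)) +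
        fps_const (fls_X_inv ^ n) * (E * \<psi> - 1)"
      unfolding H_def E_def exp_mult_nth_deriv by (simp add: algebra_simps)
    moreover have "cdegle (fps_const (fls_X_inv ^ n) * (E * \<psi> - 1)) (int n + - 1)"
      by (intro cdegle_mult cdegle_const degle_X_inv_power E_\<psi>)
    ultimately show ?thesis
      using cdegle_mono[OF twisted_deriv_power[OF E_\<psi>, of n], of "int n - 1"] by (auto intro: cdegle_add)
  qed
  then have 1: "cdegle (lift_coeff \<alpha> * H) (int n - 1)"
    using cdegle_mult[OF cdegle_lift_coeff, of H "int n - 1"] by simp
  have 2: "cdegle (E * \<eta> - lift_coeff \<alpha> * fps_const (fls_X_inv ^ n)) (int n - 1)"
    unfolding cdegle_def degle_def
  proof (intro allI impI)
    fix k i assume "i < - (int n - 1)"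
    then have "i = - int n \<or> i < - int n" by linarith
    then show "(E * \<eta> - lift_coeff \<alpha> * fps_const (fls_X_inv ^ n)) $ k $$ i = 0"
      using Suc.prems by (auto simp: lift_coeff_def \<alpha>_def cdegle_def degle_def)
  qed
  have "E * (\<eta> - lift_coeff \<alpha> * fps_nth_deriv n \<psi>) =
      (E * \<eta> - lift_coeff \<alpha> * fps_const (fls_X_inv ^ n)) - lift_coeff \<alpha> * H"
    by (simp add: H_def algebra_simps)
  then have "cdegle (E * (\<eta> - lift_coeff \<alpha> * fps_nth_deriv n \<psi>)) (int n - 1)"
    using cdegle_minus[OF 2 1] by simp
  from Suc.IH[OF this] obtain a where a: "\<And>l. n \<le> l \<Longrightarrow> a l = 0"
    "cdegle (E * (\<eta> - lift_coeff \<alpha> * fps_nth_deriv n \<psi> - (\<Sum>l<n. lift_coeff (a l) * fps_nth_deriv l \<psi>))) (- 1)"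
    by blast
  let ?a = "a(n := \<alpha>)"
  have "(\<Sum>l<Suc n. lift_coeff (?a l) * fps_nth_deriv l \<psi>) =
      (\<Sum>l<n. lift_coeff (a l) * fps_nth_deriv l \<psi>) + lift_coeff \<alpha> * fps_nth_deriv n \<psi>"
    by simp
  then have "cdegle (E * (\<eta> - (\<Sum>l<Suc n. lift_coeff (?a l) * fps_nth_deriv l \<psi>))) (- 1)"
    using a(2) by (simp only: diff_diff_eq add.commute)
  then show ?case using a(1) \<alpha>_def by (intro exI[of _ ?a]) auto
qed

text \<open>The k-th derivative of L\<psi> at x = 0 pairs the class of \<partial>^k L in D/xD with
  the derivatives \<open>v l\<close> of \<psi>.\<close>

lemma operator_series:
  assumes "\<And>l. N < l \<Longrightarrow> dcoeff L l = 0"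
  shows "lcomb v (rep L k) = fact k * (\<Sum>l\<le>N. lift_coeff (dcoeff L l) * fps_nth_deriv l \<psi>) $ k"
proof -
  let ?c = "\<lambda>i j. fls_const (of_nat (k choose j) * fact j * dcoeff L i $ j)"
  let ?D = "\<lambda>i j. fps_nth_deriv i \<psi> $ (k - j)"
  have "lcomb v (rep L k) = (\<Sum>l\<le>N + k. fls_const (rep L k l) * v l)"
    by (rule lcomb_eq) (rule rep_eq_0[of k N], use assms in auto)
  also have "\<dots> = (\<Sum>j\<le>k. \<Sum>i\<le>N. ?c i j * v (i + (k - j)))"
    by (rule rep_sum) (use assms in \<open>auto simp flip: fls_plus_const\<close>)
  also have "\<dots> = (\<Sum>j\<le>k. \<Sum>i\<le>N. fact k * (fls_const (dcoeff L i $ j) * ?D i j))"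
  proof (intro sum.cong refl)
    fix i j assume j: "j \<in> {..k}"
    have \<psi>: "v (i + (k - j)) = fact (k - j) * ?D i j"
      unfolding fps_nth_deriv_nth by (simp add: \<psi>_def add.commute)
    have c: "fls_const (of_nat (k choose j) * fact j * c) = of_nat (k choose j) * fact j * fls_const c" for c :: 'a
      by (simp add: fact_fls_const fls_of_nat)
    have "?c i j * v (i + (k - j)) =
        of_nat (k choose j) * fact j * fls_const (dcoeff L i $ j) * (fact (k - j) * ?D i j)"
      unfolding c \<psi> ..
    also have "\<dots> = (of_nat (k choose j) * fact j * fact (k - j)) * (fls_const (dcoeff L i $ j) * ?D i j)"
      by (simp only: mult_ac)
    also have "of_nat (k choose j) * fact j * fact (k - j) = (fact k :: 'a fls)"
      using j by (simp add: binomial_fact)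
    finally show "?c i j * v (i + (k - j)) =
        fact k * (fls_const (dcoeff L i $ j) * ?D i j)" .
  qed
  also have "\<dots> = fact k * (\<Sum>l\<le>N. lift_coeff (dcoeff L l) * fps_nth_deriv l \<psi>) $ k"
    by (subst sum.swap)
      (simp add: fps_sum_nth fps_mult_nth lift_coeff_def sum_distrib_left atLeast0AtMost)
  finally show ?thesis .
qed

lemma dsym_of_coefficients:
  fixes a :: "nat \<Rightarrow> 'b::field_char_0 fps"
  assumes "\<And>l. N < l \<Longrightarrow> a l = 0"
  obtains L where "dcoeff L = a"
proof -
  have "\<exists>r::nat. \<forall>k i. a k $ i \<noteq> 0 \<longrightarrow> k \<le> i + r"
    by (intro exI[of _ N]) (use assms in \<open>force simp: not_less[symmetric]\<close>)
  then have "dcoeff (Abs_dsym a) = a" by (intro Abs_dsym_inverse) simp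
  then show ?thesis using that by blast
qed

text \<open>Multiplication by exp(-xt) does not change the lowest nonzero coefficient in x, which
  thus lies both in the span of v and in zK[[z]].\<close>

lemma span_eq_0:
  assumes "\<And>k. \<exists>c N. (\<forall>l>N. c l = 0) \<and> \<zeta> $ k = lcomb v c" "cdegle (E * \<zeta>) (- 1)"
  shows "\<zeta> = 0"
proof -
  have "\<zeta> $ k = 0" for k
  proof (induction k rule: less_induct)
    case (less k)
    have "(E * \<zeta>) $ k = (\<Sum>j\<in>{0}. E $ j * \<zeta> $ (k - j))"
      unfolding fps_mult_nth by (rule sum.mono_neutral_right) (auto simp: less)
    then have d: "degle (\<zeta> $ k) (- 1)" using assms(2) by (auto simp: cdegle_def E_def dest!: spec[of _ k])
    obtain c N where c: "\<And>l. N < l \<Longrightarrow> c l = 0" "\<zeta> $ k = lcomb v c" using assms(1) by metis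
    show ?case
    proof (rule ccontr)
      assume nz: "\<zeta> $ k \<noteq> 0"
      then obtain l where "c l \<noteq> 0" unfolding c(2) lcomb_def by (metis (mono_tags, lifting) empty_Collect_eq sum.empty)
      then have "fls_subdegree (\<zeta> $ k) \<le> 0"
        unfolding c(2) using lcomb_subdegree_le_0(2)[OF graded_v, of N c l] c(1) by blast
      then show False using d nz by (auto simp: degle_subdegree)
    qed
  qed
  then show ?thesis by (intro fps_ext) simp
qed

text \<open>Multiplication by b preserves the span of v, so b\<psi> - L\<psi> has its coefficients
  there and vanishes. Then L and B have the same eigenvalue and coincide.\<close>

lemma eigen_series_eqI:
  assumes B: "eigen v B b" and a: "\<And>l. n \<le> l \<Longrightarrow> a l = 0"
    and c: "cdegle (E * (fps_const b * \<psi> - (\<Sum>l<n. lift_coeff (a l) * fps_nth_deriv l \<psi>))) (- 1)"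
  shows "dcoeff B = a"
proof -
  obtain L where L: "dcoeff L = a" using dsym_of_coefficients[of n a] a by auto
  let ?L = "\<Sum>l<n. lift_coeff (a l) * fps_nth_deriv l \<psi>"
  have "(\<Sum>l\<le>n. lift_coeff (dcoeff L l) * fps_nth_deriv l \<psi>) = ?L"
    by (simp add: L a lift_coeff_def flip: lessThan_Suc_atMost) (simp add: fps_eq_iff fps_mult_nth)
  then have series: "lcomb v (rep L k) = fact k * ?L $ k" for k
    using operator_series[of n L k] by (simp add: L a)
  have B': "fact k * (fps_const b * \<psi>) $ k = lcomb v (rep B k)" for k
    using B by (simp add: eigen_def \<psi>_def)
  have "fps_const b * \<psi> - ?L = 0"
  proof (rule span_eq_0[OF _ c])
    fix k
    obtain M where M: "\<And>l. M < l \<Longrightarrow> rep (dconst (1 / fact k) * (B - L)) k l = 0"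
      using rep_row_bounded by blast
    have "rep (dconst (1 / fact k) * (B - L)) k = (\<lambda>l. 1 / fact k * rep (B - L) k l)"
      by (rule ext) (rule rep_dconst_mult)
    then have "lcomb v (rep (dconst (1 / fact k) * (B - L)) k) = fls_const (1 / fact k) * lcomb v (rep (B - L) k)"
      by (simp only: lcomb_scale)
    also have "\<dots> = fls_const (1 / fact k) * (fact k * (fps_const b * \<psi> - ?L) $ k)"
      by (simp add: lcomb_rep_minus series right_diff_distrib flip: B')
    also have "\<dots> = (fps_const b * \<psi> - ?L) $ k"
      by (simp only: mult.assoc[symmetric] fls_const_inverse_fact mult_1_left)
    finally show "\<exists>c N. (\<forall>l>N. c l = 0) \<and> (fps_const b * \<psi> - ?L) $ k = lcomb v c"
      using M by metis
  qed
  then have L\<psi>: "?L = fps_const b * \<psi>" by simp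
  have "eigen v L b" unfolding eigen_def series L\<psi> by (simp add: \<psi>_def)
  then show ?thesis using eigen_unique_operator[OF graded_v B] L by blast
qed

text \<open>After the twist, b\<psi> agrees with b up to order N - 1. As b does not involve x,
  division starts at \<partial>^N with a constant coefficient.\<close>

lemma eigen_differential:
  assumes B: "eigen v B b" and b: "degle b (int N)"
  shows "\<And>l. N < l \<Longrightarrow> dcoeff B l = 0" "dcoeff B N = fps_const (b $$ (- int N))"
proof -
  have E: "E * (fps_const b * \<psi>) = fps_const b * (E * \<psi> - 1) + fps_const b" by (simp add: algebra_simps)
  have 1: "cdegle (fps_const b * (E * \<psi> - 1)) (int N + - 1)"
    by (intro cdegle_mult cdegle_const b E_\<psi>)
  have "cdegle (E * (fps_const b * \<psi>)) (int (Suc N) - 1)"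
    unfolding E by (intro cdegle_add cdegle_mono[OF 1] cdegle_mono[OF cdegle_const[OF b]]) auto
  from reduction[OF this] obtain a where a: "\<And>l. Suc N \<le> l \<Longrightarrow> a l = 0"
    "a N = Abs_fps (\<lambda>k. (E * (fps_const b * \<psi>)) $ k $$ (- int N))"
    "cdegle (E * (fps_const b * \<psi> - (\<Sum>l<Suc N. lift_coeff (a l) * fps_nth_deriv l \<psi>))) (- 1)"
    by blast
  have "dcoeff B = a" by (rule eigen_series_eqI[OF B a(1) a(3)])
  moreover have "a N = fps_const (b $$ (- int N))"
    unfolding a(2) E using 1 by (intro fps_ext) (auto simp: cdegle_def degle_def simp del: fps_mult_left_const_nth)
  ultimately show "\<And>l. N < l \<Longrightarrow> dcoeff B l = 0" "dcoeff B N = fps_const (b $$ (- int N))"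
    using a(1) by auto
qed

text \<open>Already t^(m+1) \<psi> - \<partial>^(m+1) \<psi> has order at most m - 1 after the
  twist, two below the top, so the division skips \<partial>^m.\<close>

lemma eigen_normalized:
  assumes B: "eigen v B (fls_X_inv ^ Suc m)"
  shows "dcoeff B m = 0"
proof -
  let ?t = "fls_X_inv :: 'a fls"
  let ?\<eta> = "fps_const (?t ^ Suc m) * \<psi> - fps_nth_deriv (Suc m) \<psi>"
  have "E * ?\<eta> = - ((twisted_deriv ^^ Suc m) (E * \<psi>) - fps_const (?t ^ Suc m) * (E * \<psi>))"
    unfolding right_diff_distrib using exp_mult_nth_deriv[of "Suc m" \<psi>, folded E_def]
    by (simp only: minus_diff_eq mult.left_commute)
  then have "cdegle (E * ?\<eta>) (int m - 1)"
    using twisted_deriv_power[OF E_\<psi>, of "Suc m"] by (simp add: cdegle_def degle_def)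
  from reduction[OF this] obtain a where a: "\<And>l. m \<le> l \<Longrightarrow> a l = 0"
    "cdegle (E * (?\<eta> - (\<Sum>l<m. lift_coeff (a l) * fps_nth_deriv l \<psi>))) (- 1)" by blast
  let ?a = "a(Suc m := 1)"
  have 1: "lift_coeff 1 = (1 :: 'a fls fps)" "lift_coeff 0 = (0 :: 'a fls fps)"
    by (rule fps_ext, simp add: lift_coeff_def)+
  have "(\<Sum>l<Suc (Suc m). lift_coeff (?a l) * fps_nth_deriv l \<psi>) =
      (\<Sum>l<m. lift_coeff (a l) * fps_nth_deriv l \<psi>) + fps_nth_deriv (Suc m) \<psi>"
    by (simp add: 1 a(1) del: fps_nth_deriv.simps)
  then have "cdegle (E * (fps_const (?t ^ Suc m) * \<psi> - (\<Sum>l<Suc (Suc m). lift_coeff (?a l) * fps_nth_deriv l \<psi>))) (- 1)"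
    using a(2) by (simp only: diff_diff_eq add.commute)
  then have "dcoeff B = ?a" by (intro eigen_series_eqI[OF B, of "Suc (Suc m)"]) (use a in auto)
  then show ?thesis using a(1) by simp
qed

end

section \<open>Evaluation of plane polynomials\<close>

definition peval :: "('a::comm_ring_1 \<Rightarrow> 'b::comm_ring_1) \<Rightarrow> 'b \<Rightarrow> 'a poly \<Rightarrow> 'b" where
  "peval \<kappa> x g = poly (map_poly \<kappa> g) x"

lemma peval_pCons: "\<kappa> 0 = 0 \<Longrightarrow> peval \<kappa> x (pCons a g) = \<kappa> a + x * peval \<kappa> x g"
  by (simp add: peval_def map_poly_pCons)

lemma peval_0 [simp]: "peval \<kappa> x 0 = 0"
  by (simp add: peval_def)

lemma peval_add:
  assumes "\<kappa> 0 = 0" "\<And>a b. \<kappa> (a + b) = \<kappa> a + \<kappa> b"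
  shows "peval \<kappa> x (g + h) = peval \<kappa> x g + peval \<kappa> x h"
  by (induction g h rule: poly_induct2) (simp_all add: peval_pCons assms algebra_simps)

lemma peval_mult:
  assumes "\<kappa> 0 = 0" "\<And>a b. \<kappa> (a + b) = \<kappa> a + \<kappa> b" "\<And>a b. \<kappa> (a * b) = \<kappa> a * \<kappa> b"
  shows "peval \<kappa> x (g * h) = peval \<kappa> x g * peval \<kappa> x h"
proof -
  have s: "peval \<kappa> x (smult a h) = \<kappa> a * peval \<kappa> x h" for a h
    by (induction h) (simp_all add: peval_pCons assms algebra_simps)
  show ?thesis
    by (induction g) (simp_all add: peval_pCons peval_add s assms algebra_simps)
qed

lemma peval_altdef:
  assumes "\<kappa> 0 = 0"
  shows "peval \<kappa> x g = (\<Sum>i\<le>degree g. \<kappa> (coeff g i) * x ^ i)"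
proof -
  have le: "degree (map_poly \<kappa> g) \<le> degree g"
    by (rule degree_le) (simp add: coeff_map_poly assms coeff_eq_0)
  have "poly (map_poly \<kappa> g) x = (\<Sum>i\<le>degree g. coeff (map_poly \<kappa> g) i * x ^ i)"
    unfolding poly_altdef
    by (rule sum.mono_neutral_left) (use le in \<open>auto simp: coeff_eq_0\<close>)
  then show ?thesis by (simp add: peval_def coeff_map_poly assms)
qed

lemma eval_XY_peval:
  fixes x y :: "'b::comm_ring_1"
  assumes "\<iota> 0 = 0"
  shows "eval_XY \<iota> f x y = peval (peval \<iota> y) x f"
  by (simp add: eval_XY_def peval_altdef assms sum_distrib_right sum_distrib_left mult_ac)

abbreviation scalar_XY :: "'a::comm_ring_1 \<Rightarrow> 'a poly poly" where "scalar_XY c \<equiv> [:[:c:]:]"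
abbreviation var_X :: "'a::comm_ring_1 poly poly" where "var_X \<equiv> [:0, 1:]"
abbreviation var_Y :: "'a::comm_ring_1 poly poly" where "var_Y \<equiv> [:[:0, 1:]:]"

abbreviation curve_eval :: "nat \<Rightarrow> 'a::field_char_0 fls \<Rightarrow> 'a poly poly \<Rightarrow> 'a fls" where
  "curve_eval p b \<equiv> peval (peval fls_const (fls_X_inv ^ p)) b"

text \<open>Gaussian elimination: a pivot \<open>s0\<close> solves equation N, and \<open>u'\<close>
  describes the other equations after the substitution.\<close>

lemma underdetermined_system:
  fixes u :: "'i \<Rightarrow> nat \<Rightarrow> 'a::field"
  assumes "finite S" "N < card S"
  shows "\<exists>x. (\<exists>s\<in>S. x s \<noteq> 0) \<and> (\<forall>i<N. (\<Sum>s\<in>S. x s * u s i) = 0)"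
  using assms
proof (induction N arbitrary: S u)
  case 0
  then obtain s where "s \<in> S" by fastforce
  then show ?case by (intro exI[of _ "\<lambda>_. 1"]) auto
next
  case (Suc N)
  show ?case
  proof (cases "\<forall>s\<in>S. u s N = 0")
    case True
    obtain x where "\<exists>s\<in>S. x s \<noteq> 0" "\<forall>i<N. (\<Sum>s\<in>S. x s * u s i) = 0"
      using Suc.IH[of S u] Suc.prems by auto
    then show ?thesis using True by (intro exI[of _ x]) (auto simp: less_Suc_eq)
  next
    case False
    then obtain s0 where s0: "s0 \<in> S" "u s0 N \<noteq> 0" by blast
    define S' where "S' = S - {s0}"
    have S': "finite S'" "N < card S'" "S = insert s0 S'" "s0 \<notin> S'"
      using Suc.prems s0 by (auto simp: S'_def)
    define u' where "u' = (\<lambda>s i. u s i - u s N / u s0 N * u s0 i)"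
    obtain x where x: "\<exists>s\<in>S'. x s \<noteq> 0" "\<And>i. i < N \<Longrightarrow> (\<Sum>s\<in>S'. x s * u' s i) = 0"
      using Suc.IH[OF S'(1,2), of u'] by blast
    define z where "z = - (\<Sum>s\<in>S'. x s * u s N) / u s0 N"
    define x' where "x' = x(s0 := z)"
    have "(\<Sum>s\<in>S. x' s * u s i) = 0" if "i < Suc N" for i
    proof -
      have "(\<Sum>s\<in>S'. x' s * u s i) = (\<Sum>s\<in>S'. x s * u s i)"
        using S'(4) by (intro sum.cong) (auto simp: x'_def)
      then have eq: "(\<Sum>s\<in>S. x' s * u s i) = z * u s0 i + (\<Sum>s\<in>S'. x s * u s i)"
        using S' by (simp add: x'_def)
      show ?thesis
      proof (cases "i = N")
        case True
        show ?thesis unfolding eq unfolding True using s0 by (simp add: z_def)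
      next
        case False
        then have "0 = (\<Sum>s\<in>S'. x s * u' s i)" using x(2)[of i] that by simp
        also have "\<dots> = (\<Sum>s\<in>S'. x s * u s i) - (\<Sum>s\<in>S'. x s * u s N) * (u s0 i / u s0 N)"
          unfolding u'_def sum_distrib_right sum_subtractf[symmetric]
          by (intro sum.cong refl) (simp add: algebra_simps)
        finally show ?thesis by (simp add: eq z_def)
      qed
    qed
    moreover have "\<exists>s\<in>S. x' s \<noteq> 0" using x(1) S' by (auto simp: x'_def)
    ultimately show ?thesis by blast
  qed
qed

lemma fls_cancel_leading:
  fixes a b :: "'a::field fls"
  assumes "a \<noteq> 0" "b \<noteq> 0" "fls_subdegree a = fls_subdegree b"
  obtains c where "c \<noteq> 0" "a = fls_const c * b \<or> fls_subdegree a < fls_subdegree (a - fls_const c * b)"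
proof -
  let ?s = "fls_subdegree a"
  define c where "c = a $$ ?s / b $$ ?s"
  have nz: "a $$ ?s \<noteq> 0" "b $$ ?s \<noteq> 0" using assms(1,2) by (simp, simp add: assms(3))
  have "(a - fls_const c * b) $$ i = 0" if "i \<le> ?s" for i
    using that assms nz by (cases "i = ?s") (auto simp: c_def)
  then have "a - fls_const c * b \<noteq> 0 \<Longrightarrow> ?s < fls_subdegree (a - fls_const c * b)"
    by (intro fls_subdegree_greaterI) auto
  then show ?thesis using that[of c] nz by (auto simp: c_def)
qed

section \<open>Products over roots of unity\<close>

lemma card_power_roots:
  fixes c :: "'a::{alg_closed_field, field_char_0}"
  assumes "0 < n" "c \<noteq> 0"
  shows "card {x. x ^ n = c} = n"
proof -
  define f where "f = monom 1 n + [:- c:]"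
  have pf: "poly f x = x ^ n - c" for x by (simp add: f_def poly_monom)
  have df: "degree f = n" unfolding f_def by (subst degree_add_eq_left) (use assms in \<open>auto simp: degree_monom_eq\<close>)
  then have f0: "f \<noteq> 0" using assms by auto
  obtain A where A: "size A = degree f" "f = smult (lead_coeff f) (\<Prod>x\<in>#A. [:- x, 1:])"
    using alg_closed_imp_factorization[OF f0] by blast
  have "proots f = A"
  proof -
    have "proots f = proots (\<Prod>x\<in>#A. [:- x, 1:])"
      by (subst A(2), subst proots_smult) (use f0 in auto)
    also have "\<dots> = A"
    proof (induction A)
      case (add x A)
      have "(\<Prod>x\<in>#A. [:- x, 1:]) \<noteq> 0" by auto
      then have "proots ([:- x, 1:] * (\<Prod>x\<in>#A. [:- x, 1:])) = {#x#} + proots (\<Prod>x\<in>#A. [:- x, 1:])"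
        by (subst proots_mult) auto
      then show ?case using add.IH by simp
    qed simp
    finally show ?thesis .
  qed
  have "rsquarefree f"
    unfolding rsquarefree_roots
  proof (intro allI notI, elim conjE)
    fix a assume a: "poly f a = 0" "poly (pderiv f) a = 0"
    have "poly (pderiv f) a = of_nat n * a ^ (n - 1)"
      by (simp add: f_def pderiv_add pderiv_monom pderiv_pCons poly_monom)
    then have "a ^ n = c" "of_nat n * a ^ (n - 1) = 0" using a pf[of a] by auto
    moreover have "a \<noteq> 0" using \<open>a ^ n = c\<close> assms by auto
    ultimately show False using assms by simp
  qed
  then have "count (proots f) x = 1" if "x \<in># proots f" for x
    using that rsquarefree_root_order[of f x] f0 by auto
  then have "size (proots f) = card (set_mset (proots f))"
    unfolding size_multiset_overloaded_eq by simp
  also have "set_mset (proots f) = {x. x ^ n = c}" using f0 by (auto simp: pf)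
  finally show ?thesis using \<open>proots f = A\<close> A(1) df by simp
qed

lemma prod_linear_power_roots:
  fixes a :: "'b::field" and h :: "'a::{alg_closed_field, field_char_0} \<Rightarrow> 'b"
  assumes "0 < n" "a \<noteq> 0" and h: "inj h" "h 1 = 1" "\<And>x y. h (x * y) = h x * h y"
  shows "(\<Prod>\<eta> | \<eta> ^ n = 1. [:- (h \<eta> * a), 1:]) = monom 1 n + [:- (a ^ n):]"
proof -
  let ?Z = "{\<eta> :: 'a. \<eta> ^ n = 1}"
  have c: "card ?Z = n" by (rule card_power_roots) (use assms in auto)
  then have fin: "finite ?Z" using assms(1) by (intro card_ge_0_finite) simp
  have hp: "h (x ^ k) = h x ^ k" for x k by (induction k) (simp_all add: h)
  have inj: "inj_on (\<lambda>\<eta>. h \<eta> * a) ?Z" using h(1) assms(2) by (auto simp: inj_on_def)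
  have deg: "degree (\<Prod>\<eta>\<in>?Z. [:- (h \<eta> * a), 1:]) = n"
    by (subst degree_prod_eq_sum_degree) (auto simp: c)
  show ?thesis
  proof (rule poly_eqI_degree_lead_coeff[where n = n and A = "(\<lambda>\<eta>. h \<eta> * a) ` ?Z"])
    have "lead_coeff (\<Prod>\<eta>\<in>?Z. [:- (h \<eta> * a), 1:]) = 1" by (simp add: lead_coeff_prod)
    then show "coeff (\<Prod>\<eta>\<in>?Z. [:- (h \<eta> * a), 1:]) n = coeff (monom 1 n + [:- (a ^ n):]) n"
      using assms(1) by (simp add: deg coeff_pCons split: nat.splits)
    show "n \<le> card ((\<lambda>\<eta>. h \<eta> * a) ` ?Z)" by (simp add: card_image[OF inj] c)
    show "degree (monom 1 n + [:- (a ^ n):]) \<le> n" by (intro degree_add_le) (auto simp: degree_monom_le)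
    fix z assume "z \<in> (\<lambda>\<eta>. h \<eta> * a) ` ?Z"
    then obtain \<eta> where \<eta>: "\<eta> ^ n = 1" "z = h \<eta> * a" by blast
    have "poly (\<Prod>\<eta>\<in>?Z. [:- (h \<eta> * a), 1:]) z = 0"
      using fin \<eta> by (auto simp: poly_prod prod_zero_iff)
    moreover have "z ^ n = a ^ n" using \<eta> hp[of \<eta> n] h(2) by (simp add: power_mult_distrib)
    ultimately show "poly (\<Prod>\<eta>\<in>?Z. [:- (h \<eta> * a), 1:]) z = poly (monom 1 n + [:- (a ^ n):]) z"
      by (simp add: poly_monom)
  qed (simp add: deg)
qed

text \<open>\<zeta> \<mapsto> \<zeta>^d has fibres of size d over the n-th roots of unity, and
  \<eta> \<mapsto> \<eta>^m permutes these because m and n are coprime.\<close>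

lemma prod_linear_power_roots_power:
  fixes a :: "'b::field" and h :: "'a::{alg_closed_field, field_char_0} \<Rightarrow> 'b"
  assumes "0 < n" "0 < d" "coprime m n" "a \<noteq> 0" and "0 < m"
    and h: "inj h" "h 1 = 1" "\<And>x y. h (x * y) = h x * h y"
  shows "(\<Prod>\<zeta> | \<zeta> ^ (n * d) = 1. [:- (h (\<zeta> ^ (m * d)) * a), 1:]) = (monom 1 n + [:- (a ^ n):]) ^ d"
proof -
  let ?Z = "{\<zeta> :: 'a. \<zeta> ^ (n * d) = 1}" and ?E = "{\<eta> :: 'a. \<eta> ^ n = 1}"
  let ?g = "\<lambda>\<eta> :: 'a. [:- (h \<eta> * a), 1:]"
  have fin: "finite ?Z" "finite ?E"
    using card_power_roots[of "n * d" "1 :: 'a"] card_power_roots[of n "1 :: 'a"] assms(1,2)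
    by (auto intro!: card_ge_0_finite)
  have "(\<Prod>\<zeta>\<in>?Z. ?g (\<zeta> ^ (m * d))) = (\<Prod>\<eta>\<in>?E. \<Prod>\<zeta> | \<zeta> \<in> ?Z \<and> \<zeta> ^ d = \<eta>. ?g (\<zeta> ^ (m * d)))"
    by (rule prod.group[symmetric]) (use fin in \<open>auto simp: mult.commute simp flip: power_mult\<close>)
  also have "\<dots> = (\<Prod>\<eta>\<in>?E. ?g (\<eta> ^ m) ^ d)"
  proof (rule prod.cong[OF refl])
    fix \<eta> assume \<eta>: "\<eta> \<in> ?E"
    then have "\<eta> \<noteq> 0" using assms(1) by (auto simp: power_0_left)
    have eq: "{\<zeta> \<in> ?Z. \<zeta> ^ d = \<eta>} = {\<zeta>. \<zeta> ^ d = \<eta>}"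
      using \<eta> by (auto simp: mult.commute[of n] power_mult)
    have "(\<Prod>\<zeta> | \<zeta> \<in> ?Z \<and> \<zeta> ^ d = \<eta>. ?g (\<zeta> ^ (m * d))) = (\<Prod>\<zeta> | \<zeta> ^ d = \<eta>. ?g (\<eta> ^ m))"
      unfolding eq by (rule prod.cong[OF refl]) (auto simp: mult.commute[of m] power_mult)
    then show "(\<Prod>\<zeta> | \<zeta> \<in> ?Z \<and> \<zeta> ^ d = \<eta>. ?g (\<zeta> ^ (m * d))) = ?g (\<eta> ^ m) ^ d"
      using card_power_roots[OF assms(2) \<open>\<eta> \<noteq> 0\<close>] by (simp del: power_Suc)
  qed
  also have "\<dots> = (\<Prod>\<eta>\<in>?E. ?g (\<eta> ^ m)) ^ d" by (rule prod_power_distrib[symmetric])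
  also have "(\<Prod>\<eta>\<in>?E. ?g (\<eta> ^ m)) = (\<Prod>\<eta>\<in>?E. ?g \<eta>)"
  proof -
    have "inj_on (\<lambda>\<eta>. \<eta> ^ m) ?E"
    proof (rule inj_onI)
      fix x y :: 'a assume xy: "x \<in> ?E" "y \<in> ?E" "x ^ m = y ^ m"
      then have y0: "y \<noteq> 0" using assms(1) by (auto simp: power_0_left)
      have z: "(x / y) ^ n = 1" "(x / y) ^ m = 1" using xy y0 by (auto simp: power_divide)
      obtain i j where "m * i = n * j + 1"
        using bezout_nat[of m n] assms(3) \<open>0 < m\<close> by (auto simp: coprime_iff_gcd_eq_1)
      then have "(x / y) ^ (m * i) = (x / y) ^ (n * j) * (x / y)" by simp
      then have "x / y = 1" using z by (simp add: power_mult)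
      then show "x = y" using y0 by simp
    qed
    moreover have "(\<lambda>\<eta>. \<eta> ^ m) ` ?E \<subseteq> ?E" by (auto simp flip: power_mult) (simp add: mult.commute[of m] power_mult)
    ultimately have "bij_betw (\<lambda>\<eta>. \<eta> ^ m) ?E ?E" using fin(2) by (simp add: bij_betw_def endo_inj_surj)
    then show ?thesis by (rule prod.reindex_bij_betw)
  qed
  also have "\<dots> = monom 1 n + [:- (a ^ n):]" by (rule prod_linear_power_roots) (use assms in auto)
  finally show ?thesis .
qed

section \<open>Orders on the coordinate ring\<close>

text \<open>The elements of the ring generated by \<open>b\<close> and \<open>y = z\<^sup>-\<^sup>p\<close> are only known through their orders: none is
  negative, and some of them, those in \<open>W\<close>, have together with \<open>p\<close> greatest common divisor \<open>1\<close>.\<close>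

locale plane_place =
  fixes b :: "'a::{alg_closed_field, field_char_0} fls" and p q :: nat and W :: "nat set"
  assumes p_pos: "0 < p"
    and b_deg: "b \<noteq> 0" "fls_subdegree b = - int q"
    and no_pos_order: "\<And>g. curve_eval p b g \<noteq> 0 \<Longrightarrow>
      fls_subdegree (curve_eval p b g) \<le> 0"
    and orders: "\<And>x. x \<in> W \<Longrightarrow> \<exists>g. curve_eval p b g \<noteq> 0 \<and>
      fls_subdegree (curve_eval p b g) = - int x"
    and orders_gcd: "\<And>g. g dvd p \<Longrightarrow> (\<And>x. x \<in> W \<Longrightarrow> g dvd x) \<Longrightarrow> g = 1"
begin

definition coeval :: "'a poly \<Rightarrow> 'a fls" where "coeval = peval fls_const (fls_X_inv ^ p)"

definition ev :: "'a poly poly \<Rightarrow> 'a fls" where "ev = peval coeval b"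

abbreviation place :: "'a poly poly \<Rightarrow> int" where "place g \<equiv> fls_subdegree (ev g)"

lemma coeval_0 [simp]: "coeval 0 = 0"
  and coeval_add: "coeval (f + g) = coeval f + coeval g"
  and coeval_mult: "coeval (f * g) = coeval f * coeval g"
  by (auto simp: coeval_def simp flip: fls_plus_const intro!: peval_add peval_mult)

lemma coeval_const [simp]: "coeval [:c:] = fls_const c"
  by (simp add: coeval_def peval_pCons)

lemma coeval_X [simp]: "coeval [:0, 1:] = fls_X_inv ^ p"
  by (simp add: coeval_def peval_pCons)

lemma ev_0 [simp]: "ev 0 = 0"
  and ev_add: "ev (f + g) = ev f + ev g"
  and ev_mult: "ev (f * g) = ev f * ev g"
  by (auto simp: ev_def coeval_add coeval_mult intro!: peval_add peval_mult)

lemma ev_const: "ev [:a:] = coeval a"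
  by (simp add: ev_def peval_pCons)

lemma ev_Y: "ev var_Y = fls_X_inv ^ p"
  by (simp add: ev_const)

lemma ev_1: "ev 1 = 1"
  using coeval_const[of 1] by (simp add: ev_const one_pCons del: coeval_const)

lemma ev_power: "ev (g ^ n) = ev g ^ n"
  by (induction n) (simp_all add: ev_1 ev_mult)

lemma ev_uminus: "ev (- g) = - ev g"
  using ev_add[of g "- g"] by (simp add: eq_neg_iff_add_eq_0 add.commute)

lemma ev_minus: "ev (f - g) = ev f - ev g"
  using ev_add[of f "- g"] by (simp add: ev_uminus)

lemma ev_smult: "ev (smult a g) = coeval a * ev g"
  using ev_mult[of "[:a:]" g] by (simp add: ev_const)

lemma ev_sum: "ev (sum f S) = (\<Sum>s\<in>S. ev (f s))"
  by (induction S rule: infinite_finite_induct) (simp_all add: ev_add)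

lemma ev_subdegree: "ev g \<noteq> 0 \<Longrightarrow> place g \<le> 0"
  using no_pos_order[of g] by (simp add: ev_def coeval_def)

text \<open>Distinct powers of y have distinct orders; in particular y is transcendental over
  K.\<close>

lemma coeval_subdegree: "a \<noteq> 0 \<Longrightarrow> coeval a \<noteq> 0 \<and> fls_subdegree (coeval a) = - int (p * degree a)"
proof (induction a)
  case (pCons c a)
  have eq: "coeval (pCons c a) = fls_const c + fls_X_inv ^ p * coeval a"
    by (simp add: coeval_def peval_pCons)
  show ?case
  proof (cases "a = 0")
    case False
    then have IH: "coeval a \<noteq> 0" "fls_subdegree (coeval a) = - int (p * degree a)" using pCons.IH by auto
    then have s: "fls_subdegree (fls_X_inv ^ p * coeval a) = - int (p * degree (pCons c a))"
      using False by (simp add: algebra_simps)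
    have "0 < p * degree (pCons c a)" using False p_pos by simp
    then have neg: "fls_subdegree (fls_X_inv ^ p * coeval a) < 0" using s by linarith
    show ?thesis
    proof (cases "c = 0")
      case False
      then have "fls_subdegree (fls_X_inv ^ p * coeval a + fls_const c) = fls_subdegree (fls_X_inv ^ p * coeval a)"
        using neg IH by (intro fls_subdegree_add_eq1) auto
      then show ?thesis using s neg by (auto simp: eq add.commute)
    next
      case True
      have "coeval (pCons c a) = fls_X_inv ^ p * coeval a" unfolding eq unfolding True by simp
      then show ?thesis using s IH by simp
    qed
  qed (use pCons.hyps in \<open>auto simp: eq\<close>)
qed simp

definition order_set :: "nat set" where
  "order_set = {x. \<exists>g. ev g \<noteq> 0 \<and> place g = - int x}"

lemma order_set_residue_1: "\<exists>w\<in>order_set. w mod p = 1 mod p"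
proof (rule semigroup_residue_1)
  show "x + y \<in> order_set" if xy: "x \<in> order_set" "y \<in> order_set" for x y
  proof -
    obtain g h where "ev g \<noteq> 0" "place g = - int x" "ev h \<noteq> 0" "place h = - int y"
      using xy unfolding order_set_def by blast
    then show ?thesis unfolding order_set_def by (intro CollectI exI[of _ "g * h"]) (simp add: ev_mult)
  qed
  show "0 \<in> order_set" by (auto simp: order_set_def ev_1 intro!: exI[of _ 1])
  show p: "p \<in> order_set" by (auto simp: order_set_def ev_Y intro!: exI[of _ var_Y])
  fix g assume "\<And>x. x \<in> order_set \<Longrightarrow> g dvd x"
  moreover have "W \<subseteq> order_set" using orders by (auto simp: order_set_def ev_def coeval_def)
  ultimately show "g = 1" using p by (intro orders_gcd) auto
qed (rule p_pos)

lemma order_difference_1: "\<exists>g h. ev g \<noteq> 0 \<and> ev h \<noteq> 0 \<and> place g = place h + 1"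
proof -
  obtain w h where w: "w mod p = 1 mod p" "ev h \<noteq> 0" "place h = - int w"
    using order_set_residue_1 by (auto simp: order_set_def)
  show ?thesis
  proof (cases "p = 1")
    \<comment> \<open>For p = 1 all residues agree and w carries no information; 1 and y have orders
      0 and -1.\<close>
    case True
    have "place 1 = place var_Y + 1"
      unfolding ev_1 ev_Y using True by simp
    moreover have "ev 1 \<noteq> 0" "ev var_Y \<noteq> 0" by (simp_all add: ev_1 ev_Y)
    ultimately show ?thesis by blast
  next
    case False
    then have "w mod p = 1" using w(1) p_pos by (cases p) auto
    then have "int w = 1 + int (w div p * p)" by (metis mod_div_mult_eq of_nat_1 of_nat_add)
    then have "place (var_Y ^ (w div p)) = place h + 1"
      using w(3) by (simp add: ev_power ev_Y flip: power_mult)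
    moreover have "ev (var_Y ^ (w div p)) \<noteq> 0" by (simp add: ev_power ev_Y)
    ultimately show ?thesis using w(2) by blast
  qed
qed

lemma order_residues: "\<exists>x\<in>order_set. x mod p = r mod p"
proof -
  obtain w h where w: "w mod p = 1 mod p" "ev h \<noteq> 0" "place h = - int w"
    using order_set_residue_1 by (auto simp: order_set_def)
  have "r * w \<in> order_set"
    unfolding order_set_def by (intro CollectI exI[of _ "h ^ r"]) (simp add: ev_power w fls_subdegree_pow)
  moreover have "(r * w) mod p = r mod p" by (metis w(1) mod_mult_right_eq mult.right_neutral)
  ultimately show ?thesis by blast
qed

text \<open>One step of division by the basis: a term c y^j e_r cancels the leading term of
  g.\<close>

definition basis_reduction :: "(nat \<Rightarrow> 'a poly poly) \<Rightarrow> 'a poly poly \<Rightarrow> bool" where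
  "basis_reduction e g \<longleftrightarrow> (\<exists>r<p. \<exists>j c. c \<noteq> 0 \<and>
      place g = place (e r) - int (p * j) \<and>
      (ev (g - scalar_XY c * var_Y ^ j * e r) = 0 \<or>
       place g < place (g - scalar_XY c * var_Y ^ j * e r)))"

text \<open>\<open>e r\<close> has minimal order among the elements whose order is congruent to \<open>r\<close> modulo \<open>p\<close>; subtracting multiples of
  the \<open>e r\<close> lowers orders, so these elements form a basis over \<open>K[y]\<close>.\<close>

lemma residue_basis:
  obtains e where "\<And>r. ev (e r) \<noteq> 0"
    "\<And>g. ev g \<noteq> 0 \<Longrightarrow> basis_reduction e g"
proof -
  define m where "m = (\<lambda>r. LEAST x. x \<in> order_set \<and> x mod p = r mod p)"
  have m: "m r \<in> order_set" "m r mod p = r mod p" for r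
    using LeastI_ex[of "\<lambda>x. x \<in> order_set \<and> x mod p = r mod p"] order_residues[of r] by (auto simp: m_def)
  have m_le: "m r \<le> x" if "x \<in> order_set" "x mod p = r mod p" for r x
    unfolding m_def using that by (intro Least_le) auto
  have "\<exists>g. ev g \<noteq> 0 \<and> place g = - int (m r)" for r
    using m(1)[of r] by (auto simp: order_set_def)
  then obtain e where e: "\<And>r. ev (e r) \<noteq> 0" "\<And>r. place (e r) = - int (m r)" by metis
  show ?thesis
  proof (rule that[of e])
    fix g assume g: "ev g \<noteq> 0"
    define x where "x = nat (- place g)"
    have x: "place g = - int x" using ev_subdegree[OF g] by (simp add: x_def)
    then have "x \<in> order_set" using g by (auto simp: order_set_def)
    define r where "r = x mod p"
    have "m r \<le> x" "m r mod p = x mod p"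
      using m_le[OF \<open>x \<in> order_set\<close>, of r] m(2)[of r] by (auto simp: r_def)
    then have "p dvd x - m r" by (metis mod_eq_dvd_iff_nat)
    then obtain j where "x - m r = p * j" by blast
    then have j: "x = m r + p * j" using \<open>m r \<le> x\<close> by simp
    let ?h = "var_Y ^ j * e r"
    have evh: "ev ?h = fls_X_inv ^ (p * j) * ev (e r)" by (simp add: ev_mult ev_power ev_Y power_mult)
    have s: "place g = place (e r) - int (p * j)" by (simp add: x j e)
    have "ev ?h \<noteq> 0" "place ?h = place g"
      unfolding evh using e(1)[of r] s by auto
    then obtain c where c: "c \<noteq> 0" "ev g = fls_const c * ev ?h \<or>
        place g < fls_subdegree (ev g - fls_const c * ev ?h)"
      using fls_cancel_leading[OF g, of "ev ?h"] by metis
    have "ev (g - scalar_XY c * var_Y ^ j * e r) = ev g - fls_const c * ev ?h"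
      by (simp only: ev_minus ev_mult ev_const coeval_const mult.assoc)
    moreover have "r < p" using p_pos by (simp add: r_def)
    ultimately show "basis_reduction e g"
      unfolding basis_reduction_def using c s by (intro exI[of _ r] conjI exI[of _ j] exI[of _ c]) auto
  qed (rule e)
qed

text \<open>Orders in the ring are at most 0, so they can increase only finitely often before the
  value becomes 0.\<close>

lemma order_induct:
  assumes "\<And>g. ev g = 0 \<Longrightarrow> P g"
    and "\<And>g. ev g \<noteq> 0 \<Longrightarrow> (\<And>h. ev h = 0 \<or> place g < place h \<Longrightarrow> P h) \<Longrightarrow> P g"
  shows "P g"
proof (induction "if ev g = 0 then 0 else Suc (nat (- place g))" arbitrary: g rule: less_induct)
  case less
  show ?case
  proof (cases "ev g = 0")
    case False
    show ?thesis
    proof (rule assms(2)[OF False])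
      fix h assume "ev h = 0 \<or> place g < place h"
      then show "P h"
        using less[of h] False ev_subdegree[of h] ev_subdegree[OF False] assms(1)[of h]
        by (cases "ev h = 0") auto
    qed
  qed (rule assms(1))
qed

text \<open>Division by the basis gives every element a representative of bounded degree D in X, so
  that b is integral over K[y].\<close>

lemma monic_relation: "\<exists>g. ev g = 0 \<and> lead_coeff g = 1"
proof -
  obtain e where e: "\<And>g. ev g \<noteq> 0 \<Longrightarrow> basis_reduction e g"
    using residue_basis by metis
  define D where "D = Max ((\<lambda>r. degree (e r)) ` {..<p})"
  have D: "degree (e r) \<le> D" if "r < p" for r unfolding D_def using that by (intro Max_ge) auto
  have red: "\<exists>h. degree h \<le> D \<and> ev h = ev g" for g
  proof (induction g rule: order_induct)
    case (2 g)
    obtain r j c where r: "r < p" and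
      lt: "ev (g - scalar_XY c * var_Y ^ j * e r) = 0 \<or>
       place g < place (g - scalar_XY c * var_Y ^ j * e r)"
      using e[OF 2(1)] unfolding basis_reduction_def by blast
    obtain h where h: "degree h \<le> D" "ev h = ev (g - scalar_XY c * var_Y ^ j * e r)"
      using 2(2)[OF lt] by blast
    have Y: "scalar_XY c * var_Y ^ j = [:[:c:] * [:0, 1:] ^ j:]"
      by (induction j) (simp_all add: mult.commute mult.left_commute)
    have "degree (scalar_XY c * var_Y ^ j * e r) \<le> D"
    proof -
      have "scalar_XY c * var_Y ^ j * e r = smult ([:c:] * [:0, 1:] ^ j) (e r)" unfolding Y by simp
      then show ?thesis using degree_smult_le[of "[:c:] * [:0, 1:] ^ j" "e r"] D[OF r] by simp
    qed
    then have "degree (h + scalar_XY c * var_Y ^ j * e r) \<le> D" by (intro degree_add_le h)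
    moreover have "ev (h + scalar_XY c * var_Y ^ j * e r) = ev g" by (simp add: ev_add h(2) ev_minus)
    ultimately show ?case by blast
  qed (auto intro!: exI[of _ 0])
  obtain h where h: "degree h \<le> D" "ev h = ev (monom 1 (Suc D))" using red by blast
  have "degree (- h) < degree (monom (1 :: 'a poly) (Suc D))" using h by (simp add: degree_monom_eq)
  then have "lead_coeff (- h + monom 1 (Suc D)) = 1"
    by (subst lead_coeff_add_le) (auto simp: degree_monom_eq)
  then show ?thesis using h(2) by (intro exI[of _ "- h + monom 1 (Suc D)"]) (simp add: ev_minus)
qed

end

section \<open>The equation of the curve\<close>

text \<open>The substitution z \<mapsto> z/\<zeta>; with the inverse, a leading term c z^(-q)
  becomes \<zeta>^q c z^(-q).\<close>

definition twist :: "'a::field_char_0 \<Rightarrow> 'a fls \<Rightarrow> 'a fls" where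
  "twist \<zeta> g = fls_compose_fps g (fps_const (inverse \<zeta>) * fps_X)"

lemma twist_nth: "\<zeta> \<noteq> 0 \<Longrightarrow> twist \<zeta> g $$ k = g $$ k * inverse \<zeta> powi k"
  unfolding twist_def by (rule fls_nth_fls_compose_fps_linear) simp

lemma twist_add: "\<zeta> \<noteq> 0 \<Longrightarrow> twist \<zeta> (f + g) = twist \<zeta> f + twist \<zeta> g"
  and twist_mult: "\<zeta> \<noteq> 0 \<Longrightarrow> twist \<zeta> (f * g) = twist \<zeta> f * twist \<zeta> g"
  unfolding twist_def by (rule fls_compose_fps_add fls_compose_fps_mult; simp)+

lemma twist_const: "\<zeta> \<noteq> 0 \<Longrightarrow> twist \<zeta> (fls_const c) = fls_const c"
  by (rule fls_eqI) (simp add: twist_nth)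

lemma twist_X_inv_power:
  assumes "\<zeta> \<noteq> 0" "\<zeta> ^ p = 1"
  shows "twist \<zeta> (fls_X_inv ^ p) = fls_X_inv ^ p"
  by (rule fls_eqI) (simp add: twist_nth assms power_int_minus power_inverse)

text \<open>With roots of weight q the coefficient of X^i has weight q (card Z - i); changing the
  roots in lower orders changes each coefficient only below its weight.\<close>

lemma prod_linear_perturbation:
  fixes r s :: "'i \<Rightarrow> 'a::field_char_0 fls"
  assumes "finite Z" and "\<And>z. z \<in> Z \<Longrightarrow> degle (r z) (int q)" "\<And>z. z \<in> Z \<Longrightarrow> degle (s z) (int q)"
    "\<And>z. z \<in> Z \<Longrightarrow> degle (r z - s z) (int q - 1)"
  shows "degle (coeff (\<Prod>z\<in>Z. [:- r z, 1:]) i) (int q * (int (card Z) - int i)) \<and>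
    degle (coeff (\<Prod>z\<in>Z. [:- s z, 1:]) i) (int q * (int (card Z) - int i)) \<and>
    degle (coeff ((\<Prod>z\<in>Z. [:- r z, 1:]) - (\<Prod>z\<in>Z. [:- s z, 1:])) i) (int q * (int (card Z) - int i) - 1)"
  using assms
proof (induction Z arbitrary: i)
  case empty
  then show ?case by (cases i) (auto simp: degle_0 degle_const[of 1, simplified] coeff_1 one_pCons coeff_pCons split: nat.splits)
next
  case (insert z Z)
  let ?n = "\<lambda>i. int q * (int (card Z) - int i)" and ?N = "int q * (int (card (insert z Z)) - int i)"
  let ?A = "\<Prod>z\<in>Z. [:- r z, 1:]" and ?B = "\<Prod>z\<in>Z. [:- s z, 1:]"
  have c: "coeff ([:- x, 1:] * H) i = - x * coeff H i + (if i = 0 then 0 else coeff H (i - 1))" for x :: "'a fls" and H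
    by (cases i) (auto simp: coeff_pCons)
  have k: "?N = int q + ?n i"
    using insert.hyps by (simp add: algebra_simps)
  have k1: "int q * (int (card Z) - int (i - 1)) = ?N" if "i \<noteq> 0"
    using insert.hyps that by (cases i) (auto simp: algebra_simps)
  have rz: "degle (- r z) (int q)" "degle (- s z) (int q)" using insert.prems by (auto intro: degle_uminus)
  have step: "degle (coeff ([:- x, 1:] * H) i) (?N - e)"
    if "degle (- x) (int q)" "\<And>i. degle (coeff H i) (?n i - e)"
    for x :: "'a fls" and H e
    unfolding c
  proof (rule degle_add)
    show "degle (- x * coeff H i) (?N - e)"
      using degle_mult[OF that(1) that(2)[of i]] unfolding k by (simp add: algebra_simps)
    show "degle (if i = 0 then 0 else coeff H (i - 1)) (?N - e)"
    proof (cases "i = 0")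
      case False
      then show ?thesis using that(2)[of "i - 1"] unfolding k1[OF False] by simp
    qed (simp add: degle_0)
  qed
  have IH: "degle (coeff ?A i) (?n i)"
    "degle (coeff ?B i) (?n i)"
    "degle (coeff (?A - ?B) i) (?n i - 1)" for i
    using insert.IH[of i] insert.prems by auto
  have A: "degle (coeff ([:- r z, 1:] * ?A) i) (?N - 0)"
    by (rule step) (use rz IH in auto)
  have B: "degle (coeff ([:- s z, 1:] * ?B) i) (?N - 0)"
    by (rule step) (use rz IH in auto)
  have D: "degle (coeff ([:- r z, 1:] * (?A - ?B)) i) (?N - 1)"
    by (rule step) (use rz IH in auto)
  have "degle (r z - s z) (int q - 1)" using insert.prems by auto
  then have "degle ((r z - s z) * coeff ?B i) ((int q - 1) + ?n i)"
    by (intro degle_mult IH)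
  then have D': "degle ((r z - s z) * coeff ?B i) (?N - 1)"
    unfolding k by (simp add: algebra_simps)
  have "[:- r z, 1:] * ?A - [:- s z, 1:] * ?B = [:- r z, 1:] * (?A - ?B) - smult (r z - s z) ?B"
    by (simp add: algebra_simps smult_diff_left smult_diff_right)
  then have "coeff ([:- r z, 1:] * ?A - [:- s z, 1:] * ?B) i =
      coeff ([:- r z, 1:] * (?A - ?B)) i - (r z - s z) * coeff ?B i" by simp
  then have E: "degle (coeff ([:- r z, 1:] * ?A - [:- s z, 1:] * ?B) i) (?N - 1)"
    using degle_minus[OF D D'] by (simp only:)
  show ?case using A B E insert.hyps by (simp only: prod.insert diff_zero simp_thms)
qed

context plane_place
begin

lemma twist_coeval:
  assumes "\<zeta> \<noteq> 0" "\<zeta> ^ p = 1"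
  shows "twist \<zeta> (coeval a) = coeval a"
proof (induction a)
  case 0
  show ?case using twist_const[OF assms(1), of 0] by simp
next
  case (pCons c a)
  have "coeval (pCons c a) = fls_const c + fls_X_inv ^ p * coeval a"
    by (simp add: coeval_def peval_pCons)
  then show ?case using pCons.IH assms by (simp add: twist_add twist_mult twist_const twist_X_inv_power)
qed

lemma twist_ev:
  assumes "\<zeta> \<noteq> 0" "\<zeta> ^ p = 1"
  shows "twist \<zeta> (ev g) = peval coeval (twist \<zeta> b) g"
proof (induction g)
  case 0
  show ?case using twist_const[OF assms(1), of 0] by simp
next
  case (pCons a g)
  then show ?case using assms by (simp add: ev_def peval_pCons twist_add twist_mult twist_coeval)
qed

lemma root_nonzero: "\<zeta> ^ p = 1 \<Longrightarrow> \<zeta> \<noteq> (0 :: 'a)"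
  using p_pos by (auto simp: power_0_left)

text \<open>A substitution fixing b fixes the whole ring, in particular an element of order -w with
  w congruent to 1 modulo p, whose leading coefficient it multiplies by \<eta>^w = \<eta>.\<close>

lemma twist_inj: "inj_on (\<lambda>\<zeta>. twist \<zeta> b) {\<zeta>. \<zeta> ^ p = 1}"
proof (rule inj_onI, elim CollectE)
  fix \<zeta> \<xi> :: 'a assume z: "\<zeta> ^ p = 1" "\<xi> ^ p = 1" and eq: "twist \<zeta> b = twist \<xi> b"
  note nz = root_nonzero[OF z(1)] root_nonzero[OF z(2)]
  define \<eta> where "\<eta> = \<zeta> / \<xi>"
  have \<eta>: "\<eta> \<noteq> 0" "\<eta> ^ p = 1" using nz z by (auto simp: \<eta>_def power_divide)
  have "twist \<eta> b = b"
  proof (rule fls_eqI)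
    fix k
    have "b $$ k * inverse \<zeta> powi k = b $$ k * inverse \<xi> powi k" by (metis eq nz twist_nth)
    then show "twist \<eta> b $$ k = b $$ k"
      using nz \<eta> by (auto simp: twist_nth \<eta>_def power_int_divide_distrib power_int_inverse field_simps)
  qed
  then have tw: "twist \<eta> (ev g) = ev g" for g using twist_ev[OF \<eta>, of g] by (simp add: ev_def)
  obtain w g where w: "w mod p = 1 mod p" "ev g \<noteq> 0" "place g = - int w"
    using order_set_residue_1 by (auto simp: order_set_def)
  have "ev g $$ (- int w) * inverse \<eta> powi (- int w) = ev g $$ (- int w)"
    using arg_cong[OF tw[of g], of "\<lambda>f. f $$ (- int w)"] \<eta> by (simp add: twist_nth)
  moreover have "ev g $$ (- int w) \<noteq> 0" using w(2,3) by (metis nth_fls_subdegree_nonzero)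
  ultimately have "inverse \<eta> ^ w = 1" by (simp add: power_int_minus power_int_inverse)
  then have "\<eta> ^ w = 1" by (simp add: power_inverse)
  moreover have "\<eta> ^ k = \<eta> ^ (k mod p)" for k
    using \<eta>(2) by (metis div_mult_mod_eq mult.commute mult_1 power_add power_mult power_one)
  ultimately have "\<eta> = 1" using w(1) by (metis power_one_right)
  then show "\<zeta> = \<xi>" using nz by (simp add: \<eta>_def)
qed

lemma card_conjugates: "card ((\<lambda>\<zeta>. twist \<zeta> b) ` {\<zeta>. \<zeta> ^ p = 1}) = p"
  by (simp add: card_image[OF twist_inj] card_power_roots p_pos)

lemma coeval_eq_0_iff [simp]: "coeval a = 0 \<longleftrightarrow> a = 0"
  using coeval_subdegree by auto

lemma conjugate_root: "ev g = 0 \<Longrightarrow> \<zeta> ^ p = 1 \<Longrightarrow> poly (map_poly coeval g) (twist \<zeta> b) = 0"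
  using twist_ev[OF root_nonzero, of \<zeta> g] twist_const[OF root_nonzero, of \<zeta> 0] by (simp add: peval_def)

text \<open>The p distinct conjugates of b are all roots.\<close>

lemma degree_relation:
  assumes "ev g = 0" "g \<noteq> 0"
  shows "p \<le> degree g"
proof -
  let ?G = "map_poly coeval g"
  have deg: "degree ?G = degree g" by (rule degree_map_poly) simp
  have nz: "?G \<noteq> 0"
  proof
    assume "?G = 0"
    then have "coeval (lead_coeff g) = 0" using coeff_map_poly[of coeval g "degree g"] by simp
    then show False using assms(2) by simp
  qed
  have "card ((\<lambda>\<zeta>. twist \<zeta> b) ` {\<zeta>. \<zeta> ^ p = 1}) \<le> card {x. poly ?G x = 0}"
    by (rule card_mono) (use nz poly_roots_finite conjugate_root[OF assms(1)] in auto)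
  then have "p \<le> card {x. poly ?G x = 0}" by (simp only: card_conjugates)
  then show ?thesis using card_poly_roots_bound[OF nz] deg by simp
qed

lemma ev_monom: "ev (monom a i) = coeval a * b ^ i"
proof (induction i)
  case (Suc i)
  then show ?case by (simp add: monom_Suc ev_def peval_pCons)
qed (simp add: monom_0 ev_const)

lemma coeval_monom: "coeval (monom c j) = fls_const c * fls_X_inv ^ (p * j)"
proof (induction j)
  case (Suc j)
  have "coeval (monom c (Suc j)) = fls_X_inv ^ p * coeval (monom c j)"
    by (simp add: monom_Suc coeval_def peval_pCons)
  then show ?case by (simp add: Suc.IH power_add mult_ac)
qed (simp add: monom_0)

text \<open>A dimension count: as no element has positive order, a combination vanishes once its
  coefficients at the exponents -N + 1, ..., 0 do.\<close>

lemma relation_of_degree_p: "\<exists>h. ev h = 0 \<and> h \<noteq> 0 \<and> degree h = p"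
proof -
  \<comment> \<open>With J = pq there are (p + 1)(J + 1) unknowns for pq + pJ + 1 equations, a
    surplus of p.\<close>
  define J where "J = p * q"
  define S where "S = {..p} \<times> {..J}"
  define N where "N = p * q + p * J + 1"
  define u where "u = (\<lambda>s k. (b ^ fst s * fls_X_inv ^ (p * snd s)) $$ (- int k))"
  have "finite S" "N < card S" using p_pos by (auto simp: S_def N_def J_def card_cartesian_product algebra_simps)
  then obtain x where x: "\<exists>s\<in>S. x s \<noteq> 0" "\<And>k. k < N \<Longrightarrow> (\<Sum>s\<in>S. x s * u s k) = 0"
    using underdetermined_system[of S N u] by blast
  define h where "h = (\<Sum>s\<in>S. monom (monom (x s) (snd s)) (fst s))"
  have evh: "ev h = (\<Sum>s\<in>S. fls_const (x s) * (b ^ fst s * fls_X_inv ^ (p * snd s)))"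
    by (simp add: h_def ev_sum ev_monom coeval_monom mult_ac)
  have "degle b (int q)" using b_deg by (simp add: degle_subdegree)
  then have d: "degle (b ^ i * fls_X_inv ^ (p * j)) (int i * int q + int (p * j))" for i j
    by (intro degle_mult fls.le_power degle_X_inv_power)
  have ds: "degle (b ^ fst s * fls_X_inv ^ (p * snd s)) (int (p * q + p * J))" if "s \<in> S" for s
    by (rule degle_mono[OF d]) (use that in \<open>auto simp: S_def simp flip: of_nat_mult intro!: add_mono mult_mono\<close>)
  have "ev h = 0"
  proof (rule ccontr)
    assume nz: "ev h \<noteq> 0"
    have "ev h $$ i = 0" if "i \<le> 0" for i
    proof (cases "i < - int (p * q + p * J)")
      case True
      then have "(b ^ fst s * fls_X_inv ^ (p * snd s)) $$ i = 0" if "s \<in> S" for s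
        using ds[OF that] by (simp only: degle_def)
      then show ?thesis by (simp add: evh fls_nth_sum)
    next
      case False
      then have "- i \<le> int (p * q + p * J)" by linarith
      then have "nat (- i) < N" unfolding N_def by linarith
      then have "(\<Sum>s\<in>S. x s * u s (nat (- i))) = 0" by (rule x(2))
      then show ?thesis using that by (simp add: evh fls_nth_sum u_def)
    qed
    then have "0 < place h" using nz by (intro fls_subdegree_greaterI) auto
    then show False using ev_subdegree[OF nz] by simp
  qed
  moreover have "degree h \<le> p"
    unfolding h_def by (rule degree_sum_le) (auto simp: S_def intro: order_trans[OF degree_monom_le])
  moreover have "h \<noteq> 0"
  proof
    assume h0: "h = 0"
    obtain i j where ij: "(i, j) \<in> S" "x (i, j) \<noteq> 0" using x(1) by auto
    have "coeff (coeff h i) j = (\<Sum>s\<in>S. if s = (i, j) then x s else 0)"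
      unfolding h_def coeff_sum by (intro sum.cong refl) (auto simp: split: prod.splits)
    also have "\<dots> = x (i, j)" using ij \<open>finite S\<close> by simp
    finally show False using ij(2) h0 by simp
  qed
  ultimately show ?thesis using degree_relation[of h] by (intro exI[of _ h]) auto
qed

text \<open>Gauss' lemma is avoided: among the relations of degree \<open>p\<close> one whose leading coefficient has minimal
  degree is compared with a monic relation.\<close>

lemma minimal_relation:
  assumes "\<beta> \<noteq> 0"
  obtains f where "ev f = 0" "degree f = p" "lead_coeff f = [:\<beta>:]"
proof -
  let ?P = "\<lambda>h. ev h = 0 \<and> h \<noteq> 0 \<and> degree h = p"
  obtain h where h: "?P h" and hmin: "\<And>g. ?P g \<Longrightarrow> degree (lead_coeff h) \<le> degree (lead_coeff g)"
    using ex_has_least_nat[of ?P _ "\<lambda>h. degree (lead_coeff h)"] relation_of_degree_p by blast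
  obtain g where g: "ev g = 0" "lead_coeff g = 1" using monic_relation by blast
  let ?R = "\<lambda>CQ. fst CQ \<noteq> 0 \<and> smult (fst CQ) g = h * snd CQ"
  obtain Q r where Qr: "pseudo_divmod g h = (Q, r)" by fastforce
  define C0 where "C0 = coeff h (degree h) ^ (Suc (degree g) - degree h)"
  have pd: "smult C0 g = h * Q + r" "r = 0 \<or> degree r < degree h"
    using pseudo_divmod[OF _ Qr] h by (auto simp: C0_def)
  have "ev r = 0" using arg_cong[OF pd(1), of ev] g(1) h by (simp add: ev_smult ev_add ev_mult)
  have "r = 0"
  proof (rule ccontr)
    assume "r \<noteq> 0"
    then have "p \<le> degree r" using degree_relation \<open>ev r = 0\<close> by blast
    then show False using pd(2) h \<open>r \<noteq> 0\<close> by linarith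
  qed
  moreover have "C0 \<noteq> 0"
    unfolding C0_def by (intro power_not_zero leading_coeff_neq_0) (use h in blast)
  ultimately have "?R (C0, Q)" using pd(1) by simp
  then obtain CQ where CQ: "?R CQ" and CQmin: "\<And>X. ?R X \<Longrightarrow> degree (fst CQ) \<le> degree (fst X)"
    using ex_has_least_nat[of ?R _ "\<lambda>X. degree (fst X)"] by blast
  obtain C Q where CQ_eq: "CQ = (C, Q)" by fastforce
  have C: "C \<noteq> 0" "smult C g = h * Q" using CQ by (auto simp: CQ_eq)
  \<comment> \<open>A root y0 of C would make the prime y - y0 divide h or Q. Cancelling it from h
    contradicts the choice of h, cancelling it from Q the choice of C.\<close>
  have "degree C = 0"
  proof (rule ccontr)
    assume "degree C \<noteq> 0"
    then obtain y0 where "poly C y0 = 0" using alg_closed_imp_poly_has_root[of C] by auto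
    then have "[:- y0, 1:] dvd C" by (simp add: poly_eq_0_iff_dvd)
    then obtain C' where C': "C = [:- y0, 1:] * C'" by blast
    have prime: "prime_elem [:[:- y0, 1:]:]"
    proof (rule lift_prime_elem_poly, rule prime_elemI)
      show "\<not> [:- y0, 1:] dvd 1" by (simp add: is_unit_poly_iff)
      fix u v assume "[:- y0, 1:] dvd u * v"
      then have "poly u y0 * poly v y0 = 0" by (simp add: poly_eq_0_iff_dvd[symmetric])
      then show "[:- y0, 1:] dvd u \<or> [:- y0, 1:] dvd v" by (simp add: poly_eq_0_iff_dvd[symmetric])
    qed simp
    have "[:[:- y0, 1:]:] * smult C' g = h * Q" using C(2) unfolding C' by simp
    then have "[:[:- y0, 1:]:] dvd h * Q" by (metis dvd_triv_left)
    then consider "[:[:- y0, 1:]:] dvd h" | "[:[:- y0, 1:]:] dvd Q"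
      using prime_elem_dvd_multD[OF prime] by blast
    then show False
    proof cases
      case 1
      then obtain h' where "h = [:[:- y0, 1:]:] * h'" by blast
      then have h': "h = smult [:- y0, 1:] h'" by simp
      then have nz: "h' \<noteq> 0" using h by auto
      have "ev h' = 0" using h unfolding h' by (simp add: ev_smult del: mult_eq_0_iff) (simp add: mult_eq_0_iff)
      then have "?P h'" using h h' nz by simp
      moreover have "lead_coeff h = [:- y0, 1:] * lead_coeff h'" using h' by simp
      then have "degree (lead_coeff h) = Suc (degree (lead_coeff h'))"
        using nz by (simp add: degree_mult_eq del: mult_pCons_left)
      ultimately show False using hmin[of h'] by simp
    next
      case 2
      then obtain Q' where "Q = [:[:- y0, 1:]:] * Q'" by blast
      then have "[:[:- y0, 1:]:] * smult C' g = [:[:- y0, 1:]:] * (h * Q')"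
        using C(2) unfolding C' by (simp add: mult.left_commute)
      then have "smult C' g = h * Q'" by (subst (asm) mult_cancel_left) simp
      moreover have "C' \<noteq> 0" using C(1) C' by auto
      ultimately have "degree C \<le> degree C'" using CQmin[of "(C', Q')"] by (simp add: CQ_eq)
      then show False using \<open>C' \<noteq> 0\<close> unfolding C' by (simp add: degree_mult_eq del: mult_pCons_left)
    qed
  qed
  moreover have "C = lead_coeff h * lead_coeff Q"
    using arg_cong[OF C(2), of lead_coeff] g(2) C(1) by (simp add: lead_coeff_mult)
  ultimately have "degree (lead_coeff h) = 0" using C(1) by (auto simp: degree_mult_eq)
  then obtain c where c: "lead_coeff h = [:c:]" by (meson degree_eq_zeroE)
  then have "c \<noteq> 0" using h by auto
  then have "ev (smult [:\<beta> / c:] h) = 0" "degree (smult [:\<beta> / c:] h) = p" "lead_coeff (smult [:\<beta> / c:] h) = [:\<beta>:]"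
    using h c assms by (simp_all add: ev_smult)
  then show ?thesis using that by blast
qed

end

section \<open>Irreducibility and the place at infinity\<close>

locale plane_place_relation = plane_place +
  fixes f :: "'a poly poly" and \<beta> :: 'a
  assumes f: "ev f = 0" "degree f = p" "lead_coeff f = [:\<beta>:]" and \<beta>: "\<beta> \<noteq> 0"
begin

text \<open>The leading coefficient is a nonzero scalar, so division by f is possible; a nonzero
  remainder would be a relation of degree below p.\<close>

lemma f_dvd_iff: "f dvd g \<longleftrightarrow> ev g = 0"
proof
  assume g: "ev g = 0"
  have f0: "f \<noteq> 0" using f \<beta> by auto
  obtain Q r where Qr: "pseudo_divmod g f = (Q, r)" by fastforce
  define k where "k = Suc (degree g) - degree f"
  have pd: "smult ([:\<beta>:] ^ k) g = f * Q + r" "r = 0 \<or> degree r < degree f"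
    using pseudo_divmod[OF f0 Qr] f(3) by (auto simp: k_def)
  have "ev r = 0" using arg_cong[OF pd(1), of ev] g f by (simp add: ev_smult ev_add ev_mult)
  have "r = 0"
  proof (rule ccontr)
    assume "r \<noteq> 0"
    then have "p \<le> degree r" using degree_relation \<open>ev r = 0\<close> by blast
    then show False using pd(2) f(2) \<open>r \<noteq> 0\<close> by linarith
  qed
  moreover have "[:\<beta>:] ^ k = [:\<beta> ^ k:]" by (induction k) (simp_all add: one_pCons mult.commute)
  ultimately have "smult [:\<beta> ^ k:] g = f * Q" using pd(1) by simp
  then have "smult [:1 / \<beta> ^ k:] (smult [:\<beta> ^ k:] g) = f * smult [:1 / \<beta> ^ k:] Q" by simp
  then have "g = f * smult [:1 / \<beta> ^ k:] Q" using \<beta> by (simp flip: one_pCons)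
  then show "f dvd g" by (metis dvd_triv_left)
next
  assume "f dvd g"
  then show "ev g = 0" using f(1) by (metis dvdE ev_mult mult_zero_left)
qed

text \<open>The factor that vanishes on the curve already has degree p, so the other one is free of
  X and divides the scalar \<beta>.\<close>

lemma irreducible_f: "irreducible f"
proof (rule irreducibleI)
  show "f \<noteq> 0" using f \<beta> by auto
  show "\<not> f dvd 1" by (simp add: f_dvd_iff ev_1)
  have half: "v dvd 1" if uv: "f = u * v" and "ev u = 0" for u v
  proof -
    have nz: "u \<noteq> 0" "v \<noteq> 0" using uv f \<beta> by auto
    then have "p \<le> degree u" "degree f = degree u + degree v"
      using degree_relation[OF that(2)] by (auto simp: uv degree_mult_eq)
    then have "degree v = 0" using f(2) by simp
    then obtain v0 where v0: "v = [:v0:]" by (meson degree_eq_zeroE)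
    have "[:\<beta>:] = lead_coeff u * lead_coeff v" using f(3) lead_coeff_mult[of u v] unfolding uv by metis
    moreover have "lead_coeff v = v0" by (simp add: v0)
    ultimately have "[:\<beta>:] = lead_coeff u * v0" by simp
    then have "v0 dvd [:\<beta>:]" by (metis dvd_triv_right)
    moreover have "[:\<beta>:] dvd 1" using \<beta> by (simp add: is_unit_const_poly_iff dvd_field_iff)
    ultimately have "v0 dvd 1" using dvd_trans by blast
    then show ?thesis by (simp add: v0 is_unit_const_poly_iff)
  qed
  fix u v assume uv: "f = u * v"
  then have "ev u = 0 \<or> ev v = 0" using f(1) by (simp add: ev_mult)
  then show "u dvd 1 \<or> v dvd 1" using half[of u v] half[of v u] uv by (auto simp: mult.commute)
qed

lemma map_f: "map_poly coeval f = smult (fls_const \<beta>) (\<Prod>\<zeta> | \<zeta> ^ p = 1. [:- twist \<zeta> b, 1:])"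
proof -
  let ?Z = "{\<zeta> :: 'a. \<zeta> ^ p = 1}" and ?R = "\<Prod>\<zeta> | \<zeta> ^ p = 1. [:- twist \<zeta> b, 1:]"
  have card: "card ?Z = p" by (simp add: card_power_roots p_pos)
  then have fin: "finite ?Z" using p_pos by (intro card_ge_0_finite) simp
  have R: "degree ?R = p" by (subst degree_prod_eq_sum_degree) (auto simp: card)
  have "lead_coeff ?R = 1" by (simp add: lead_coeff_prod)
  show ?thesis
  proof (rule poly_eqI_degree_lead_coeff[where n = p and A = "(\<lambda>\<zeta>. twist \<zeta> b) ` ?Z"])
    show "coeff (map_poly coeval f) p = coeff (smult (fls_const \<beta>) ?R) p"
      using \<open>lead_coeff ?R = 1\<close> f(2,3) by (simp add: coeff_map_poly R)
    show "degree (map_poly coeval f) \<le> p" by (simp add: degree_map_poly f(2))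
    show "degree (smult (fls_const \<beta>) ?R) \<le> p" using R degree_smult_le[of "fls_const \<beta>" ?R] by simp
    fix z assume "z \<in> (\<lambda>\<zeta>. twist \<zeta> b) ` ?Z"
    then obtain \<zeta> where \<zeta>: "\<zeta> ^ p = 1" "z = twist \<zeta> b" by blast
    have "poly ?R z = 0" using fin \<zeta> by (auto simp: poly_prod prod_zero_iff)
    then show "poly (map_poly coeval f) z = poly (smult (fls_const \<beta>) ?R) z"
      using conjugate_root[OF f(1) \<zeta>(1)] by (simp add: \<zeta>(2))
  qed (simp add: card_conjugates)
qed

lemma valuation_place: "valuation_at_infinity f place"
  unfolding valuation_at_infinity_def f_dvd_iff
proof (intro conjI allI impI)
  show "place g = place h" if "ev (g - h) = 0" for g h using that by (simp add: ev_minus)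
  show "place (g * h) = place g + place h" if "ev g \<noteq> 0" "ev h \<noteq> 0" for g h
    using that by (simp add: ev_mult)
  show "min (place g) (place h) \<le> place (g + h)" if "ev (g + h) \<noteq> 0" for g h
    using that by (simp add: ev_add fls_plus_subdegree)
  show "place (scalar_XY c) = 0" for c by (simp add: ev_const)
  show "\<exists>g h. ev g \<noteq> 0 \<and> ev h \<noteq> 0 \<and> place g = place h + 1"
    using order_difference_1 by (simp add:)
  show "\<exists>g. ev g \<noteq> 0 \<and> place g < 0"
    using p_pos by (intro exI[of _ var_Y]) (simp add: ev_Y)
qed

lemma place_residue:
  assumes "\<not> f dvd g" "\<not> f dvd h" "place g = place h"
  shows "\<exists>c. f dvd (g - scalar_XY c * h) \<or> place h < place (g - scalar_XY c * h)"
proof -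
  obtain c where "ev g = fls_const c * ev h \<or> place g < fls_subdegree (ev g - fls_const c * ev h)"
    using fls_cancel_leading[of "ev g" "ev h"] assms by (metis f_dvd_iff)
  then show ?thesis using assms(3)
    by (intro exI[of _ c]) (auto simp: f_dvd_iff ev_minus ev_smult)
qed

text \<open>By the basis \<open>e\<close>, any valuation \<open>w\<close> at infinity satisfies \<open>p * w g \<ge> w y * ord g\<close> up to a bounded error,
  which is removed by passing to powers of \<open>g\<close>; equality follows as \<open>g\<^sup>p\<close> and a power of \<open>y\<close> have equal order.\<close>

lemma valuation_unique:
  assumes w: "valuation_at_infinity f w" and g: "\<not> f dvd g"
  shows "w g = place g"
proof -
  have eq: "w g = w h" if "ev g \<noteq> 0" "ev g = ev h" for g h
  proof -
    have "\<forall>g h. ev g \<noteq> 0 \<longrightarrow> ev (g - h) = 0 \<longrightarrow> w g = w h"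
      using w unfolding valuation_at_infinity_def f_dvd_iff by blast
    moreover have "ev (g - h) = 0" by (simp add: ev_minus that(2))
    ultimately show ?thesis using that(1) by blast
  qed
  have mult: "w (g * h) = w g + w h" if "ev g \<noteq> 0" "ev h \<noteq> 0" for g h
    using w that unfolding valuation_at_infinity_def f_dvd_iff by blast
  have add: "min (w g) (w h) \<le> w (g + h)" if "ev g \<noteq> 0" "ev h \<noteq> 0" "ev (g + h) \<noteq> 0" for g h
    using w that unfolding valuation_at_infinity_def f_dvd_iff by blast
  have const: "w (scalar_XY c) = 0" if "c \<noteq> 0" for c
    using w that unfolding valuation_at_infinity_def by blast
  have one: "w 1 = 0" using const[of 1] by (simp flip: one_pCons)
  have pow: "w (g ^ k) = int k * w g" if "ev g \<noteq> 0" for g k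
  proof (induction k)
    case (Suc k)
    then show ?case using mult[OF that, of "g ^ k"] that by (simp add: ev_power algebra_simps)
  qed (simp add: one)
  have Y: "ev (var_Y ^ j) \<noteq> 0" for j by (simp add: ev_power ev_Y)
  obtain e where e0: "\<And>r. ev (e r) \<noteq> 0" and e: "\<And>g. ev g \<noteq> 0 \<Longrightarrow> basis_reduction e g"
    using residue_basis by metis
  let ?y = "w var_Y"
  have term_val: "w (scalar_XY c * var_Y ^ j * e r) = int j * ?y + w (e r)"
    "ev (scalar_XY c * var_Y ^ j * e r) \<noteq> 0" if "c \<noteq> 0" for c j r
  proof -
    have n1: "ev (scalar_XY c) \<noteq> 0" using that by (simp add: ev_const)
    then have n2: "ev (scalar_XY c * var_Y ^ j) \<noteq> 0" unfolding ev_mult using Y by simp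
    then show "ev (scalar_XY c * var_Y ^ j * e r) \<noteq> 0" unfolding ev_mult[of _ "e r"] using e0 by simp
    have "ev var_Y \<noteq> 0" using Y[of 1] by simp
    then show "w (scalar_XY c * var_Y ^ j * e r) = int j * ?y + w (e r)"
      using mult[OF n2 e0] mult[OF n1 Y[of j]] const[OF that] pow[of var_Y j] by simp
  qed
  define lo where "lo = Min ((\<lambda>r. int p * w (e r) + ?y * place (e r)) ` {..<p})"
  have lo: "lo \<le> int p * w (e r) + ?y * place (e r)" if "r < p" for r
    unfolding lo_def using that by (intro Min_le) auto
  \<comment> \<open>In the expansion of g by the basis some term bounds \<open>w g\<close> from
    below, while every term has order at least that of g.\<close>
  have pick: "\<exists>r<p. \<exists>j. w g \<ge> int j * ?y + w (e r) \<and> place g \<le> place (e r) - int (p * j)"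
    if "ev g \<noteq> 0" for g
    using that
  proof (induction g rule: order_induct)
    case (2 g)
    obtain r j c where r: "r < p" "c \<noteq> 0" and s: "place g = place (e r) - int (p * j)" and
      lt: "ev (g - scalar_XY c * var_Y ^ j * e r) = 0 \<or>
       place g < place (g - scalar_XY c * var_Y ^ j * e r)"
      using e[OF 2(1)] unfolding basis_reduction_def by blast
    let ?t = "scalar_XY c * var_Y ^ j * e r"
    show ?case
    proof (cases "ev (g - ?t) = 0")
      case True
      then have "w g = w ?t" using 2(1) by (intro eq) (auto simp: ev_minus)
      then show ?thesis using term_val(1)[OF r(2), of j r] s r by (intro exI[of _ r]) auto
    next
      case False
      then obtain r' j' where r': "r' < p" "w (g - ?t) \<ge> int j' * ?y + w (e r')"
        "place (g - ?t) \<le> place (e r') - int (p * j')"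
        using 2(2)[OF lt] by blast
      have "min (w (g - ?t)) (w ?t) \<le> w (g - ?t + ?t)"
        using False term_val(2)[OF r(2)] 2(1) by (intro add) auto
      then consider "w (g - ?t) \<le> w g" | "w ?t \<le> w g" by (auto simp: min_def split: if_splits)
      then show ?thesis
      proof cases
        case 1
        then show ?thesis using r' lt False by (intro exI[of _ r'] conjI exI[of _ j']) auto
      next
        case 2
        then show ?thesis using r s term_val(1)[OF r(2), of j r] by (intro exI[of _ r] conjI exI[of _ j]) auto
      qed
    qed
  qed simp
  \<comment> \<open>Otherwise w would be bounded below on the ring, against the powers of an element
    of negative value.\<close>
  have y_neg: "?y < 0"
  proof (rule ccontr)
    assume "\<not> ?y < 0"
    obtain g where g: "ev g \<noteq> 0" "w g < 0"
      using w unfolding valuation_at_infinity_def f_dvd_iff by blast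
    define l where "l = Min ((\<lambda>r. w (e r)) ` {..<p})"
    have l: "l \<le> w (e r)" if "r < p" for r unfolding l_def using that by (intro Min_le) auto
    have ge: "l \<le> w h" if h: "ev h \<noteq> 0" for h
    proof -
      obtain r j where "r < p" "w h \<ge> int j * ?y + w (e r)" using pick[OF h] by blast
      moreover have "0 \<le> int j * ?y" using \<open>\<not> ?y < 0\<close> by simp
      ultimately show ?thesis using l[of r] by linarith
    qed
    have "ev (g ^ nat (1 - l)) \<noteq> 0" using g by (simp add: ev_power)
    from ge[OF this] have "l \<le> int (nat (1 - l)) * w g" using pow[OF g(1)] by simp
    also have "\<dots> \<le> int (nat (1 - l)) * (- 1)" using g(2) by (intro mult_left_mono) auto
    finally show False using ge[of 1] one ev_1 by (auto split: if_splits)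
  qed
  have lower: "lo \<le> int p * w g + ?y * place g" if g: "ev g \<noteq> 0" for g
  proof -
    obtain r j where r: "r < p" "w g \<ge> int j * ?y + w (e r)"
      "place g \<le> place (e r) - int (p * j)" using pick[OF g] by blast
    have 1: "int p * (int j * ?y + w (e r)) \<le> int p * w g" using r(2) by (intro mult_left_mono) auto
    have "?y * (place (e r) - int (p * j)) \<le> ?y * place g"
      using r(3) y_neg by (intro mult_left_mono_neg) auto
    then show ?thesis using lo[OF r(1)] 1 by (simp add: algebra_simps)
  qed
  \<comment> \<open>The expression is additive in products, so the power 1 - \<open>lo\<close> of a
    counterexample would fall below \<open>lo\<close>.\<close>
  have lower0: "0 \<le> int p * w g + ?y * place g" if g: "ev g \<noteq> 0" for g
  proof (rule ccontr)
    let ?a = "int p * w g + ?y * place g"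
    assume "\<not> 0 \<le> ?a"
    define k where "k = nat (1 - lo)"
    have "ev (g ^ k) \<noteq> 0" using g by (simp add: ev_power)
    from lower[OF this] have "lo \<le> int k * ?a"
      using pow[OF g, of k] by (simp add: ev_power fls_subdegree_pow algebra_simps)
    also have "\<dots> \<le> int k * (- 1)" using \<open>\<not> 0 \<le> ?a\<close> by (intro mult_left_mono) auto
    finally have "1 - lo \<le> 0" by (auto simp: k_def split: if_splits)
    moreover have "lo \<le> 0" using lower[of 1] one by (simp add: ev_1)
    ultimately show False by simp
  qed
  have eqn: "int p * w g = - ?y * place g" if g: "ev g \<noteq> 0" for g
  proof -
    define a where "a = nat (- place g)"
    have a: "place g = - int a" using ev_subdegree[OF g] by (simp add: a_def)
    have gp: "ev (g ^ p) \<noteq> 0" using g by (simp add: ev_power)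
    have "place (g ^ p) = place (var_Y ^ a)"
      by (simp add: ev_power ev_Y fls_subdegree_pow a flip: power_mult)
    then obtain c where c: "c \<noteq> 0" "ev (g ^ p) = fls_const c * ev (var_Y ^ a) \<or>
        place (g ^ p) < fls_subdegree (ev (g ^ p) - fls_const c * ev (var_Y ^ a))"
      using fls_cancel_leading[OF gp Y] by metis
    let ?t = "scalar_XY c * var_Y ^ a"
    have evt: "ev ?t = fls_const c * ev (var_Y ^ a)" by (simp only: ev_mult ev_const coeval_const)
    have t: "ev ?t \<noteq> 0" unfolding evt using c(1) Y by simp
    have "ev var_Y \<noteq> 0" using Y[of 1] by simp
    then have wt: "w ?t = int a * ?y"
      using mult[of "scalar_XY c" "var_Y ^ a"] c(1) Y const[OF c(1)] pow[of var_Y a] by (simp add: ev_const)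
    have "w (g ^ p) = int a * ?y"
    proof (cases "ev (g ^ p - ?t) = 0")
      case True
      then have "w (g ^ p) = w ?t" using gp by (intro eq) (auto simp: ev_minus)
      then show ?thesis using wt by simp
    next
      case False
      let ?s = "g ^ p - ?t"
      have "place (g ^ p) < place ?s"
        using c(2) False unfolding ev_minus evt by auto
      then have s: "- int (p * a) < place ?s"
        by (simp add: ev_power fls_subdegree_pow a)
      have "?y * place ?s < ?y * (- int (p * a))" using s y_neg by (rule mult_strict_left_mono_neg)
      then have "int p * (int a * ?y) < int p * w ?s" using lower0[OF False] by (simp add: algebra_simps)
      then have ws: "int a * ?y < w ?s" by (simp add: mult_less_cancel_left)
      have "min (w ?s) (w ?t) \<le> w (?s + ?t)" by (rule add) (use False t gp in auto)
      then have ge: "int a * ?y \<le> w (g ^ p)" using ws wt by simp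
      have m: "ev (- ?s) \<noteq> 0" using False by (simp only: ev_uminus neg_equal_0_iff_equal not_False_eq_True)
      have "w (scalar_XY (- 1) * ?s) = w (scalar_XY (- 1)) + w ?s"
        by (rule mult) (use False in \<open>simp_all add: ev_const\<close>)
      moreover have "scalar_XY (- 1 :: 'a) = - 1" by (simp add: one_pCons)
      then have "scalar_XY (- 1) * ?s = - ?s" by (simp only: mult_minus1)
      ultimately have wm: "w (- ?s) = w ?s" using const[of "- 1"] by simp
      have "min (w (g ^ p)) (w (- ?s)) \<le> w (g ^ p + - ?s)" by (rule add) (use m t gp in auto)
      then have "min (w (g ^ p)) (w ?s) \<le> int a * ?y" using wm wt by simp
      then show ?thesis using ge ws by (auto simp: min_def split: if_splits)
    qed
    then show ?thesis using pow[OF g, of p] a by simp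
  qed
  obtain g1 h1 where gh: "ev g1 \<noteq> 0" "ev h1 \<noteq> 0" "place g1 = place h1 + 1"
    using order_difference_1 by blast
  \<comment> \<open>w is -k times the order. As both take values that differ by 1, k is 1 or -1, and
    \<open>w var_Y < 0\<close> selects -1.\<close>
  define k where "k = w h1 - w g1"
  have y: "?y = int p * k"
    using eqn[OF gh(1)] eqn[OF gh(2)] unfolding gh(3) by (simp add: k_def algebra_simps)
  have val: "w g = - k * place g" if "ev g \<noteq> 0" for g
  proof -
    have "int p * w g = int p * (- k * place g)" using eqn[OF that] unfolding y by simp
    then show ?thesis using p_pos by (subst (asm) mult_cancel_left) simp
  qed
  obtain g2 h2 where gh2: "ev g2 \<noteq> 0" "ev h2 \<noteq> 0" "w g2 = w h2 + 1"
    using w unfolding valuation_at_infinity_def f_dvd_iff by blast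
  then have "k * (place h2 - place g2) = 1"
    using val[OF gh2(1)] val[OF gh2(2)] by (simp add: algebra_simps)
  then have "k = 1 \<or> k = - 1" using zmult_eq_1_iff by auto
  moreover have "k < 0" using y_neg p_pos unfolding y by (simp add: mult_less_0_iff)
  ultimately show ?thesis using val[of g] g by (auto simp: f_dvd_iff)
qed

lemma one_regular_point: "one_regular_point_at_infinity f"
  unfolding one_regular_point_at_infinity_def
  using valuation_place place_residue valuation_unique by blast

end

section \<open>The weighted leading form\<close>

context plane_place
begin

lemma coeval_sum: "coeval (sum f S) = (\<Sum>s\<in>S. coeval (f s))"
  by (induction S rule: infinite_finite_induct) (simp_all add: coeval_add)

lemma coeval_minus: "coeval (f - g) = coeval f - coeval g"
  using coeval_add[of "f - g" g] by simp

lemma map_coeval_add: "map_poly coeval (f + g) = map_poly coeval f + map_poly coeval g"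
  by (rule poly_eqI) (simp add: coeff_map_poly coeval_add)

lemma map_coeval_mult: "map_poly coeval (f * g) = map_poly coeval f * map_poly coeval g"
  by (rule poly_eqI) (simp add: coeff_map_poly coeff_mult coeval_sum coeval_mult)

lemma map_coeval_power: "map_poly coeval (f ^ k) = map_poly coeval f ^ k"
proof (induction k)
  case 0
  have "coeval 1 = 1" using coeval_const[of 1] by (simp add: one_pCons del: coeval_const)
  then show ?case by simp
qed (simp add: map_coeval_mult)

end

context plane_place_relation
begin

text \<open>After Y \<mapsto> z^(-p) the polynomial f is \<beta> times the product over the
  conjugates of b, and \<open>G\<close> is the same product over their leading terms. Replacing the
  conjugates by these terms affects only lower weights.\<close>

lemma BC_type_f:
  assumes nmd: "p = n * d" "q = m * d" "coprime m n" "0 < m" "0 < n" "0 < d"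
    and \<beta>_eq: "\<beta> = (- 1 / (b $$ (- int q)) ^ n) ^ d"
  shows "BC_type n m d f"
proof -
  define c where "c = b $$ (- int q)"
  \<comment> \<open>Forced by \<alpha> a^n + y^m = 0 for the leading term a of b.\<close>
  define \<alpha> where "\<alpha> = - 1 / c ^ n"
  define a where "a = fls_const c * fls_X_inv ^ q"
  define G where "G = (monom [:\<alpha>:] n + [:monom 1 m:]) ^ d"
  have c: "c \<noteq> 0" using b_deg by (metis c_def nth_fls_subdegree_nonzero)
  then have a: "a \<noteq> 0" "\<alpha> \<noteq> 0" by (simp_all add: a_def \<alpha>_def)
  have \<beta>': "\<beta> = \<alpha> ^ d" using \<beta>_eq by (simp add: \<alpha>_def c_def)
  have "fls_const \<alpha> * - (a ^ n) = fls_const (\<alpha> * - (c ^ n)) * fls_X_inv ^ (q * n)"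
    by (simp add: a_def power_mult_distrib power_mult mult.assoc[symmetric] flip: fls_const_power)
  also have "\<alpha> * - (c ^ n) = 1" using c by (simp add: \<alpha>_def)
  also have "q * n = p * m" using nmd by (simp add: mult_ac)
  finally have an: "fls_const \<alpha> * - (a ^ n) = fls_X_inv ^ (p * m)" by simp
  have "map_poly coeval (monom [:\<alpha>:] n + [:monom 1 m:]) = monom (fls_const \<alpha>) n + [:fls_X_inv ^ (p * m):]"
    by (simp add: map_coeval_add map_poly_monom map_poly_pCons coeval_monom)
  also have "\<dots> = smult (fls_const \<alpha>) (monom 1 n + [:- (a ^ n):])"
    using an by (simp add: smult_add_right smult_monom)
  finally have "map_poly coeval G = smult (fls_const \<beta>) ((monom 1 n + [:- (a ^ n):]) ^ d)"
    by (simp add: G_def map_coeval_power smult_power \<beta>' fls_const_power)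
  also have "(monom 1 n + [:- (a ^ n):]) ^ d = (\<Prod>\<zeta> | \<zeta> ^ (n * d) = 1. [:- (fls_const (\<zeta> ^ (m * d)) * a), 1:])"
  proof (rule prod_linear_power_roots_power[symmetric])
    show "inj (fls_const :: 'a \<Rightarrow> 'a fls)" by (rule injI) (metis fls_const_nth)
  qed (use nmd a in auto)
  finally have mapG: "map_poly coeval G =
      smult (fls_const \<beta>) (\<Prod>\<zeta> | \<zeta> ^ p = 1. [:- (fls_const (\<zeta> ^ q) * a), 1:])"
    by (simp add: nmd)
  let ?Z = "{\<zeta> :: 'a. \<zeta> ^ p = 1}"
  let ?R = "\<Prod>\<zeta>\<in>?Z. [:- twist \<zeta> b, 1:]" and ?L = "\<Prod>\<zeta>\<in>?Z. [:- (fls_const (\<zeta> ^ q) * a), 1:]"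
  have card: "card ?Z = p" by (simp add: card_power_roots p_pos)
  then have fin: "finite ?Z" using p_pos by (intro card_ge_0_finite) simp
  have b0: "b $$ i = 0" if "i < - int q" for i
    using that b_deg by (intro fls_eq0_below_subdegree) simp
  have pert: "degle (coeff (?R - ?L) i)
      (int q * (int p - int i) - 1)" for i
  proof -
    have tw: "degle (twist \<zeta> b) (int q)" if "\<zeta> \<in> ?Z" for \<zeta>
      using that root_nonzero by (auto simp: degle_def twist_nth b0)
    have tw': "degle (fls_const (\<zeta> ^ q) * a) (int q)" for \<zeta>
      unfolding a_def degle_def by simp
    have "degle (twist \<zeta> b - fls_const (\<zeta> ^ q) * a) (int q - 1)" if "\<zeta> \<in> ?Z" for \<zeta>
      unfolding degle_def
    proof (intro allI impI)
      fix i assume "i < - (int q - 1)"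
      then consider "i < - int q" | "i = - int q" by linarith
      then show "(twist \<zeta> b - fls_const (\<zeta> ^ q) * a) $$ i = 0"
      proof cases
        case 1
        then show ?thesis using tw[OF that] tw'[of \<zeta>] by (simp only: degle_def fls_minus_nth diff_zero)
      next
        case 2
        have "\<zeta> \<noteq> 0" using that root_nonzero by auto
        then show ?thesis unfolding 2 by (simp add: twist_nth a_def c_def power_int_minus power_inverse)
      qed
    qed
    from prod_linear_perturbation[where i = i and r = "\<lambda>\<zeta>. twist \<zeta> b" and
        s = "\<lambda>\<zeta>. fls_const (\<zeta> ^ q) * a", OF fin tw tw' this]
    show ?thesis unfolding card by blast
  qed
  have "m * i + n * j < m * n * d" if nz: "coeff (coeff (f - G) i) j \<noteq> 0" for i j
  proof -
    let ?A = "coeff (f - G) i"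
    have "coeval ?A = coeff (map_poly coeval f) i - coeff (map_poly coeval G) i"
      by (simp add: coeff_map_poly coeval_minus)
    also have "\<dots> = fls_const \<beta> * coeff (?R - ?L) i"
      unfolding map_f mapG by (simp add: right_diff_distrib)
    finally have "degle (coeval ?A) (int q * (int p - int i) - 1)"
      using degle_mult[OF degle_const pert[of i], of \<beta>] by simp
    moreover have "?A \<noteq> 0" "j \<le> degree ?A" using nz by (auto intro: le_degree)
    ultimately have "int (p * degree ?A) \<le> int q * (int p - int i) - 1"
      using coeval_subdegree[of ?A] by (auto simp: degle_subdegree)
    moreover have "int (p * j) \<le> int (p * degree ?A)"
      using \<open>j \<le> degree ?A\<close> by (simp only: of_nat_le_iff mult_le_mono2)
    ultimately have "int (p * j) < int q * (int p - int i)" by linarith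
    then have "int d * (int (n * j) + int (m * i)) < int d * (int (m * n * d))"
      by (simp add: nmd algebra_simps)
    then have "int (n * j) + int (m * i) < int (m * n * d)" using nmd(6) by (simp only: mult_less_cancel_left_pos of_nat_0_less_iff)
    then show ?thesis by linarith
  qed
  then show ?thesis
    unfolding BC_type_def using irreducible_f one_regular_point nmd a(2) unfolding G_def by auto
qed

end

section \<open>The distance\<close>

text \<open>Membership in K((z^g)).\<close>

definition support_dvd :: "int \<Rightarrow> 'a::zero fls \<Rightarrow> bool" where
  "support_dvd g x \<longleftrightarrow> (\<forall>k. x $$ k \<noteq> 0 \<longrightarrow> g dvd k)"

lemma support_dvd_mult:
  fixes x y :: "'a::field_char_0 fls"
  assumes "support_dvd g x" "support_dvd g y"
  shows "support_dvd g (x * y)"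
  unfolding support_dvd_def
proof (intro allI impI)
  fix k assume "(x * y) $$ k \<noteq> 0"
  then obtain i where "x $$ i * y $$ (k - i) \<noteq> 0"
    unfolding fls_times_nth(2) by (metis (no_types, lifting) sum.not_neutral_contains_not_neutral)
  then have "g dvd i" "g dvd k - i" using assms by (auto simp: support_dvd_def)
  then show "g dvd k" by (metis add.commute diff_add_cancel dvd_add)
qed

lemma support_dvd_power: "support_dvd g x \<Longrightarrow> support_dvd g (x ^ n)" for x :: "'a::field_char_0 fls"
proof (induction n)
  case (Suc n)
  then show ?case by (simp add: support_dvd_mult)
qed (simp add: support_dvd_def)

lemma support_dvd_minus:
  fixes x y :: "'a::field_char_0 fls"
  assumes "support_dvd g x" "support_dvd g y"
  shows "support_dvd g (x - y)"
  unfolding support_dvd_def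
proof (intro allI impI)
  fix k assume "(x - y) $$ k \<noteq> 0"
  then have "x $$ k \<noteq> 0 \<or> y $$ k \<noteq> 0" by auto
  then show "g dvd k" using assms by (auto simp: support_dvd_def)
qed

lemma support_dvd_chop_fls:
  fixes y b :: "'a::field_char_0 fls"
  assumes "support_dvd g y" "support_dvd g b"
  shows "support_dvd g (chop_fls \<nu> \<mu> \<epsilon> y b i)"
proof (induction i)
  case (Suc i)
  have "support_dvd g (fls_const (\<epsilon> i ^ \<nu> i) * y ^ \<mu> i)"
    by (rule support_dvd_mult[OF _ support_dvd_power[OF assms(1)]]) (simp add: support_dvd_def)
  moreover have "support_dvd g (chop_fls \<nu> \<mu> \<epsilon> y b i ^ \<nu> i)" by (rule support_dvd_power[OF Suc.IH])
  ultimately show ?case by (simp only: chop_fls.simps support_dvd_minus)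
qed (simp add: assms)

text \<open>Cutting b off at z^p is a perturbation of order -p and preserves the leading terms of
  the sequence. If g divides d and the remaining exponents, the truncated sequence lies in K((z^g)),
  so g divides every \<open>w i\<close>.\<close>

lemma exponents_gcd_eq_1:
  fixes b :: "'a::field_char_0 fls"
  assumes b: "degle b (int (m * d))" and "d dvd p"
    and \<nu>: "\<And>i. i < I \<Longrightarrow> 1 \<le> \<nu> i"
    and lead: "\<And>i. i \<le> I \<Longrightarrow> degle (chop_fls \<nu> \<mu> \<epsilon> (fls_X_inv ^ p) b i) (int (w i))"
      "\<And>i. i \<le> I \<Longrightarrow> chop_fls \<nu> \<mu> \<epsilon> (fls_X_inv ^ p) b i $$ (- int (w i)) \<noteq> 0"
    and E: "\<And>i. i \<le> I \<Longrightarrow> (\<Sum>j<i. (\<nu> j - 1) * w j) < w i + p"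
    and gcd: "\<And>g. g dvd p \<Longrightarrow> (\<And>i. i \<le> I \<Longrightarrow> g dvd w i) \<Longrightarrow> g = 1"
  shows "exponents_gcd m d b (int p - 1) = 1"
proof -
  let ?y = "fls_X_inv ^ p :: 'a fls"
  let ?F = "chop_fls \<nu> \<mu> \<epsilon> ?y" and ?E = "\<lambda>i. \<Sum>j<i. (\<nu> j - 1) * w j"
  define g where "g = exponents_gcd m d b (int p - 1)"
  define b1 where "b1 = Abs_fls (\<lambda>k. if k \<le> int p - 1 then b $$ k else 0)"
  have "\<forall>\<^sub>\<infinity>n. (if - int n \<le> int p - 1 then b $$ (- int n) else 0) = 0"
    using fls_nth_vanishes_below_natE[of b] unfolding MOST_nat by (metis (no_types, lifting) MOST_nat)
  then have b1: "b1 $$ k = (if k \<le> int p - 1 then b $$ k else 0)" for k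
    unfolding b1_def by (subst nth_Abs_fls) auto
  have gd: "g dvd int d" unfolding g_def exponents_gcd_def by (rule Gcd_dvd) simp
  have "g dvd k" if "b $$ k \<noteq> 0" "k \<le> int p - 1" for k
  proof -
    have "- int (m * d) \<le> k" using b that by (auto simp: degle_def not_less[symmetric])
    then consider "k = - int (m * d)" | "- int (m * d) < k" by linarith
    then show ?thesis
    proof cases
      case 1
      then show ?thesis using gd by simp
    next
      case 2
      then show ?thesis using that unfolding g_def exponents_gcd_def by (intro Gcd_dvd) simp
    qed
  qed
  then have "support_dvd g b1" by (auto simp: support_dvd_def b1 split: if_splits)
  moreover have gp: "g dvd int p" using gd \<open>d dvd p\<close> by (meson dvd_trans of_nat_dvd_iff)
  then have "support_dvd g ?y" by (auto simp: support_dvd_def)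
  ultimately have supp: "support_dvd g (?F b1 i)" for i
    by (intro support_dvd_chop_fls)
  have gw: "g dvd int (w i)" if i: "i \<le> I" for i
  proof -
    have "degle (?F b1 i - ?F b i) (int (?E i) + - int p)"
    proof (rule fls.power_recursion_perturbation[where I = I])
      show "degle (?F b1 0 - ?F b 0) (- int p)"
        by (auto simp: degle_def b1)
      show "int (?E i) + - int p \<le> int (w i)" if "i \<le> I" for i
        using E[OF that] by linarith
    qed (use \<nu> lead i in auto)
    moreover have "- int (w i) < - (int (?E i) + - int p)" using E[OF i] by linarith
    ultimately have "(?F b1 i - ?F b i) $$ (- int (w i)) = 0"
      unfolding degle_def by blast
    then have "?F b1 i $$ (- int (w i)) \<noteq> 0" using lead(2)[OF i] by simp
    then have "g dvd - int (w i)" using supp[of i] unfolding support_dvd_def by blast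
    then show ?thesis by simp
  qed
  have "nat g = 1" 
  proof (rule gcd)
    have g0: "0 \<le> g" by (simp add: g_def exponents_gcd_def)
    show "nat g dvd p" using gp g0 by (metis int_nat_eq of_nat_dvd_iff)
    show "nat g dvd w i" if "i \<le> I" for i using gw[OF that] g0 by (metis int_nat_eq of_nat_dvd_iff)
  qed
  then show ?thesis unfolding g_def[symmetric] by (simp add: nat_eq_iff split: if_splits)
qed

text \<open>The greatest common divisor changes only at exponents of b, so the least e where it
  becomes 1 is such an exponent, and e \<le> p - 1. For d = 1 it is 1 from the outset, and the
  leading exponent gives distance 0.\<close>

lemma has_distance_le:
  fixes b :: "'a::field_char_0 fls"
  assumes puiseux: "puiseux_solution n m d f b" and "0 < d" "0 < p"
    and gcd: "exponents_gcd m d b (int p - 1) = 1"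
  shows "\<exists>\<delta>. has_distance n m d f \<delta> \<and> \<delta> \<le> int p + int (m * d) - 1"
proof -
  have b: "b \<noteq> 0" "fls_subdegree b = - int (m * d)" using puiseux by (auto simp: puiseux_solution_def)
  have low: "exponents_gcd m d b e = int d" if "e \<le> - int (m * d)" for e
  proof -
    have empty: "{k. - int (m * d) < k \<and> k \<le> e \<and> fls_nth b k \<noteq> 0} = {}" using that by auto
    show ?thesis unfolding exponents_gcd_def empty by simp
  qed
  show ?thesis
  proof (cases "d = 1")
    case True
    have "exponents_gcd m d b e = 1" for e using True by (simp add: exponents_gcd_def)
    moreover have "b $$ (- int (m * d)) \<noteq> 0" using b by (metis nth_fls_subdegree_nonzero)
    moreover have "b $$ e = 0" if "e < - int (m * d)" for e
      using that b by (intro fls_eq0_below_subdegree) simp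
    ultimately have "has_distance n m d f 0"
      unfolding has_distance_def using puiseux
      by (intro exI[of _ b] exI[of _ "- int (m * d)"]) auto
    moreover have "0 \<le> int p + int (m * d) - 1" using \<open>0 < p\<close> by linarith
    ultimately show ?thesis by blast
  next
    case False
    \<comment> \<open>The shift by md makes the candidates natural numbers, so that a least one
      exists.\<close>
    let ?Q = "\<lambda>N :: nat. exponents_gcd m d b (int N - int (m * d)) = 1"
    define N where "N = Least ?Q"
    have top: "?Q (p - 1 + m * d)" using gcd \<open>0 < p\<close> by (simp add: of_nat_diff)
    have N: "?Q N" "N \<le> p - 1 + m * d" "\<And>M. M < N \<Longrightarrow> \<not> ?Q M"
      using LeastI[of ?Q, OF top] Least_le[of ?Q, OF top] not_less_Least[of _ ?Q] by (auto simp: N_def)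
    define e where "e = int N - int (m * d)"
    have "N \<noteq> 0" using N(1) low[of "- int (m * d)"] False by (intro notI) simp
    have e: "exponents_gcd m d b e = 1" using N(1) by (simp add: e_def)
    have less: "exponents_gcd m d b e' \<noteq> 1" if "e' < e" for e'
    proof (cases "e' \<le> - int (m * d)")
      case True
      then show ?thesis using low[OF True] False by simp
    next
      case False
      then have "nat (e' + int (m * d)) < N" using that by (simp add: e_def)
      moreover have "int (nat (e' + int (m * d))) - int (m * d) = e'" using False by linarith
      ultimately show ?thesis using N(3) by metis
    qed
    have "b $$ e \<noteq> 0"
    proof
      assume "b $$ e = 0"
      then have "{k. - int (m * d) < k \<and> k \<le> e \<and> fls_nth b k \<noteq> 0} =
          {k. - int (m * d) < k \<and> k \<le> e - 1 \<and> fls_nth b k \<noteq> 0}"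
        by (smt (verit) Collect_cong)
      then have "exponents_gcd m d b (e - 1) = 1" using e unfolding exponents_gcd_def by simp
      then show False using less[of "e - 1"] by simp
    qed
    then have "has_distance n m d f (int (m * d) + e)"
      unfolding has_distance_def using puiseux e less by blast
    moreover have "int (m * d) + e \<le> int p + int (m * d) - 1"
      using N(2) \<open>0 < p\<close> unfolding e_def by linarith
    ultimately show ?thesis by blast
  qed
qed

section \<open>The commuting pair\<close>

lemma head_chop_commute:
  assumes "X * P = P * X" "X * Q = Q * X"
  shows "X * head_chop \<nu> \<mu> \<epsilon> P Q i = head_chop \<nu> \<mu> \<epsilon> P Q i * X"
proof (induction i)
  case (Suc i)
  have pow: "X * A ^ k = A ^ k * X" if "X * A = A * X" for A k
  proof (induction k)
    case (Suc k)
    have "X * A ^ Suc k = A * (X * A ^ k)" by (simp add: that mult.assoc flip: mult.assoc[of X A])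
    then show ?case by (simp add: Suc.IH mult.assoc)
  qed simp
  have "X * (dconst c * A) = dconst c * A * X" if "X * A = A * X" for A c
  proof -
    have "X * (dconst c * A) = dconst c * (X * A)" by (simp add: dconst_commute[of c X] flip: mult.assoc)
    then show ?thesis by (simp add: that mult.assoc)
  qed
  then show ?case
    using pow[OF Suc.IH] pow[OF assms(1)] by (simp add: left_diff_distrib right_diff_distrib)
qed (simp add: assms)

text \<open>The orders of operators with constant symbol commuting with P and Q form a semigroup
  containing p and all \<open>w i\<close>, so the residue 1 occurs.\<close>

lemma commuting_order_1_operator:
  fixes P Q :: "'a::field_char_0 dsym"
  assumes cp: "chopped_pair P Q \<nu> \<mu> \<epsilon> I w c" and PQ: "Q * P = P * Q"
    and P: "leads P p 1" "0 < p"
    and gcd: "\<And>g. g dvd p \<Longrightarrow> (\<And>i. i \<le> I \<Longrightarrow> g dvd w i) \<Longrightarrow> g = 1"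
  obtains R x where "x mod p = 1 mod p" "leads R x 1" "R * P = P * R" "Q * R = R * Q"
proof -
  interpret chopped_pair P Q \<nu> \<mu> \<epsilon> I w c by (rule cp)
  define G where "G = {x. \<exists>R e. e \<noteq> 0 \<and> leads R x e \<and> R * P = P * R \<and> Q * R = R * Q}"
  have hc: "w i \<in> G" if "i \<le> I" for i
    unfolding G_def
  proof (intro CollectI exI conjI)
    show "leads (head_chop \<nu> \<mu> \<epsilon> P Q i) (w i) (c i)" "c i \<noteq> 0"
      using chop_leads[OF that] chop_nonzero[OF that] by auto
    show "head_chop \<nu> \<mu> \<epsilon> P Q i * P = P * head_chop \<nu> \<mu> \<epsilon> P Q i"
      by (rule head_chop_commute[symmetric]) (simp_all add: PQ)
    show "Q * head_chop \<nu> \<mu> \<epsilon> P Q i = head_chop \<nu> \<mu> \<epsilon> P Q i * Q"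
      by (rule head_chop_commute) (simp_all add: PQ)
  qed
  have pG: "p \<in> G" unfolding G_def using P(1) PQ by (intro CollectI exI[of _ P] exI[of _ 1]) simp
  have "\<exists>x\<in>G. x mod p = 1 mod p"
  proof (rule semigroup_residue_1)
    fix x y assume "x \<in> G" "y \<in> G"
    then obtain R e R' e' where R: "e \<noteq> 0" "leads R x e" "R * P = P * R" "Q * R = R * Q"
      "e' \<noteq> 0" "leads R' y e'" "R' * P = P * R'" "Q * R' = R' * Q" unfolding G_def by blast
    then have "R * R' * P = P * (R * R')" "Q * (R * R') = R * R' * Q" by (metis mult.assoc)+
    then show "x + y \<in> G" unfolding G_def
      using leads_mult[OF R(2,6)] R(1,5) by (intro CollectI exI[of _ "R * R'"] exI[of _ "e * e'"]) simp
  next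
    show "0 \<in> G" unfolding G_def using leads_1 by (intro CollectI exI[of _ 1] exI[of _ 1]) simp
  next
    fix g assume "\<And>x. x \<in> G \<Longrightarrow> g dvd x"
    then show "g = 1" using gcd[of g] hc pG by blast
  qed (use pG P in auto)
  then obtain x R e where R: "x mod p = 1 mod p" "e \<noteq> 0" "leads R x e" "R * P = P * R" "Q * R = R * Q"
    unfolding G_def by blast
  have "leads (dconst (1 / e) * R) x 1"
    using leads_mult[OF leads_dconst R(3), of "1 / e"] R(2) by simp
  moreover have "dconst (1 / e) * R * P = P * (dconst (1 / e) * R)"
    by (metis R(4) dconst_commute mult.assoc)
  moreover have "Q * (dconst (1 / e) * R) = dconst (1 / e) * R * Q"
    by (metis R(5) dconst_commute mult.assoc)
  ultimately show ?thesis using that R(1) by blast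
qed

lemma eigen_conj:
  assumes "eigen \<phi> A a" "U * T = 1"
  shows "eigen (\<lambda>k. lcomb \<phi> (rep T k)) (T * A * U) a"
  unfolding eigen_def
proof
  fix k
  have "lcomb (\<lambda>m. lcomb \<phi> (rep T m)) (rep (T * A * U) k) = lcomb \<phi> (rep (T * A * (U * T)) k)"
    by (simp only: lcomb_rep_mult[symmetric] mult.assoc)
  also have "\<dots> = lcomb \<phi> (rep (T * A) k)" by (simp only: assms(2) mult_1_right)
  also have "\<dots> = lcomb (\<lambda>m. a * \<phi> m) (rep T k)"
    using assms(1) by (simp only: lcomb_rep_mult eigen_def)
  finally show "lcomb (\<lambda>m. lcomb \<phi> (rep T m)) (rep (T * A * U) k) = a * lcomb \<phi> (rep T k)"
    by (simp only: lcomb_mult_left)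
qed

lemma eigen_eval_XY:
  "eigen \<phi> P y \<Longrightarrow> eigen \<phi> Q b \<Longrightarrow> eigen \<phi> (eval_XY dconst g Q P) (eval_XY fls_const g b y)"
  unfolding eval_XY_def by (intro eigen_sum eigen_mult eigen_power eigen_dconst)

text \<open>Places the \<open>w i\<close> among the orders on the coordinate ring of the
  curve.\<close>

lemma chop_fls_peval:
  fixes b y :: "'a::field_char_0 fls"
  shows "\<exists>g. peval (peval fls_const y) b g = chop_fls \<nu> \<mu> \<epsilon> y b i"
proof -
  let ?k = "peval fls_const y"
  have k0: "?k 0 = 0" by simp
  have ka: "?k (f + g) = ?k f + ?k g" and km: "?k (f * g) = ?k f * ?k g" for f g
    by (auto simp flip: fls_plus_const intro!: peval_add peval_mult)
  have const: "?k [:c:] = fls_const c" for c by (simp add: peval_pCons)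
  have add: "peval ?k b (f + g) = peval ?k b f + peval ?k b g" for f g
    by (rule peval_add) (simp_all add: ka)
  have mult: "peval ?k b (f * g) = peval ?k b f * peval ?k b g" for f g
    by (rule peval_mult) (simp_all add: ka km)
  have c: "peval ?k b [:f:] = ?k f" for f by (simp add: peval_pCons)
  have one: "peval ?k b 1 = 1" using c[of 1] const[of 1] by (simp add: one_pCons)
  have pow: "peval ?k b (f ^ j) = peval ?k b f ^ j" for f j by (induction j) (simp_all add: one mult)
  have Y: "peval ?k b var_Y = y" by (simp add: c peval_pCons)
  have X: "peval ?k b var_X = b" using const[of 1] by (simp add: peval_pCons one_pCons)
  show ?thesis
  proof (induction i)
    case 0
    show ?case using X by (intro exI[of _ var_X]) simp
  next
    case (Suc i)
    then obtain g where g: "peval ?k b g = chop_fls \<nu> \<mu> \<epsilon> y b i" by blast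
    have "peval ?k b (g ^ \<nu> i + scalar_XY (- (\<epsilon> i ^ \<nu> i)) * var_Y ^ \<mu> i) =
        chop_fls \<nu> \<mu> \<epsilon> y b i ^ \<nu> i + fls_const (- (\<epsilon> i ^ \<nu> i)) * y ^ \<mu> i"
      unfolding add mult pow Y g by (simp only: c const)
    then show ?case by (intro exI[of _ "g ^ \<nu> i + scalar_XY (- (\<epsilon> i ^ \<nu> i)) * var_Y ^ \<mu> i"]) simp
  qed
qed

lemma generated_algebra_head_chop:
  "head_chop \<nu> \<mu> \<epsilon> P Q i \<in> generated_algebra {P, Q}"
proof -
  have "head_chop \<nu> \<mu> \<epsilon> P Q i \<in> B" if B: "dsubalgebra B" "{P, Q} \<subseteq> B" for B
  proof -
    have const: "dconst c \<in> B" for c using B(1) by (auto simp: dsubalgebra_def)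
    have add: "L + M \<in> B" and mult: "L * M \<in> B" if "L \<in> B" "M \<in> B" for L M
      using B(1) that by (auto simp: dsubalgebra_def)
    have pow: "L ^ k \<in> B" if "L \<in> B" for L k
      by (induction k) (use const[of 1] that mult in \<open>auto simp: dconst_1\<close>)
    show ?thesis
    proof (induction i)
      case (Suc i)
      have "head_chop \<nu> \<mu> \<epsilon> P Q i ^ \<nu> i + dconst (- 1) * (dconst (\<epsilon> i ^ \<nu> i) * P ^ \<mu> i) \<in> B"
        by (intro add mult pow const Suc.IH) (use B(2) in auto)
      moreover have "dconst (- 1) * L = - L" for L :: "'a dsym"
        by (rule rep_inject) (simp add: rep_dconst_mult)
      ultimately show ?case by simp
    qed (use B(2) in auto)
  qed
  then show ?thesis unfolding generated_algebra_def hull_def by blast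
qed

lemma generators_in_generated_algebra: "X \<subseteq> generated_algebra X"
  unfolding generated_algebra_def by (rule hull_subset)

lemma rk_eq_1I:
  assumes "\<And>g. (\<And>L. L \<in> B \<Longrightarrow> L \<noteq> 0 \<Longrightarrow> g dvd dord L) \<Longrightarrow> g = 1"
  shows "rk B = 1"
  unfolding rk_def by (rule assms) (auto intro: Gcd_dvd)

theorem theorem5p1:
  fixes P Q S Qt Qt' :: "'a::{alg_closed_field, field_char_0} dsym"
    and p q n m d I :: nat and \<nu> \<mu> :: "nat \<Rightarrow> nat" and \<epsilon> :: "nat \<Rightarrow> 'a"
  assumes "orders_agree P" and "dord P = p" and "p = n * d" and "symb P = dD ^ p"
    and "orders_agree Q" and "dord Q = q" and "q = m * d"
    and "coprime m n" and "1 < m" and "1 < n"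
    and "Q * P - P * Q = 1"
    and "head_chopping_sequence \<nu> \<mu> \<epsilon> I P Q"
    and "\<forall>i\<le>I. orders_agree (head_chop \<nu> \<mu> \<epsilon> P Q i)"
    and "SeqGCD \<nu> \<mu> \<epsilon> P Q (int I) = 1" and "SeqGCD \<nu> \<mu> \<epsilon> P Q (int I - 1) > 1"
    and "schur_operator P S" and "monic_order_zero S"
    and "Qt = dinv S * Q * S"
    and "Qt' = Qt - hcomp Qt (- int p)"
  shows "\<exists>P' Q'.
       P' \<in> D1 \<and> Q' \<in> D1 \<and> P' * Q' = Q' * P' \<and>
       formally_elliptic P' \<and> formally_elliptic Q' \<and>
       monic_op P' \<and> normalized_op P' \<and> dord P' = p \<and> dord Q' = q \<and>
       rk (generated_algebra {P', Q'}) = 1 \<and>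
       normal_form P' Q' Qt' \<and>
       head_chopping_sequence \<nu> \<mu> \<epsilon> I (dD ^ p) Qt' \<and>
       (\<exists>s. sequence_of \<nu> \<mu> \<epsilon> I P Q s \<and> sequence_of \<nu> \<mu> \<epsilon> I (dD ^ p) Qt' s) \<and>
       (\<exists>f. spectral_polynomial f P' Q' \<and> BC_type n m d f \<and>
          (\<exists>\<delta>. has_distance n m d f \<delta> \<and> \<delta> \<le> int p + int q - 1))"
proof -
  let ?y = "fls_X_inv ^ p :: 'a fls"
  define w where "w = (\<lambda>i. dord (head_chop \<nu> \<mu> \<epsilon> P Q i))"
  \<comment> \<open>d = 0 would give P and Q degree 0 in \<partial>, but a commutator with leading
    term 1 needs a positive sum of degrees.\<close>
  have "leads (Q * P - P * Q) 0 1" using assms(11) leads_1 by simp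
  then have "0 < dord Q + dord P"
    using leads_commutator_le[of Q P 0 1] assms(1,5) by (simp add: orders_agree_def)
  then have d: "0 < d" using assms(2,3,6,7) by (cases "d = 0") auto
  then have p: "0 < p" using assms(3,10) by simp

  obtain c where cp: "chopped_pair P Q \<nu> \<mu> \<epsilon> I w c"
    using chopped_pairI[OF assms(12,13)] unfolding w_def by blast
  interpret PQ: chopped_pair P Q \<nu> \<mu> \<epsilon> I w c by (rule cp)
  note nf = chopped_pair_normal_form[OF assms(1,2,11,13) cp[unfolded w_def] assms(16-19), folded w_def]
  interpret N: chopped_pair "dD ^ p" Qt' \<nu> \<mu> \<epsilon> I w c by (rule nf(2))
  have gcd: "g = 1" if "g dvd p" "\<And>i. i \<le> I \<Longrightarrow> g dvd w i" for g
  proof (rule SeqGCD_eq_1D[OF assms(14) _ _ that])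
    show "Ord P = int p" using assms(1,2) by (simp add: orders_agree_def)
    show "Ord (head_chop \<nu> \<mu> \<epsilon> P Q i) = int (w i)" if "i \<le> I" for i
      using assms(13) that by (simp add: orders_agree_def w_def)
  qed
  have w0: "w 0 = q" using assms(6) by (simp add: w_def)

  obtain R x where R: "x mod p = 1 mod p" "leads R x 1" "R * dD ^ p = dD ^ p * R" "Qt' * R = R * Qt'"
    by (rule commuting_order_1_operator[OF nf(2,3) leads_dD_power p gcd])
  obtain \<phi> \<rho> where \<phi>: "graded \<phi>" "\<And>k. \<phi> (k + p) = ?y * \<phi> k" "eigen \<phi> R \<rho>"
    and \<rho>: "degle \<rho> (int x)" "\<rho> $$ (- int x) = 1"
    using eigenvector_exists[OF p R(1) R(3) R(2)] by blast
  obtain b where b: "eigen \<phi> Qt' b"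
    by (rule eigen_commuting[OF p R(1) R(2) \<phi> \<rho> nf(3) R(4)])
  have y: "eigen \<phi> (dD ^ p) ?y" unfolding eigen_def lcomb_rep_dD_power using \<phi>(2) by blast
  let ?F = "chop_fls \<nu> \<mu> \<epsilon> ?y b"
  have chop: "eigen \<phi> (head_chop \<nu> \<mu> \<epsilon> (dD ^ p) Qt' i) (?F i)" for i
    by (rule eigen_head_chop[OF y b])
  have chop_deg: "degle (?F i) (int (w i))"
    "?F i $$ (- int (w i)) = c i" if "i \<le> I" for i
    using eigen_leads[OF \<phi>(1) chop N.chop_leads[OF that]] by auto
  have b_lead: "degle b (int q)" "b $$ (- int q) \<noteq> 0"
    using chop_deg[of 0] N.chop_nonzero[of 0] w0 by auto
  have b_sub: "b \<noteq> 0" "fls_subdegree b = - int q"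
    using b_lead by (auto simp: degle_def intro!: fls_subdegree_eqI)

  obtain T where T: "leads T 0 1" "baker_akhiezer (\<lambda>k. lcomb \<phi> (rep T k))"
    using baker_akhiezer_exists[OF \<phi>(1)] .
  obtain U where U: "leads U 0 1" "U * T = 1" "T * U = 1" using leads_inverse[OF T(1)] .
  define v where "v = (\<lambda>k. lcomb \<phi> (rep T k))"
  interpret v: baker_akhiezer_family v by standard (use T(2) in \<open>simp add: v_def\<close>)
  have conj: "eigen v (T * A * U) a" if "eigen \<phi> A a" for A a
    unfolding v_def by (rule eigen_conj[OF that U(2)])
  \<comment> \<open>T is to be the Schur operator of \<open>P'\<close>; conjugation by it takes W to
    the basis v, where eigenvalues with poles belong to differential operators.\<close>
  define P' where "P' = T * dD ^ p * U"
  define Q' where "Q' = T * Qt' * U"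
  have eP: "eigen v P' ?y" unfolding P'_def by (rule conj[OF y])
  have eQ: "eigen v Q' b" unfolding Q'_def by (rule conj[OF b])
  have hc': "head_chop \<nu> \<mu> \<epsilon> P' Q' i = T * head_chop \<nu> \<mu> \<epsilon> (dD ^ p) Qt' i * U" for i
    unfolding P'_def Q'_def by (rule head_chop_conj[symmetric, OF U(2,3)])

  note yP = degle_X_inv_power[of p, where ?'a = 'a]
  have dP: "dcoeff P' p = 1" "\<And>l. p < l \<Longrightarrow> dcoeff P' l = 0"
    using v.eigen_differential[OF eP yP] by auto
  have P': "P' \<in> D1" "dord P' = p" "P' \<noteq> 0" using dordI[of p P'] dP by auto
  have dQ: "dcoeff Q' q = fps_const (b $$ (- int q))" "\<And>l. q < l \<Longrightarrow> dcoeff Q' l = 0"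
    using v.eigen_differential[OF eQ b_lead(1)] by auto
  have Q': "Q' \<in> D1" "dord Q' = q" "Q' \<noteq> 0" using dordI[of q Q'] dQ b_lead(2) by auto
  have comm: "P' * Q' = Q' * P'"
    using eigen_unique_operator[OF v.graded_v eigen_mult[OF eP eQ], of "Q' * P'"] eigen_mult[OF eQ eP]
    by (simp add: mult.commute)
  have monic: "monic_op P'" using P' dP by (simp add: monic_op_def)
  have normalized: "normalized_op P'"
    unfolding normalized_op_def using monic v.eigen_normalized[of P'] eP P'(2) by metis
  have ell: "formally_elliptic P'" "formally_elliptic Q'"
    unfolding formally_elliptic_def using P' Q' dP dQ b_lead(2)
    by (auto intro!: exI[of _ 1] exI[of _ "b $$ (- int q)"])

  have schur: "schur_operator P' T"
    unfolding schur_operator_def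
  proof (intro conjI)
    have lP: "leads P' p 1" using leads_mult[OF leads_mult[OF T(1) leads_dD_power] U(1)] by (simp add: P'_def)
    show "orders_agree P'" using P' leads_Ord[OF lP] by (simp add: orders_agree_def)
    show "symb P' = dD ^ dord P'" using leads_symb[OF lP] P'(2) by (simp add: dconst_1)
    show "dinvertible T" using U unfolding dinvertible_def by blast
    show "Ord T = 0" using leads_Ord[OF T(1)] by simp
    have "dinv T * P' * T = (U * T) * dD ^ p * (U * T)"
      using dinv_unique[OF U(3,2)] by (simp add: P'_def mult.assoc)
    then show "dinv T * P' * T = dD ^ dord P'" using U P'(2) by simp
  qed
  have "dinv T * Q' * T = (U * T) * Qt' * (U * T)"
    using dinv_unique[OF U(3,2)] by (simp add: Q'_def mult.assoc)
  then have normal: "normal_form P' Q' Qt'" unfolding normal_form_def using schur U by auto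

  \<comment> \<open>The chopped sequence of \<open>P'\<close> and \<open>Q'\<close> has the
    eigenvalues \<open>?F i\<close>, whose pole orders \<open>w i\<close> are now degrees in
    \<partial>.\<close>
  have rank: "rk (generated_algebra {P', Q'}) = 1"
  proof (rule rk_eq_1I)
    fix g assume g: "\<And>L. L \<in> generated_algebra {P', Q'} \<Longrightarrow> L \<noteq> 0 \<Longrightarrow> g dvd dord L"
    show "g = 1"
    proof (rule gcd)
      show "g dvd p" using g[of P'] P' generators_in_generated_algebra[of "{P', Q'}"] by auto
      fix i assume i: "i \<le> I"
      let ?H = "head_chop \<nu> \<mu> \<epsilon> P' Q' i"
      have "eigen v ?H (?F i)" unfolding hc' by (rule conj[OF chop])
      from v.eigen_differential[OF this chop_deg(1)[OF i]] have "dord ?H = w i" "?H \<noteq> 0"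
        using dordI[of "w i" ?H] chop_deg(2)[OF i] N.chop_nonzero[OF i] by auto
      then show "g dvd w i" using g[OF generated_algebra_head_chop] by metis
    qed
  qed

  interpret plane_place b p q "w ` {..I}"
  proof
    fix g assume nz: "curve_eval p b g \<noteq> 0"
    have "eigen \<phi> (eval_XY dconst g Qt' (dD ^ p)) (curve_eval p b g)"
      using eigen_eval_XY[OF y b, of g] by (simp add: eval_XY_peval)
    then show "fls_subdegree (curve_eval p b g) \<le> 0"
      using nz by (rule eigen_subdegree_le_0[OF \<phi>(1)])
  next
    fix x assume "x \<in> w ` {..I}"
    then obtain i where i: "i \<le> I" "x = w i" by auto
    obtain g where g: "curve_eval p b g = ?F i"
      using chop_fls_peval by blast
    have "?F i $$ (- int x) \<noteq> 0" using chop_deg(2)[OF i(1)] N.chop_nonzero[OF i(1)] i(2) by simp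
    then have "?F i \<noteq> 0" "fls_subdegree (?F i) = - int x"
      using chop_deg(1)[OF i(1)] i(2) by (auto simp: degle_def intro!: fls_subdegree_eqI)
    then show "\<exists>g. curve_eval p b g \<noteq> 0 \<and> fls_subdegree (curve_eval p b g) = - int x"
      using g by metis
  qed (use p b_sub gcd in auto)
  \<comment> \<open>The coefficient \<alpha>^d of X^(nd) in (\<alpha> X^n + Y^m)^d.\<close>
  define \<beta> where "\<beta> = (- 1 / (b $$ (- int q)) ^ n) ^ d"
  have \<beta>: "\<beta> \<noteq> 0" using b_lead(2) by (simp add: \<beta>_def)
  obtain f where f: "ev f = 0" "degree f = p" "lead_coeff f = [:\<beta>:]" by (rule minimal_relation[OF \<beta>])
  interpret plane_place_relation b p q "w ` {..I}" f \<beta> by standard (use f \<beta> in auto)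
  have BC: "BC_type n m d f"
    by (rule BC_type_f) (use assms(3,7,8,9,10) d \<beta>_def in auto)
  have evf: "eval_XY fls_const f b ?y = 0"
    using f(1) by (simp add: ev_def coeval_def eval_XY_peval)
  \<comment> \<open>An operator is determined by its eigenvalue, so the relation passes from K((z))
    to the operators.\<close>
  have "eigen v (eval_XY dconst f Q' P') 0" using eigen_eval_XY[OF eP eQ, of f] by (simp add: evf)
  then have "eval_XY dconst f Q' P' = 0" using eigen_unique_operator[OF v.graded_v _ eigen_0] by blast
  then have spec: "spectral_polynomial f P' Q'" using irreducible_f by (simp add: spectral_polynomial_def)
  have "puiseux_solution n m d f b"
    using b_sub evf by (simp add: puiseux_solution_def assms(3,7))
  moreover have "exponents_gcd m d b (int p - 1) = 1"
  proof (rule exponents_gcd_eq_1[where I = I and \<nu> = \<nu> and \<mu> = \<mu> and \<epsilon> = \<epsilon> and w = w])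
    show "degle b (int (m * d))" "d dvd p" using b_lead(1) assms(3,7) by auto
    show "(\<Sum>j<i. (\<nu> j - 1) * w j) < w i + p" if "i \<le> I" for i
      using nf(1)[OF that] by (simp add: w_def)
  qed (use N.chop_exponent chop_deg N.chop_nonzero gcd in auto)
  ultimately have dist: "\<exists>\<delta>. has_distance n m d f \<delta> \<and> \<delta> \<le> int p + int q - 1"
    using has_distance_le[of n m d f b p] d p assms(7) by simp

  have hcs: "head_chopping_sequence \<nu> \<mu> \<epsilon> I (dD ^ p) Qt'" by (rule N.head_chopping) (simp add: nf(3))
  show ?thesis
    by (rule exI[of _ P'], rule exI[of _ Q'])
      (use P' Q' comm ell monic normalized rank normal hcs PQ.sequence N.sequence spec BC dist in blast)
qed

end
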